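(* Let $q\in[1,\infty]$ and let $A$ be the stochastic pseudo-differential operator with symbol $a$. If $a\in S^0_\infty$, then $A:L^q_{\mathcal{F}}(0,T;L^2(\mathbb{R}^n))\to L^q_{\mathcal{F}}(0,T;L^2(\mathbb{R}^n))$ is bounded.
   Context: $(\Omega,\mathcal{F},\{\mathcal{F}_t\}_{t\ge0},P)$ is a complete filtered probability space and $T>0$. For a Banach space $H$ and $q\in[1,\infty)$, $L^q_{\mathcal{F}}(0,T;H)$ is the space of $H$-valued $\{\mathcal{F}_t\}$-adapted processes $X$ with $\mathbb{E}\int_0^T|X(t)|_H^qdt<\infty$; for $q=\infty$ it is the space of bounded adapted processes; $L^q_{\mathcal{F}}(0,T)$ is the scalar case. $S^0_\infty$ is the set of complex-valued functions $a(t,\omega,x,\xi)$ such that $a(t,\omega,\cdot,\cdot)\in C^\infty(\mathbb{R}^n\times\mathbb{R}^n)$ for a.e. $(t,\omega)\in(0,T)\times\Omega$; $a(\cdot,\cdot,x,\xi)$ is $\{\mathcal{F}_t\}$-adapted for all $(x,\xi)$; and for all multi-indices $\alpha,\beta$ there is a nonnegative $M_{\alpha,\beta}\in L^\infty_{\mathcal{F}}(0,T)$ with $|\partial_\xi^\alpha\partial_x^\beta a(t,\omega,x,\xi)|\le M_{\alpha,\beta}(t,\omega)(1+|\xi|)^{-|\alpha|}$ for a.e. $(t,\omega)$ and all $(x,\xi)\in\mathbb{R}^n\times\mathbb{R}^n$. The stochastic pseudo-differential operator with symbol $a$ is $(Au)(t,\omega,x)=(2\pi)^{-n}\int_{\mathbb{R}^n}e^{ix\cdot\xi}a(t,\omega,x,\xi)\hat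 u(t,\omega,\xi)d\xi$, with $\hat u(t,\omega,\xi)=\int e^{-ix\cdot\xi}u(t,\omega,x)dx$ (acting for a.e. $(t,\omega)$ as a usual pseudo-differential operator). *)

theory Defs
  imports "HOL-Probability.Probability"
begin

section \<open>The Hilbert space of complex-valued square-integrable functions\<close>

definition square_integrable :: "('a::euclidean_space \<Rightarrow> complex) \<Rightarrow> bool" where
  "square_integrable f \<longleftrightarrow>
     f \<in> borel_measurable lborel \<and> integrable lborel (\<lambda>x. (norm (f x))\<^sup>2)"

definition L2_eq :: "('a::euclidean_space \<Rightarrow> complex) \<Rightarrow> ('a \<Rightarrow> complex) \<Rightarrow> bool" where
  "L2_eq f g \<longleftrightarrow> square_integrable f \<and> square_integrable g \<and> (AE x in lborel. f x = g x)"

lemma square_integrable_zero: "square_integrable (\<lambda>_. 0)"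
  by (simp add: square_integrable_def)

lemma square_integrable_measurable:
  "square_integrable f \<Longrightarrow> f \<in> borel_measurable lborel"
  by (simp add: square_integrable_def)

lemma square_integrable_cmult:
  assumes "square_integrable f"
  shows "square_integrable (\<lambda>x. c * f x)"
  using assms by (auto simp: square_integrable_def norm_mult power_mult_distrib)

lemma square_integrable_scaleR:
  "square_integrable f \<Longrightarrow> square_integrable (\<lambda>x. r *\<^sub>R f x)"
  using square_integrable_cmult[of f "of_real r"] by (simp add: scaleR_conv_of_real)

lemma square_integrable_uminus:
  "square_integrable f \<Longrightarrow> square_integrable (\<lambda>x. - f x)"
  by (simp add: square_integrable_def)

lemma square_integrable_add:
  assumes "square_integrable f" "square_integrable g"
  shows "square_integrable (\<lambda>x. f x + g x)"
proof -
  have meas [measurable]: "f \<in> borel_measurable borel" "g \<in> borel_measurable borel"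
    using assms by (auto simp: square_integrable_def)
  have "(norm (f x + g x))\<^sup>2 \<le> 2 * (norm (f x))\<^sup>2 + 2 * (norm (g x))\<^sup>2" for x
  proof -
    have "(norm (f x + g x))\<^sup>2 \<le> (norm (f x) + norm (g x))\<^sup>2"
      by (intro power_mono norm_triangle_ineq) auto
    also have "\<dots> \<le> 2 * (norm (f x))\<^sup>2 + 2 * (norm (g x))\<^sup>2"
      using zero_le_power2[of "norm (f x) - norm (g x)"] by (simp add: power2_eq_square algebra_simps)
    finally show ?thesis .
  qed
  moreover have "integrable lborel (\<lambda>x. 2 * (norm (f x))\<^sup>2 + 2 * (norm (g x))\<^sup>2)"
    using assms by (auto simp: square_integrable_def)
  ultimately have "integrable lborel (\<lambda>x. (norm (f x + g x))\<^sup>2)"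
    by (intro Bochner_Integration.integrable_bound[where
          f = "\<lambda>x. 2 * (norm (f x))\<^sup>2 + 2 * (norm (g x))\<^sup>2" and g = "\<lambda>x. (norm (f x + g x))\<^sup>2"]) auto
  then show ?thesis by (simp add: square_integrable_def)
qed

lemma square_integrable_diff:
  assumes "square_integrable f" "square_integrable g"
  shows "square_integrable (\<lambda>x. f x - g x)"
  using square_integrable_add[OF assms(1) square_integrable_uminus[OF assms(2)]] by simp

lemma square_integrable_inner:
  assumes "square_integrable f" "square_integrable g"
  shows "integrable lborel (\<lambda>x. f x \<bullet> g x)"
proof -
  have meas [measurable]: "f \<in> borel_measurable borel" "g \<in> borel_measurable borel"
    using assms by (auto simp: square_integrable_def)
  have "\<bar>f x \<bullet> g x\<bar> \<le> (norm (f x))\<^sup>2 + (norm (g x))\<^sup>2" for x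
  proof -
    have "\<bar>f x \<bullet> g x\<bar> \<le> norm (f x) * norm (g x)" by (rule Cauchy_Schwarz_ineq2)
    also have "\<dots> \<le> (norm (f x))\<^sup>2 + (norm (g x))\<^sup>2"
      using sum_squares_bound[of "norm (f x)" "norm (g x)"]
        mult_nonneg_nonneg[OF norm_ge_zero[of "f x"] norm_ge_zero[of "g x"]] by linarith
    finally show ?thesis .
  qed
  moreover have "integrable lborel (\<lambda>x. (norm (f x))\<^sup>2 + (norm (g x))\<^sup>2)"
    using assms by (auto simp: square_integrable_def)
  ultimately show ?thesis
    by (intro Bochner_Integration.integrable_bound[where
          f = "\<lambda>x. (norm (f x))\<^sup>2 + (norm (g x))\<^sup>2" and g = "\<lambda>x. f x \<bullet> g x"]) auto
qed

quotient_type (overloaded) 'a L2 = "('a::euclidean_space) \<Rightarrow> complex" / partial: L2_eq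
proof (rule part_equivpI)
  show "\<exists>f::'a \<Rightarrow> complex. L2_eq f f"
    using square_integrable_zero by (auto simp: L2_eq_def)
  show "symp (L2_eq :: ('a \<Rightarrow> complex) \<Rightarrow> _)"
    by (auto simp: L2_eq_def symp_def)
  show "transp (L2_eq :: ('a \<Rightarrow> complex) \<Rightarrow> _)"
    by (auto simp: L2_eq_def transp_def)
qed

instantiation L2 :: (euclidean_space) real_inner
begin

lift_definition zero_L2 :: "'a L2" is "\<lambda>_. 0"
  by (simp add: L2_eq_def square_integrable_zero)

lift_definition plus_L2 :: "'a L2 \<Rightarrow> 'a L2 \<Rightarrow> 'a L2" is "\<lambda>f g x. f x + g x"
  by (auto simp: L2_eq_def square_integrable_add)

lift_definition minus_L2 :: "'a L2 \<Rightarrow> 'a L2 \<Rightarrow> 'a L2" is "\<lambda>f g x. f x - g x"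
  by (auto simp: L2_eq_def square_integrable_diff)

lift_definition uminus_L2 :: "'a L2 \<Rightarrow> 'a L2" is "\<lambda>f x. - f x"
  by (auto simp: L2_eq_def square_integrable_uminus)

lift_definition scaleR_L2 :: "real \<Rightarrow> 'a L2 \<Rightarrow> 'a L2" is "\<lambda>r f x. r *\<^sub>R f x"
  by (auto simp: L2_eq_def square_integrable_scaleR)

text \<open>On \<^typ>\<open>complex\<close> the real inner product is \<open>f x \<bullet> g x = Re (f x * cnj (g x))\<close>.\<close>

lift_definition inner_L2 :: "'a L2 \<Rightarrow> 'a L2 \<Rightarrow> real" is "\<lambda>f g. LINT x|lborel. f x \<bullet> g x"
proof -
  fix f f' g g' :: "'a \<Rightarrow> complex"
  assume *: "L2_eq f f'" "L2_eq g g'"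
  then have [measurable]: "f \<in> borel_measurable borel" "f' \<in> borel_measurable borel"
      "g \<in> borel_measurable borel" "g' \<in> borel_measurable borel"
    by (auto simp: L2_eq_def square_integrable_def)
  have "AE x in lborel. f x = f' x" "AE x in lborel. g x = g' x"
    using * by (auto simp: L2_eq_def)
  then have "AE x in lborel. f x \<bullet> g x = f' x \<bullet> g' x" by eventually_elim simp
  then show "(LINT x|lborel. f x \<bullet> g x) = (LINT x|lborel. f' x \<bullet> g' x)"
    by (intro integral_cong_AE) auto
qed

definition norm_L2 :: "'a L2 \<Rightarrow> real" where "norm_L2 f = sqrt (f \<bullet> f)"
definition dist_L2 :: "'a L2 \<Rightarrow> 'a L2 \<Rightarrow> real" where "dist_L2 f g = norm (f - g)"
definition sgn_L2 :: "'a L2 \<Rightarrow> 'a L2" where "sgn_L2 f = inverse (norm f) *\<^sub>R f"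
definition uniformity_L2 :: "('a L2 \<times> 'a L2) filter" where
  "uniformity_L2 = (INF e\<in>{0<..}. principal {(f, g). dist f g < e})"
definition open_L2 :: "'a L2 set \<Rightarrow> bool" where
  "open_L2 U = (\<forall>f\<in>U. eventually (\<lambda>(f', g). f' = f \<longrightarrow> g \<in> U) uniformity)"

instance
proof
  fix f g h :: "'a L2" and r s :: real
  show "f + g + h = f + (g + h)"
    by transfer (auto simp: L2_eq_def algebra_simps intro!: square_integrable_add)
  show "f + g = g + f"
    by transfer (auto simp: L2_eq_def algebra_simps intro!: square_integrable_add)
  show "0 + f = f"
    by transfer (auto simp: L2_eq_def)
  show "- f + f = 0"
    by transfer (auto simp: L2_eq_def square_integrable_zero)
  show "f - g = f + - g"
    by transfer (auto simp: L2_eq_def square_integrable_diff)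
  show "r *\<^sub>R (f + g) = r *\<^sub>R f + r *\<^sub>R g"
    by transfer (auto simp: L2_eq_def scaleR_add_right intro!: square_integrable_scaleR square_integrable_add)
  show "(r + s) *\<^sub>R f = r *\<^sub>R f + s *\<^sub>R f"
    by transfer (auto simp: L2_eq_def scaleR_add_left intro!: square_integrable_scaleR square_integrable_add)
  show "r *\<^sub>R s *\<^sub>R f = (r * s) *\<^sub>R f"
    by transfer (auto simp: L2_eq_def intro!: square_integrable_scaleR)
  show "1 *\<^sub>R f = f"
    by transfer (auto simp: L2_eq_def)
  show "dist f g = norm (f - g)" by (rule dist_L2_def)
  show "sgn f = inverse (norm f) *\<^sub>R f" by (rule sgn_L2_def)
  show "(uniformity :: ('a L2 \<times> 'a L2) filter) = (INF e\<in>{0<..}. principal {(x, y). dist x y < e})"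
    by (rule uniformity_L2_def)
  show "open U = (\<forall>x\<in>U. eventually (\<lambda>(x', y). x' = x \<longrightarrow> y \<in> U) uniformity)" for U :: "'a L2 set"
    by (rule open_L2_def)
  show "f \<bullet> g = g \<bullet> f"
    by transfer (simp add: inner_commute)
  show "(f + g) \<bullet> h = f \<bullet> h + g \<bullet> h"
    by transfer (simp add: L2_eq_def inner_add_left square_integrable_inner)
  show "(r *\<^sub>R f) \<bullet> g = r * (f \<bullet> g)"
    by transfer simp
  show "0 \<le> f \<bullet> f"
    by transfer (simp add: integral_nonneg_AE)
  show "f \<bullet> f = 0 \<longleftrightarrow> f = 0"
  proof transfer
    fix f :: "'a \<Rightarrow> complex"
    assume *: "L2_eq f f"
    then have "integrable lborel (\<lambda>x. f x \<bullet> f x)"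
      by (auto simp: L2_eq_def intro: square_integrable_inner)
    then have "(LINT x|lborel. f x \<bullet> f x) = 0 \<longleftrightarrow> (AE x in lborel. f x \<bullet> f x = 0)"
      by (intro integral_nonneg_eq_0_iff_AE) auto
    then show "(LINT x|lborel. f x \<bullet> f x) = 0 \<longleftrightarrow> L2_eq f (\<lambda>_. 0)"
      using * by (auto simp: L2_eq_def square_integrable_zero)
  qed
  show "norm f = sqrt (f \<bullet> f)" by (rule norm_L2_def)
qed

end

lift_definition scaleC_L2 :: "complex \<Rightarrow> 'a::euclidean_space L2 \<Rightarrow> 'a L2" is "\<lambda>c f x. c * f x"
  by (auto simp: L2_eq_def square_integrable_cmult)

lemma norm_abs_L2:
  assumes "square_integrable f"
  shows "norm (abs_L2 f) = sqrt (LINT x|lborel. (norm (f x))\<^sup>2)"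
  using assms
  by (simp add: norm_L2_def inner_L2.abs_eq L2_eq_def power2_norm_eq_inner)

lemma L2_cases:
  obtains f where "square_integrable f" "F = abs_L2 f"
proof -
  have "L2_eq (rep_L2 F) (rep_L2 F)" "abs_L2 (rep_L2 F) = F"
    using Quotient_rep_reflp[OF Quotient_L2] Quotient_abs_rep[OF Quotient_L2] by auto
  then show ?thesis
    by (intro that[of "rep_L2 F"]) (auto simp: L2_eq_def)
qed

lemma abs_L2_diff:
  assumes "square_integrable f" "square_integrable g"
  shows "abs_L2 f - abs_L2 g = abs_L2 (\<lambda>x. f x - g x)"
  using assms by (simp add: minus_L2.abs_eq L2_eq_def)

lemma nn_integral_abs_L2_diff:
  assumes "square_integrable f" "square_integrable g"
  shows "(\<integral>\<^sup>+x. ennreal ((norm (f x - g x))\<^sup>2) \<partial>lborel) = ennreal ((dist (abs_L2 f) (abs_L2 g))\<^sup>2)"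
proof -
  have *: "square_integrable (\<lambda>x. f x - g x)"
    by (rule square_integrable_diff[OF assms])
  then show ?thesis
    by (subst nn_integral_eq_integral)
       (auto simp: dist_norm abs_L2_diff[OF assms] norm_abs_L2 square_integrable_def integral_nonneg_AE)
qed

instance L2 :: (euclidean_space) banach
proof
  fix X :: "nat \<Rightarrow> 'a L2"
  assume "Cauchy X"
  have "\<forall>n. \<exists>h. square_integrable h \<and> X n = abs_L2 h"
    by (meson L2_cases)
  then obtain f where f: "\<And>n. square_integrable (f n)" and Xf: "\<And>n. X n = abs_L2 (f n)"
    unfolding choice_iff by blast
  have [measurable]: "f n \<in> borel_measurable borel" for n
    using f[of n] by (simp add: square_integrable_def)
  have "\<exists>N. \<forall>m\<ge>N. \<forall>n\<ge>N. dist (X m) (X n) < (1/2)^k" for k :: nat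
    using \<open>Cauchy X\<close> by (auto simp: Cauchy_def)
  then obtain N where N: "\<And>k m n. m \<ge> N k \<Longrightarrow> n \<ge> N k \<Longrightarrow> dist (X m) (X n) < (1/2)^k"
    by metis
  define r where "r k = (\<Sum>j\<le>k. N j) + k" for k
  have rN: "r k \<ge> N k" for k
    unfolding r_def by (intro trans_le_add1 member_le_sum) auto
  have r_ge: "r k \<ge> k" for k by (simp add: r_def)
  have r_Suc: "r k \<le> r (Suc k)" for k by (simp add: r_def)
  have step: "dist (X (r (Suc k))) (X (r k)) < (1/2)^k" for k
    by (rule N) (use rN[of k] r_Suc[of k] in auto)
  define d where "d k x = f (r (Suc k)) x - f (r k) x" for k x
  have [measurable]: "d k \<in> borel_measurable borel" for k
    unfolding d_def by measurable
  have "(\<integral>\<^sup>+x. (\<Sum>k. ennreal (2^k * (norm (d k x))\<^sup>2)) \<partial>lborel)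
      = (\<Sum>k. \<integral>\<^sup>+x. ennreal (2^k * (norm (d k x))\<^sup>2) \<partial>lborel)"
    by (rule nn_integral_suminf) auto
  also have "\<dots> \<le> (\<Sum>k. ennreal ((1/2)^k))"
  proof (intro suminf_le)
    fix k
    have "(\<integral>\<^sup>+x. ennreal (2^k * (norm (d k x))\<^sup>2) \<partial>lborel)
        = ennreal (2^k) * (\<integral>\<^sup>+x. ennreal ((norm (d k x))\<^sup>2) \<partial>lborel)"
      by (subst nn_integral_cmult[symmetric]) (auto simp: ennreal_mult)
    also have "\<dots> = ennreal (2^k * (dist (X (r (Suc k))) (X (r k)))\<^sup>2)"
      unfolding d_def nn_integral_abs_L2_diff[OF f f] Xf by (simp add: ennreal_mult)
    also have "\<dots> \<le> ennreal (2^k * ((1/2)^k)\<^sup>2)"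
      using step[of k] by (intro ennreal_leI mult_left_mono power_mono) auto
    also have "(2::real)^k * ((1/2)^k)\<^sup>2 = (1/2)^k"
      by (simp add: power2_eq_square field_simps)
    finally show "(\<integral>\<^sup>+x. ennreal (2^k * (norm (d k x))\<^sup>2) \<partial>lborel) \<le> ennreal ((1/2)^k)" .
  qed auto
  also have "\<dots> < \<infinity>"
    by (subst suminf_ennreal2) (auto simp: summable_geometric)
  finally have "(\<integral>\<^sup>+x. (\<Sum>k. ennreal (2^k * (norm (d k x))\<^sup>2)) \<partial>lborel) \<noteq> \<infinity>"
    by simp
  then have "AE x in lborel. (\<Sum>k. ennreal (2^k * (norm (d k x))\<^sup>2)) \<noteq> \<infinity>"
    by (intro nn_integral_PInf_AE) auto
  then have conv: "AE x in lborel. convergent (\<lambda>k. f (r k) x)"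
  proof eventually_elim
    fix x assume fin: "(\<Sum>k. ennreal (2^k * (norm (d k x))\<^sup>2)) \<noteq> \<infinity>"
    then have sm: "summable (\<lambda>k. 2^k * (norm (d k x))\<^sup>2)"
      by (intro summable_suminf_not_top) auto
    have "summable (\<lambda>k. norm (d k x))"
    proof (rule summable_comparison_test')
      show "summable (\<lambda>k. (1/2)^k + 2^k * (norm (d k x))\<^sup>2)"
        by (intro summable_add sm summable_geometric) auto
      fix k :: nat assume "k \<ge> 0"
      have "norm (d k x) \<le> (1/2)^k + 2^k * (norm (d k x))\<^sup>2"
      proof (cases "norm (d k x) \<le> (1/2)^k")
        case False
        then have "1 \<le> 2^k * norm (d k x)" by (simp add: field_simps)
        then have "1 * norm (d k x) \<le> (2^k * norm (d k x)) * norm (d k x)"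
          by (intro mult_right_mono) auto
        then show ?thesis by (simp add: power2_eq_square add_increasing mult.assoc)
      qed (simp add: add_increasing2)
      then show "norm (norm (d k x)) \<le> (1/2)^k + 2^k * (norm (d k x))\<^sup>2" by simp
    qed
    then have "summable (\<lambda>k. d k x)" by (rule summable_norm_cancel)
    then have "convergent (\<lambda>n. f (r 0) x + (\<Sum>k<n. d k x))"
      by (auto simp: summable_iff_convergent intro: convergent_add convergent_const)
    moreover have "f (r 0) x + (\<Sum>k<n. d k x) = f (r n) x" for n
      using sum_lessThan_telescope[of "\<lambda>k. f (r k) x" n] by (simp add: d_def)
    ultimately show "convergent (\<lambda>k. f (r k) x)" by simp
  qed
  define g where "g x = lim (\<lambda>k. f (r k) x)" for x
  have [measurable]: "g \<in> borel_measurable borel"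
    unfolding g_def by (rule borel_measurable_lim_metric) measurable
  have bound: "(\<integral>\<^sup>+x. ennreal ((norm (g x - f n x))\<^sup>2) \<partial>lborel) \<le> ennreal (((1/2)^k)\<^sup>2)"
    if n: "n \<ge> N k" for n k
  proof -
    have "(\<integral>\<^sup>+x. ennreal ((norm (g x - f n x))\<^sup>2) \<partial>lborel)
       = (\<integral>\<^sup>+x. liminf (\<lambda>m. ennreal ((norm (f (r m) x - f n x))\<^sup>2)) \<partial>lborel)"
    proof (rule nn_integral_cong_AE)
      show "AE x in lborel. ennreal ((norm (g x - f n x))\<^sup>2)
          = liminf (\<lambda>m. ennreal ((norm (f (r m) x - f n x))\<^sup>2))"
        using conv
      proof eventually_elim
        fix x assume "convergent (\<lambda>k. f (r k) x)"
        then have "(\<lambda>m. f (r m) x) \<longlonglongrightarrow> g x" by (simp add: g_def convergent_LIMSEQ_iff)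
        then have "(\<lambda>m. ennreal ((norm (f (r m) x - f n x))\<^sup>2)) \<longlonglongrightarrow> ennreal ((norm (g x - f n x))\<^sup>2)"
          by (intro tendsto_intros tendsto_ennrealI)
        from lim_imp_Liminf[OF _ this]
        show "ennreal ((norm (g x - f n x))\<^sup>2)
            = liminf (\<lambda>m. ennreal ((norm (f (r m) x - f n x))\<^sup>2))"
          by simp
      qed
    qed
    also have "\<dots> \<le> liminf (\<lambda>m. \<integral>\<^sup>+x. ennreal ((norm (f (r m) x - f n x))\<^sup>2) \<partial>lborel)"
      by (rule nn_integral_liminf) auto
    also have "\<dots> \<le> limsup (\<lambda>m. \<integral>\<^sup>+x. ennreal ((norm (f (r m) x - f n x))\<^sup>2) \<partial>lborel)"
      by (rule Liminf_le_Limsup) auto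
    also have "\<dots> \<le> ennreal (((1/2)^k)\<^sup>2)"
    proof (rule Limsup_bounded)
      show "\<forall>\<^sub>F m in sequentially. (\<integral>\<^sup>+x. ennreal ((norm (f (r m) x - f n x))\<^sup>2) \<partial>lborel)
          \<le> ennreal (((1/2)^k)\<^sup>2)"
        using eventually_ge_at_top[of "N k"]
      proof eventually_elim
        fix m assume "m \<ge> N k"
        then have "dist (X (r m)) (X n) < (1/2)^k"
          using r_ge[of m] n by (intro N) auto
        then show "(\<integral>\<^sup>+x. ennreal ((norm (f (r m) x - f n x))\<^sup>2) \<partial>lborel) \<le> ennreal (((1/2)^k)\<^sup>2)"
          unfolding nn_integral_abs_L2_diff[OF f f] Xf
          by (intro ennreal_leI power_mono) auto
      qed
    qed
    finally show ?thesis .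
  qed
  have "integrable lborel (\<lambda>x. (norm (g x - f (N 0) x))\<^sup>2)"
  proof (rule integrableI_nonneg)
    show "(\<integral>\<^sup>+x. ennreal ((norm (g x - f (N 0) x))\<^sup>2) \<partial>lborel) < \<infinity>"
      by (rule order.strict_trans1[OF bound[of 0 "N 0"]]) auto
  qed auto
  then have "square_integrable (\<lambda>x. g x - f (N 0) x)"
    by (simp add: square_integrable_def)
  from square_integrable_add[OF this f[of "N 0"]] have g: "square_integrable g"
    by simp
  have "X \<longlonglongrightarrow> abs_L2 g"
  proof (rule LIMSEQ_I)
    fix e :: real assume "0 < e"
    then obtain k where k: "(1/2::real)^k < e"
      using real_arch_pow_inv[of e "1/2"] by auto
    have "norm (X n - abs_L2 g) < e" if n: "n \<ge> N k" for n
    proof -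
      have "(dist (abs_L2 g) (X n))\<^sup>2 \<le> ((1/2)^k)\<^sup>2"
        using bound[OF n] unfolding nn_integral_abs_L2_diff[OF g f] Xf
        by (simp add: ennreal_le_iff)
      then have "dist (abs_L2 g) (X n) \<le> (1/2)^k"
        by (rule power2_le_imp_le) auto
      then show ?thesis using k by (simp add: dist_norm norm_minus_commute)
    qed
    then show "\<exists>no. \<forall>n\<ge>no. norm (X n - abs_L2 g) < e" by blast
  qed
  then show "convergent X" by (rule convergentI)
qed


section \<open>Adapted processes\<close>

locale complete_filtered_prob_space = prob_space M + complete_measure M
  for M :: "'w measure" and F :: "real \<Rightarrow> 'w measure" +
  assumes subalgebra_F: "0 \<le> t \<Longrightarrow> subalgebra M (F t)"
    and F_mono: "0 \<le> s \<Longrightarrow> s \<le> t \<Longrightarrow> sets (F s) \<subseteq> sets (F t)"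
    and null_sets_F: "null_sets M \<subseteq> sets (F 0)"

definition time_prob :: "'w measure \<Rightarrow> real \<Rightarrow> (real \<times> 'w) measure" where
  "time_prob M T = completion (restrict_space lborel {0<..<T} \<Otimes>\<^sub>M M)"

text \<open>Processes are identified when they agree for a.e. \<open>(t, \<omega>)\<close>. The notion of adaptedness
  is therefore made invariant under this identification (for a complete filtration): the process is
  jointly measurable, and \<open>X t\<close> is \<open>F t\<close>-measurable for a.e. \<open>t\<close>. Equivalently,
  \<open>X\<close> agrees a.e. with a jointly measurable process that is adapted at every time.\<close>

definition adapted_process ::
    "'w measure \<Rightarrow> (real \<Rightarrow> 'w measure) \<Rightarrow> real \<Rightarrow> (real \<Rightarrow> 'w \<Rightarrow> 'h::topological_space) \<Rightarrow> bool" where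
  "adapted_process M F T X \<longleftrightarrow>
     (\<lambda>(t, \<omega>). X t \<omega>) \<in> borel_measurable (time_prob M T) \<and>
     (AE t in restrict_space lborel {0<..<T}. X t \<in> borel_measurable (F t))"

definition LqF ::
    "'w measure \<Rightarrow> (real \<Rightarrow> 'w measure) \<Rightarrow> real \<Rightarrow> ennreal \<Rightarrow> (real \<Rightarrow> 'w \<Rightarrow> 'h::banach) set" where
  "LqF M F T q = {X. adapted_process M F T X \<and>
     (if q = \<infinity> then esssup (time_prob M T) (\<lambda>(t, \<omega>). ennreal (norm (X t \<omega>))) < \<infinity>
      else integrable (time_prob M T) (\<lambda>(t, \<omega>). norm (X t \<omega>) powr enn2real q))}"

definition LqF_norm ::
    "'w measure \<Rightarrow> real \<Rightarrow> ennreal \<Rightarrow> (real \<Rightarrow> 'w \<Rightarrow> 'h::banach) \<Rightarrow> real" where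
  "LqF_norm M T q X =
     (if q = \<infinity> then enn2real (esssup (time_prob M T) (\<lambda>(t, \<omega>). ennreal (norm (X t \<omega>))))
      else (LINT (t, \<omega>)|time_prob M T. norm (X t \<omega>) powr enn2real q) powr (1 / enn2real q))"

text \<open>Linearity is understood up to a.e. equality. That the operator respects a.e. equality follows
  from linearity together with the norm bound.\<close>

definition bounded_operator_LqF ::
    "'w measure \<Rightarrow> (real \<Rightarrow> 'w measure) \<Rightarrow> real \<Rightarrow> ennreal \<Rightarrow>
     ((real \<Rightarrow> 'w \<Rightarrow> 'a::euclidean_space L2) \<Rightarrow> (real \<Rightarrow> 'w \<Rightarrow> 'a L2)) \<Rightarrow> bool" where
  "bounded_operator_LqF M F T q A \<longleftrightarrow>
     (\<forall>u\<in>LqF M F T q. A u \<in> LqF M F T q) \<and>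
     (\<forall>u\<in>LqF M F T q. \<forall>v\<in>LqF M F T q. AE (t, \<omega>) in time_prob M T.
        A (\<lambda>t \<omega>. u t \<omega> + v t \<omega>) t \<omega> = A u t \<omega> + A v t \<omega>) \<and>
     (\<forall>c. \<forall>u\<in>LqF M F T q. AE (t, \<omega>) in time_prob M T.
        A (\<lambda>t \<omega>. scaleC_L2 c (u t \<omega>)) t \<omega> = scaleC_L2 c (A u t \<omega>)) \<and>
     (\<exists>C\<ge>0. \<forall>u\<in>LqF M F T q. LqF_norm M T q (A u) \<le> C * LqF_norm M T q u)"


section \<open>Partial derivatives, smooth functions, Schwartz functions\<close>

definition partial_deriv ::
    "'a::euclidean_space \<Rightarrow> ('a \<Rightarrow> 'b::real_normed_vector) \<Rightarrow> 'a \<Rightarrow> 'b" where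
  "partial_deriv b f x = vector_derivative (\<lambda>s. f (x + s *\<^sub>R b)) (at 0)"

definition partial_derivs ::
    "'a::euclidean_space list \<Rightarrow> ('a \<Rightarrow> 'b::real_normed_vector) \<Rightarrow> 'a \<Rightarrow> 'b" where
  "partial_derivs bs f = foldr partial_deriv bs f"

definition smooth :: "('a::euclidean_space \<Rightarrow> 'b::real_normed_vector) \<Rightarrow> bool" where
  "smooth f \<longleftrightarrow> (\<forall>bs. set bs \<subseteq> Basis \<longrightarrow>
     continuous_on UNIV (partial_derivs bs f) \<and>
     (\<forall>b\<in>Basis. \<forall>x. (\<lambda>s. partial_derivs bs f (x + s *\<^sub>R b)) differentiable (at 0)))"

text \<open>A multi-index is a function on the index type \<open>'n\<close> of \<open>real ^ 'n\<close>. The index type carries no order,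
  so a list containing each \<open>i\<close> exactly \<open>\<alpha> i\<close> times is chosen; for smooth functions
  the derivative does not depend on the choice.\<close>

type_synonym 'n multiindex = "'n \<Rightarrow> nat"

definition multiindex_list :: "'n::finite multiindex \<Rightarrow> 'n list" where
  "multiindex_list \<alpha> = (SOME is. \<forall>i. count_list is i = \<alpha> i)"

lemma count_multiindex_list: "count_list (multiindex_list \<alpha>) i = \<alpha> i"
proof -
  obtain "is" where is_def: "mset is = Abs_multiset \<alpha>" using ex_mset by blast
  have "count (Abs_multiset \<alpha>) = \<alpha>"
    by (rule Abs_multiset_inverse) simp
  then have "\<forall>i. count_list is i = \<alpha> i"
    unfolding count_mset[symmetric] is_def by simp
  then have "\<forall>i. count_list (multiindex_list \<alpha>) i = \<alpha> i"
    unfolding multiindex_list_def by (rule someI[where P = "\<lambda>is. \<forall>i. count_list is i = \<alpha> i"])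
  then show ?thesis by blast
qed

definition multiindex_order :: "'n::finite multiindex \<Rightarrow> nat" where
  "multiindex_order \<alpha> = (\<Sum>i\<in>UNIV. \<alpha> i)"

definition multi_deriv ::
    "'n::finite multiindex \<Rightarrow> (real^'n \<Rightarrow> complex) \<Rightarrow> real^'n \<Rightarrow> complex" where
  "multi_deriv \<alpha> f = partial_derivs (map (\<lambda>i. axis i 1) (multiindex_list \<alpha>)) f"

definition schwartz :: "(real^'n \<Rightarrow> complex) \<Rightarrow> bool" where
  "schwartz f \<longleftrightarrow> smooth f \<and>
     (\<forall>k \<beta>. \<exists>C. \<forall>x. (1 + norm x)^k * norm (multi_deriv \<beta> f x) \<le> C)"


section \<open>Symbols and pseudo-differential operators\<close>

text \<open>\<open>symbol_deriv \<alpha> \<beta> \<sigma> x \<xi>\<close> is \<open>\<partial>\<^sub>\<xi>\<^sup>\<alpha> \<partial>\<^sub>x\<^sup>\<beta> \<sigma> (x, \<xi>)\<close>.\<close>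

definition symbol_deriv ::
    "'n::finite multiindex \<Rightarrow> 'n multiindex \<Rightarrow>
     (real^'n \<Rightarrow> real^'n \<Rightarrow> complex) \<Rightarrow> real^'n \<Rightarrow> real^'n \<Rightarrow> complex" where
  "symbol_deriv \<alpha> \<beta> \<sigma> x \<xi> = multi_deriv \<alpha> (\<lambda>\<eta>. multi_deriv \<beta> (\<lambda>y. \<sigma> y \<eta>) x) \<xi>"

definition S0_infty ::
    "'w measure \<Rightarrow> (real \<Rightarrow> 'w measure) \<Rightarrow> real \<Rightarrow>
     (real \<Rightarrow> 'w \<Rightarrow> real^'n \<Rightarrow> real^'n \<Rightarrow> complex) set" where
  "S0_infty M F T = {a.
     (AE (t, \<omega>) in time_prob M T. smooth (\<lambda>(x, \<xi>). a t \<omega> x \<xi>)) \<and>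
     (\<forall>x \<xi>. adapted_process M F T (\<lambda>t \<omega>. a t \<omega> x \<xi>)) \<and>
     (\<forall>\<alpha> \<beta>. \<exists>m :: real \<Rightarrow> 'w \<Rightarrow> real. m \<in> LqF M F T \<infinity> \<and> (\<forall>t \<omega>. 0 \<le> m t \<omega>) \<and>
        (AE (t, \<omega>) in time_prob M T. \<forall>x \<xi>.
           norm (symbol_deriv \<alpha> \<beta> (a t \<omega>) x \<xi>)
             \<le> m t \<omega> * (1 + norm \<xi>) powr (- real (multiindex_order \<alpha>))))}"

definition fourier :: "(real^'n \<Rightarrow> complex) \<Rightarrow> real^'n \<Rightarrow> complex" where
  "fourier u \<xi> = (LINT x|lborel. exp (- \<i> * of_real (x \<bullet> \<xi>)) * u x)"

definition pdo ::
    "(real^'n \<Rightarrow> real^'n \<Rightarrow> complex) \<Rightarrow> (real^'n \<Rightarrow> complex) \<Rightarrow> real^'n \<Rightarrow> complex" where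
  "pdo \<sigma> u x = of_real ((2 * pi) powr (- real CARD('n))) *
     (LINT \<xi>|lborel. exp (\<i> * of_real (x \<bullet> \<xi>)) * \<sigma> x \<xi> * fourier u \<xi>)"

text \<open>The integral formula is absolutely convergent on Schwartz functions; on all of \<open>L2\<close> the operator
  is, as usual, its extension by continuity. \<open>pdo_extends_to \<sigma> f g\<close> says that this extension
  is defined at \<open>f\<close> with value \<open>g\<close>. The constant sequences show that on (the class of) a Schwartz
  function the value is given by the formula. Values of \<open>abs_L2\<close> outside
  \<^const>\<open>square_integrable\<close> are unspecified, hence the explicit square-integrability.\<close>

definition pdo_extends_to ::
    "(real^'n \<Rightarrow> real^'n \<Rightarrow> complex) \<Rightarrow> (real^'n) L2 \<Rightarrow> (real^'n) L2 \<Rightarrow> bool" where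
  "pdo_extends_to \<sigma> f g \<longleftrightarrow>
     (\<forall>\<phi> :: nat \<Rightarrow> real^'n \<Rightarrow> complex.
        (\<forall>k. schwartz (\<phi> k)) \<and> (\<lambda>k. abs_L2 (\<phi> k)) \<longlonglongrightarrow> f \<longrightarrow>
        (\<forall>k. square_integrable (pdo \<sigma> (\<phi> k))) \<and> (\<lambda>k. abs_L2 (pdo \<sigma> (\<phi> k))) \<longlonglongrightarrow> g)"

definition pdo_L2 ::
    "(real^'n \<Rightarrow> real^'n \<Rightarrow> complex) \<Rightarrow> (real^'n) L2 \<Rightarrow> (real^'n) L2" where
  "pdo_L2 \<sigma> f = (THE g. pdo_extends_to \<sigma> f g)"

definition stochastic_pdo ::
    "(real \<Rightarrow> 'w \<Rightarrow> real^'n \<Rightarrow> real^'n \<Rightarrow> complex) \<Rightarrow>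
     (real \<Rightarrow> 'w \<Rightarrow> (real^'n) L2) \<Rightarrow> real \<Rightarrow> 'w \<Rightarrow> (real^'n) L2" where
  "stochastic_pdo a u t \<omega> = pdo_L2 (a t \<omega>) (u t \<omega>)"

text \<open>For a.e. \<open>(t, \<omega>)\<close>, \<^const>\<open>pdo_L2\<close> is an actual extension and not an unspecified
  description.\<close>

definition stochastic_pdo_well_defined ::
    "'w measure \<Rightarrow> real \<Rightarrow> (real \<Rightarrow> 'w \<Rightarrow> real^'n \<Rightarrow> real^'n \<Rightarrow> complex) \<Rightarrow> bool" where
  "stochastic_pdo_well_defined M T a \<longleftrightarrow>
     (AE (t, \<omega>) in time_prob M T. \<forall>f. \<exists>!g. pdo_extends_to (a t \<omega>) f g)"

end

theory Submission
  imports Defs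
begin

text \<open>
  For fixed \<open>(t, \<omega>)\<close> the \<open>L\<^sup>2\<close> bound is of Calderon--Vaillancourt type. Write \<open>T\<^sub>m\<close> for the Fourier
  multiplier with symbol \<open>m\<close>, so that up to a constant \<open>A u(x) = T\<^bsub>\<sigma>(x, \<cdot>)\<^esub> u(x)\<close>. Integrating
  \<open>g - g'\<close> against \<open>e\<^sup>-\<^sup>r\<close> over a half-line recovers \<open>g(0)\<close>; applied in every coordinate of \<open>x\<close> this bounds
  \<open>\<bar>A u(x)\<bar>\<^sup>2\<close> by the average over \<open>z\<close> of \<open>\<bar>T\<^bsub>\<rho>(z, \<cdot>)\<^esub> u(x)\<bar>\<^sup>2\<close> with the weight
  \<open>\<Prod>\<^sub>b 2 / (1 + (z\<^sub>b - x\<^sub>b)\<^sup>2)\<close>, where \<open>\<rho>\<close> is a combination of derivatives of \<open>\<sigma>\<close> in \<open>x\<close>. The weight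
  can be moved through the multiplier: with \<open>l(y) = 1 + i (z\<^sub>b - y\<^sub>b)\<close> one has
  \<open>T\<^sub>m g = l T\<^sub>m (g / l) - T\<^bsub>\<partial>\<^sub>b m\<^esub> (g / l)\<close>, so each factor of the weight costs one derivative in \<open>\<xi>\<close>.
  The Plancherel inequality for the multipliers and integration over \<open>z\<close> then give the bound, with a
  constant that depends on finitely many symbol seminorms only, hence is uniform in \<open>(t, \<omega>)\<close>.

  For the measurability of \<open>A u\<close>, the process \<open>u\<close> is approximated by processes with values in a
  countable dense set of Schwartz functions, on which \<open>A\<close> is given by an integral of a Caratheodory
  function.
\<close>

section \<open>Iterated partial derivatives\<close>

text \<open>Freezing the first variable of the symbol at z leaves a genuine Fourier multiplier, and
  Plancherel controls it in x for that fixed z; the operator itself needs the diagonal z = x. A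
  Sobolev inequality in z reaches the diagonal at the price of an integral over z, which converges
  because of a weight concentrated near x. That weight depends on x and does not commute with the
  multiplier; this obstacle dictates its form. One probability measure does all the work, the
  exponential distribution. Jensen's inequality holds for it with constant 1. Its Fourier transform
  is 1 / (1 + i t), so dividing by \<open>l\<close> averages modulations, that is, translations of
  the frequency. The squared modulus 1 / (1 + t^2) is integrable and dominates half the exponential
  density. The same facts serve in x, in \<xi> and for the decay of Fourier transforms of Schwartz
  functions. Each of the n coordinates uses one derivative in x and one in \<xi>, so derivatives of
  total order at most 2 n enter the constant.\<close>

lemma partial_derivs_Nil [simp]: "partial_derivs [] f = f"
  by (simp add: partial_derivs_def)

lemma partial_derivs_Cons [simp]: "partial_derivs (b # bs) f = partial_deriv b (partial_derivs bs f)"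
  by (simp add: partial_derivs_def)

lemma partial_derivs_append: "partial_derivs (as @ bs) f = partial_derivs as (partial_derivs bs f)"
  by (simp add: partial_derivs_def)

lemma smooth_partial_derivs:
  assumes "smooth f" "set bs \<subseteq> Basis"
  shows "smooth (partial_derivs bs f)"
  unfolding smooth_def
proof (intro allI impI)
  fix as :: "'a list" assume "set as \<subseteq> Basis"
  then have "set (as @ bs) \<subseteq> Basis" using assms(2) by auto
  with assms(1) show "continuous_on UNIV (partial_derivs as (partial_derivs bs f)) \<and>
      (\<forall>b\<in>Basis. \<forall>x. (\<lambda>s. partial_derivs as (partial_derivs bs f) (x + s *\<^sub>R b)) differentiable (at 0))"
    unfolding smooth_def partial_derivs_append[symmetric] by blast
qed

lemma smooth_partial_deriv: "smooth f \<Longrightarrow> b \<in> Basis \<Longrightarrow> smooth (partial_deriv b f)"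
  using smooth_partial_derivs[of f "[b]"] by simp

lemma smooth_continuous_on: "smooth f \<Longrightarrow> continuous_on UNIV f"
  unfolding smooth_def by (metis empty_subsetI list.set(1) partial_derivs_Nil)

text \<open>\<open>smooth\<close> provides the derivative at parameter 0; moving the base point to x
  + t b gives it at every t, as the fundamental theorem along coordinate lines requires.\<close>

lemma smooth_has_vector_derivative:
  assumes "smooth f" "b \<in> Basis"
  shows "((\<lambda>s. f (x + s *\<^sub>R b)) has_vector_derivative partial_deriv b f (x + t *\<^sub>R b)) (at t)"
proof -
  have "(\<lambda>s. f ((x + t *\<^sub>R b) + s *\<^sub>R b)) differentiable (at 0)"
    using assms unfolding smooth_def by (metis empty_subsetI list.set(1) partial_derivs_Nil)
  then have "((\<lambda>s. f ((x + t *\<^sub>R b) + s *\<^sub>R b)) has_vector_derivative partial_deriv b f (x + t *\<^sub>R b)) (at (t - t))"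
    unfolding partial_deriv_def by (simp add: vector_derivative_works)
  from vector_diff_chain_at[of "\<lambda>s. s - t" 1 t, OF _ this]
  show ?thesis
    by (simp add: o_def algebra_simps has_vector_derivative_diff_const)
qed

lemma partial_deriv_eqI:
  "((\<lambda>s. f (x + s *\<^sub>R b)) has_vector_derivative d) (at 0) \<Longrightarrow> partial_deriv b f x = d"
  by (simp add: partial_deriv_def vector_derivative_at)

lemma
  assumes "smooth f" "smooth g"
  shows partial_derivs_diff: "set bs \<subseteq> Basis \<Longrightarrow>
      partial_derivs bs (\<lambda>x. f x - g x) = (\<lambda>x. partial_derivs bs f x - partial_derivs bs g x)"
    and smooth_diff: "smooth (\<lambda>x. f x - g x)"
proof -
  have vd: "((\<lambda>s. partial_derivs bs f (x + s *\<^sub>R b) - partial_derivs bs g (x + s *\<^sub>R b)) has_vector_derivative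
      (partial_deriv b (partial_derivs bs f) x - partial_deriv b (partial_derivs bs g) x)) (at 0)"
    if "set bs \<subseteq> Basis" "b \<in> Basis" for bs b x
    using smooth_has_vector_derivative[OF smooth_partial_derivs[OF assms(1) that(1)] that(2), of x 0]
      smooth_has_vector_derivative[OF smooth_partial_derivs[OF assms(2) that(1)] that(2), of x 0]
    by (auto intro!: has_vector_derivative_diff)
  show *: "partial_derivs bs (\<lambda>x. f x - g x) = (\<lambda>x. partial_derivs bs f x - partial_derivs bs g x)"
    if "set bs \<subseteq> Basis" for bs
    using that
  proof (induction bs)
    case (Cons b bs)
    then show ?case by (auto intro!: ext partial_deriv_eqI vd)
  qed simp
  show "smooth (\<lambda>x. f x - g x)"
    unfolding smooth_def
    using assms vd by (auto simp: * smooth_def intro!: continuous_intros differentiableI_vector)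
qed

lemma
  assumes "smooth f"
  shows partial_derivs_cmult: "set bs \<subseteq> Basis \<Longrightarrow>
      partial_derivs bs (\<lambda>x. (c::complex) * f x) = (\<lambda>x. c * partial_derivs bs f x)"
    and smooth_cmult: "smooth (\<lambda>x. (c::complex) * f x)"
proof -
  have vd: "((\<lambda>s. c * partial_derivs bs f (x + s *\<^sub>R b)) has_vector_derivative
      (c * partial_deriv b (partial_derivs bs f) x)) (at 0)"
    if "set bs \<subseteq> Basis" "b \<in> Basis" for bs b x
    using smooth_has_vector_derivative[OF smooth_partial_derivs[OF assms(1) that(1)] that(2), of x 0]
    by (auto intro!: has_vector_derivative_mult_right)
  show *: "partial_derivs bs (\<lambda>x. c * f x) = (\<lambda>x. c * partial_derivs bs f x)"
    if "set bs \<subseteq> Basis" for bs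
    using that
  proof (induction bs)
    case (Cons b bs)
    then show ?case by (auto intro!: ext partial_deriv_eqI vd)
  qed simp
  show "smooth (\<lambda>x. c * f x)"
    unfolding smooth_def
    using assms vd by (auto simp: * smooth_def intro!: continuous_intros differentiableI_vector)
qed

text \<open>Schwarz's theorem. By the fundamental theorem along b and differentiation under the
  integral in the direction c, the increment of the c-derivative along b is the integral of the
  mixed derivative \<open>?fcb\<close>. This integrand is continuous, so its value at the left end
  is the other mixed derivative.\<close>

lemma partial_deriv_commute:
  fixes f :: "'a::euclidean_space \<Rightarrow> complex"
  assumes f: "smooth f" and b: "b \<in> Basis" and c: "c \<in> Basis"
  shows "partial_deriv b (partial_deriv c f) = partial_deriv c (partial_deriv b f)"
proof
  fix x
  let ?fb = "partial_deriv b f" and ?fc = "partial_deriv c f" and ?fcb = "partial_deriv c (partial_deriv b f)"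
  note sm = smooth_partial_deriv[OF f b] smooth_partial_deriv[OF f c]
    smooth_partial_deriv[OF smooth_partial_deriv[OF f b] c]
  note cont = continuous_on_compose2[OF smooth_continuous_on]
  have eq: "?fc (x + s *\<^sub>R b) - ?fc x = integral {0..s} (\<lambda>r. ?fcb (x + r *\<^sub>R b))" if s: "0 \<le> s" for s
  proof -
    have "((\<lambda>t. integral (cbox 0 s) (\<lambda>r. ?fb (x + t *\<^sub>R c + r *\<^sub>R b))) has_vector_derivative
        integral (cbox 0 s) (\<lambda>r. ?fcb (x + 0 *\<^sub>R c + r *\<^sub>R b))) (at 0 within UNIV)"
    proof (rule leibniz_rule_vector_derivative)
      fix t r
      have "((\<lambda>t. ?fb ((x + r *\<^sub>R b) + t *\<^sub>R c)) has_vector_derivative ?fcb ((x + r *\<^sub>R b) + t *\<^sub>R c)) (at t)"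
        by (rule smooth_has_vector_derivative[OF sm(1) c])
      then show "((\<lambda>t. ?fb (x + t *\<^sub>R c + r *\<^sub>R b)) has_vector_derivative ?fcb (x + t *\<^sub>R c + r *\<^sub>R b)) (at t within UNIV)"
        by (simp add: algebra_simps)
      show "(\<lambda>r. ?fb (x + t *\<^sub>R c + r *\<^sub>R b)) integrable_on cbox 0 s"
        by (intro integrable_continuous cont[OF sm(1)] continuous_intros) auto
      show "continuous_on (UNIV \<times> cbox 0 s) (\<lambda>(t, r). ?fcb (x + t *\<^sub>R c + r *\<^sub>R b))"
        unfolding case_prod_unfold
        by (intro cont[OF sm(3)] continuous_intros) auto
    qed auto
    moreover have "integral (cbox 0 s) (\<lambda>r. ?fb (x + t *\<^sub>R c + r *\<^sub>R b)) = f (x + s *\<^sub>R b + t *\<^sub>R c) - f (x + t *\<^sub>R c)" for t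
    proof -
      have "((\<lambda>r. ?fb (x + t *\<^sub>R c + r *\<^sub>R b)) has_integral f (x + t *\<^sub>R c + s *\<^sub>R b) - f (x + t *\<^sub>R c + 0 *\<^sub>R b)) {0..s}"
        by (rule fundamental_theorem_of_calculus[OF s])
           (rule has_vector_derivative_at_within[OF smooth_has_vector_derivative[OF f b]])
      then show ?thesis
        by (simp add: integral_unique algebra_simps cbox_interval)
    qed
    ultimately have "((\<lambda>t. f (x + s *\<^sub>R b + t *\<^sub>R c) - f (x + t *\<^sub>R c)) has_vector_derivative
        integral {0..s} (\<lambda>r. ?fcb (x + r *\<^sub>R b))) (at 0)"
      by (simp add: cbox_interval)
    moreover have "((\<lambda>t. f (x + s *\<^sub>R b + t *\<^sub>R c) - f (x + t *\<^sub>R c)) has_vector_derivative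
        ?fc (x + s *\<^sub>R b) - ?fc x) (at 0)"
      using smooth_has_vector_derivative[OF f c, of "x + s *\<^sub>R b" 0] smooth_has_vector_derivative[OF f c, of x 0]
      by (intro has_vector_derivative_diff) simp_all
    ultimately show ?thesis
      using vector_derivative_unique_at by blast
  qed
  \<comment> \<open>The integral formula is available for s \<ge> 0 only, so derivatives are
    compared within {0..1}, where they are still unique.\<close>
  have "((\<lambda>s. integral {0..s} (\<lambda>r. ?fcb (x + r *\<^sub>R b))) has_vector_derivative ?fcb (x + 0 *\<^sub>R b)) (at 0 within {0..1})"
    by (rule integral_has_vector_derivative) (auto intro!: cont[OF sm(3)] continuous_intros)
  then have "((\<lambda>s. integral {0..s} (\<lambda>r. ?fcb (x + r *\<^sub>R b)) + ?fc x) has_vector_derivative ?fcb x) (at 0 within {0..1})"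
    by (auto intro!: derivative_eq_intros)
  then have "((\<lambda>s. ?fc (x + s *\<^sub>R b)) has_vector_derivative ?fcb x) (at 0 within {0..1})"
    by (rule has_vector_derivative_transform[rotated 2]) (auto simp: eq[symmetric])
  moreover have "((\<lambda>s. ?fc (x + s *\<^sub>R b)) has_vector_derivative partial_deriv b ?fc x) (at 0 within {0..1})"
    using smooth_has_vector_derivative[OF sm(2) b, of x 0] by (auto intro: has_vector_derivative_at_within)
  ultimately show "partial_deriv b ?fc x = ?fcb x"
    by (intro vector_derivative_unique_within) (auto intro!: trivial_limit_at_left_real simp: at_within_Icc_at_right)
qed

lemma partial_derivs_snoc_move:
  fixes f :: "'a::euclidean_space \<Rightarrow> complex"
  assumes "smooth f" "b \<in> Basis" "set bs \<subseteq> Basis"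
  shows "partial_derivs bs (partial_deriv b f) = partial_deriv b (partial_derivs bs f)"
  using assms(3)
proof (induction bs)
  case (Cons c bs)
  then show ?case
    using partial_deriv_commute[OF smooth_partial_derivs[OF assms(1), of bs] assms(2), of c] by simp
qed simp

text \<open>Induction on \<open>as\<close>: its head occurs somewhere in \<open>bs\<close>, is moved
  to the front by commuting it with what precedes, and is then cancelled.\<close>

lemma partial_derivs_perm:
  fixes f :: "'a::euclidean_space \<Rightarrow> complex"
  assumes "smooth f" "set bs \<subseteq> Basis" "mset as = mset bs"
  shows "partial_derivs as f = partial_derivs bs f"
  using assms(2,3)
proof (induction as arbitrary: bs)
  case (Cons a as)
  then have "a \<in> set bs" by (metis list.set_intros(1) mset_eq_setD)
  then obtain cs ds where bs: "bs = cs @ a # ds" by (auto simp: in_set_conv_decomp)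
  have "mset as = mset (cs @ ds)" using Cons.prems(2) bs by simp
  then have "partial_derivs as f = partial_derivs (cs @ ds) f"
    using Cons.prems bs by (intro Cons.IH) auto
  moreover have "partial_derivs bs f = partial_deriv a (partial_derivs (cs @ ds) f)"
    using Cons.prems(1) assms(1)
    by (auto simp: bs partial_derivs_append intro!: partial_derivs_snoc_move smooth_partial_derivs)
  ultimately show ?case by simp
qed simp

section \<open>Multi-indices and lists of basis vectors\<close>

lemma mset_multiindex_list_count:
  "mset (multiindex_list (count_list is)) = mset is"
  by (rule multiset_eqI) (simp add: count_mset count_multiindex_list)

text \<open>A multi-index determines a list of basis vectors only up to order, because
  \<open>multiindex_list\<close> is a choice; equality of multisets is exactly what
  \<open>partial_derivs_perm\<close> can use.\<close>

lemma multiindex_list_of_basis: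
  fixes bs :: "(real^'n) list"
  assumes "set bs \<subseteq> Basis"
  obtains \<alpha> :: "'n multiindex"
  where "mset (map (\<lambda>i. axis i 1) (multiindex_list \<alpha>)) = mset bs"
proof -
  have "\<forall>b\<in>set bs. \<exists>i. b = axis i 1"
    using assms by (auto simp: Basis_vec_def)
  then obtain g where g: "\<forall>b\<in>set bs. b = axis (g b) 1" by metis
  have "mset (map (\<lambda>i. axis i 1) (multiindex_list (count_list (map g bs)))) = mset (map (\<lambda>i. axis i 1) (map g bs))"
    by (simp only: mset_map mset_multiindex_list_count)
  also have "map (\<lambda>i. axis i 1) (map g bs) = bs"
    using g by (simp add: map_idI)
  finally show ?thesis by (rule that)
qed

lemma partial_derivs_multi_deriv:
  assumes "set bs \<subseteq> Basis"
  obtains \<alpha> where "\<And>f :: real^'n \<Rightarrow> complex. smooth f \<Longrightarrow> partial_derivs bs f = multi_deriv \<alpha> f"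
proof -
  obtain \<alpha> :: "'n multiindex" where \<alpha>: "mset (map (\<lambda>i. axis i 1) (multiindex_list \<alpha>)) = mset bs"
    using multiindex_list_of_basis[OF assms] .
  show ?thesis
    by (rule that[of \<alpha>]) (use \<alpha> in \<open>auto simp: multi_deriv_def Basis_vec_def intro!: partial_derivs_perm\<close>)
qed

lemma partial_deriv_Pair_left:
  "partial_deriv (b, 0) f (x, \<xi>) = partial_deriv b (\<lambda>y. f (y, \<xi>)) x"
  by (simp add: partial_deriv_def)

lemma partial_deriv_Pair_right:
  "partial_deriv (0, b) f (x, \<xi>) = partial_deriv b (\<lambda>\<eta>. f (x, \<eta>)) \<xi>"
  by (simp add: partial_deriv_def)

lemma partial_derivs_Pair_left:
  "partial_derivs (map (\<lambda>b. (b, 0)) bs) f (x, \<xi>) = partial_derivs bs (\<lambda>y. f (y, \<xi>)) x"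
  by (induction bs arbitrary: x) (simp_all add: partial_deriv_Pair_left)

lemma partial_derivs_Pair_right:
  "partial_derivs (map (Pair 0) bs) f (x, \<xi>) = partial_derivs bs (\<lambda>\<eta>. f (x, \<eta>)) \<xi>"
  by (induction bs arbitrary: \<xi>) (simp_all add: partial_deriv_Pair_right)

text \<open>Sorts directions into \<xi>-directions and x-directions, in the order in which
  \<open>symbol_deriv\<close> composes them.\<close>

lemma mset_Basis_prod:
  fixes cs :: "('a::euclidean_space \<times> 'b::euclidean_space) list"
  assumes "set cs \<subseteq> Basis"
  obtains as bs where "set as \<subseteq> Basis" "set bs \<subseteq> Basis" "mset cs = mset (map (Pair 0) as @ map (\<lambda>b. (b, 0)) bs)"
  using assms
proof (induction cs arbitrary: thesis)
  case Nil
  show ?case by (rule Nil(1)[of "[]" "[]"]) auto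
next
  case (Cons c cs)
  obtain as bs where *: "set as \<subseteq> Basis" "set bs \<subseteq> Basis"
      "mset cs = mset (map (Pair 0) as @ map (\<lambda>b. (b, 0)) bs)"
    using Cons by auto
  from Cons.prems(2) consider b where "b \<in> Basis" "c = (b, 0)" | b where "b \<in> Basis" "c = (0, b)"
    by (auto simp: Basis_prod_def)
  then show ?case
  proof cases
    case (1 b)
    then show ?thesis using * by (intro Cons.prems(1)[of as "b # bs"]) auto
  next
    case (2 b)
    then show ?thesis using * by (intro Cons.prems(1)[of "b # as" bs]) auto
  qed
qed

lemma symbol_deriv_eq_partial_derivs:
  "symbol_deriv \<alpha> \<beta> \<sigma> x \<xi> =
    partial_derivs (map (Pair 0) (map (\<lambda>i. axis i 1) (multiindex_list \<alpha>)) @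
      map (\<lambda>b. (b, 0)) (map (\<lambda>i. axis i 1) (multiindex_list \<beta>))) (\<lambda>(x, \<xi>). \<sigma> x \<xi>) (x, \<xi>)"
  unfolding symbol_deriv_def multi_deriv_def partial_derivs_append partial_derivs_Pair_right
    partial_derivs_Pair_left by simp

text \<open>The multi-indices depend on \<open>cs\<close> alone. The same pair therefore serves all
  (t, \<omega>), and a single dominating process from \<open>S0_infty\<close> covers the derivative
  along \<open>cs\<close>.\<close>

lemma partial_derivs_symbol_deriv:
  fixes cs :: "((real^'n) \<times> (real^'n)) list"
  assumes "set cs \<subseteq> Basis"
  obtains \<alpha> \<beta> where "\<And>\<sigma> x \<xi>. smooth (\<lambda>(x, \<xi>). \<sigma> x \<xi>) \<Longrightarrow>
      partial_derivs cs (\<lambda>(x, \<xi>). \<sigma> x \<xi>) (x, \<xi>) = symbol_deriv \<alpha> \<beta> \<sigma> x \<xi>"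
proof -
  obtain as bs where *: "set as \<subseteq> Basis" "set bs \<subseteq> Basis" "mset cs = mset (map (Pair 0) as @ map (\<lambda>b. (b, 0)) bs)"
    using mset_Basis_prod[OF assms] by metis
  obtain \<alpha> :: "'n multiindex" where \<alpha>: "mset (map (\<lambda>i. axis i 1) (multiindex_list \<alpha>)) = mset as"
    using multiindex_list_of_basis[OF *(1)] .
  obtain \<beta> :: "'n multiindex" where \<beta>: "mset (map (\<lambda>i. axis i 1) (multiindex_list \<beta>)) = mset bs"
    using multiindex_list_of_basis[OF *(2)] .
  have m: "mset cs = mset (map (Pair 0) (map (\<lambda>i. axis i 1) (multiindex_list \<alpha>)) @
      map (\<lambda>b. (b, 0)) (map (\<lambda>i. axis i 1) (multiindex_list \<beta>)))"
    by (simp only: mset_append mset_map[of "Pair 0"] mset_map[of "\<lambda>b. (b, 0)"] \<alpha> \<beta> *(3))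
  show ?thesis
    by (rule that[of \<alpha> \<beta>], unfold symbol_deriv_eq_partial_derivs)
       (rule fun_cong[OF partial_derivs_perm[OF _ _ m]], auto simp: Basis_vec_def Basis_prod_def)
qed

section \<open>The exponential distribution\<close>

abbreviation expm :: "real measure" where
  "expm \<equiv> density lborel (exponential_density 1)"

interpretation expm: prob_space expm
  by (rule prob_space_exponential_density) simp

interpretation expm_lborel: pair_sigma_finite expm "lborel :: 'a::euclidean_space measure" ..

lemma integrable_expm_bounded:
  fixes f :: "real \<Rightarrow> 'b::{banach, second_countable_topology}"
  assumes "f \<in> borel_measurable borel" "\<And>r. norm (f r) \<le> B"
  shows "integrable expm f"
  using assms by (intro expm.integrable_const_bound[where B = B]) auto

lemma integral_expm:
  fixes f :: "real \<Rightarrow> 'b::{banach, second_countable_topology}"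
  assumes [measurable]: "f \<in> borel_measurable borel"
  shows "(\<integral>r. f r \<partial>expm) = (LBINT r:{0<..}. exp (- r) *\<^sub>R f r)"
proof -
  have "(\<integral>r. f r \<partial>expm) = (\<integral>r. exponential_density 1 r *\<^sub>R f r \<partial>lborel)"
    by (rule integral_density) auto
  also have "\<dots> = (LBINT r:{0<..}. exp (- r) *\<^sub>R f r)"
    unfolding set_lebesgue_integral_def
    by (rule integral_cong_AE)
       (use AE_lborel_singleton[of "0::real"] in \<open>auto simp: exponential_density_def indicator_def\<close>)
  finally show ?thesis .
qed

text \<open>Integrates the derivative of \<open>- exp (- r) * N r\<close> over the half-line.\<close>

lemma integral_expm_diff_deriv:
  fixes N :: "real \<Rightarrow> complex"
  assumes N: "\<And>r. (N has_vector_derivative N' r) (at r)"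
    and N': "continuous_on UNIV N'"
    and B: "\<And>r. norm (N r) \<le> B" "\<And>r. norm (N' r) \<le> B"
  shows "(\<integral>r. (N r - N' r) \<partial>expm) = N 0"
proof -
  have cN: "continuous_on UNIV N"
    using N by (auto intro!: continuous_at_imp_continuous_on has_vector_derivative_continuous)
  have [measurable]: "N \<in> borel_measurable borel" "N' \<in> borel_measurable borel"
    using cN N' by (auto intro: borel_measurable_continuous_onI)
  have int: "integrable expm (\<lambda>r. N r - N' r)"
    by (intro Bochner_Integration.integrable_diff integrable_expm_bounded[where B = B]) (auto intro: B)
  then have "integrable lborel (\<lambda>r. exponential_density 1 r *\<^sub>R (N r - N' r))"
    by (subst (asm) integrable_density) auto
  then have sint: "set_integrable lborel {0<..} (\<lambda>r. exp (- r) *\<^sub>R (N r - N' r))"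
    unfolding set_integrable_def
    by (rule Bochner_Integration.integrable_cong_AE_imp)
       (use AE_lborel_singleton[of "0::real"] in \<open>auto simp: exponential_density_def indicator_def\<close>)
  have e: "einterval 0 \<infinity> = {0<..}" by (auto simp: einterval_def)
  have "(LBINT r=0..\<infinity>. exp (- r) *\<^sub>R (N r - N' r)) = 0 - (- N 0)"
  proof (rule interval_integral_FTC_integrable[where F = "\<lambda>r. - (exp (- r) *\<^sub>R N r)"])
    fix r :: real
    show "((\<lambda>r. - (exp (- r) *\<^sub>R N r)) has_vector_derivative exp (- r) *\<^sub>R (N r - N' r)) (at r)"
      by (rule has_vector_derivative_eq_rhs, (rule derivative_eq_intros N refl | simp)+)
         (simp add: scaleR_diff_right)
    show "isCont (\<lambda>r. exp (- r) *\<^sub>R (N r - N' r)) r"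
      using cN N' by (auto intro!: continuous_intros simp: continuous_on_eq_continuous_at)
  next
    have "isCont (\<lambda>r. - (exp (- r) *\<^sub>R N r)) 0"
      using cN by (auto intro!: continuous_intros simp: continuous_on_eq_continuous_at)
    then have "((\<lambda>r. - (exp (- r) *\<^sub>R N r)) \<longlongrightarrow> - N 0) (at_right 0)"
      unfolding isCont_def by (auto intro: tendsto_mono[rotated] simp: at_le)
    then show "(((\<lambda>r. - (exp (- r) *\<^sub>R N r)) \<circ> real_of_ereal) \<longlongrightarrow> - N 0) (at_right 0)"
      by (simp add: ereal_tendsto_simps1 zero_ereal_def)
  next
    have "((\<lambda>r::real. exp (- r) * B) \<longlongrightarrow> 0 * B) at_top"
      by (intro tendsto_mult tendsto_const filterlim_compose[OF exp_at_bot filterlim_uminus_at_bot_at_top])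
    then have "((\<lambda>r::real. exp (- r) * B) \<longlongrightarrow> 0) at_top" by simp
    then have "((\<lambda>r. - (exp (- r) *\<^sub>R N r)) \<longlongrightarrow> 0) at_top"
      by (rule Lim_null_comparison[rotated]) (auto intro!: always_eventually mult_left_mono B)
    then show "(((\<lambda>r. - (exp (- r) *\<^sub>R N r)) \<circ> real_of_ereal) \<longlongrightarrow> 0) (at_left \<infinity>)"
      by (simp add: ereal_tendsto_simps1)
  qed (auto simp: e sint)
  then show ?thesis
    by (simp add: integral_expm interval_lebesgue_integral_def e)
qed

text \<open>For N r = exp (- i r t) the difference N - N' is (1 + i t) N, so
  \<open>integral_expm_diff_deriv\<close> yields the characteristic function of the exponential
  distribution at -t.\<close>

lemma integral_expm_cis:
  "(\<integral>r. exp (- \<i> * of_real (r * t)) \<partial>expm) = 1 / (1 + \<i> * of_real t)"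
proof -
  have nz: "1 + \<i> * of_real t \<noteq> 0" by (auto simp: complex_eq_iff)
  have "(\<integral>r. (exp (- \<i> * of_real (r * t)) - (- \<i> * of_real t * exp (- \<i> * of_real (r * t)))) \<partial>expm) = exp (- \<i> * of_real (0 * t))"
  proof (rule integral_expm_diff_deriv[where B = "1 + \<bar>t\<bar>"])
    fix r :: real
    have "((\<lambda>z. exp (- \<i> * (z * of_real t))) has_field_derivative
        - \<i> * of_real t * exp (- \<i> * (of_real r * of_real t))) (at (of_real r))"
      by (auto intro!: derivative_eq_intros)
    from has_vector_derivative_real_field[OF this]
    show "((\<lambda>r. exp (- \<i> * of_real (r * t))) has_vector_derivative - \<i> * of_real t * exp (- \<i> * of_real (r * t))) (at r)"
      by simp
  qed (auto intro!: continuous_intros simp: norm_mult)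
  also have "(\<lambda>r. exp (- \<i> * of_real (r * t)) - (- \<i> * of_real t * exp (- \<i> * of_real (r * t))))
      = (\<lambda>r. (1 + \<i> * of_real t) * exp (- \<i> * of_real (r * t)))"
    by (auto simp: algebra_simps)
  finally have "(1 + \<i> * of_real t) * (\<integral>r. exp (- \<i> * of_real (r * t)) \<partial>expm) = 1"
    by simp
  then show ?thesis using nz by (simp add: field_simps)
qed

text \<open>Jensen's inequality for the square, read off from the nonnegativity of the variance of
  \<open>norm (f r)\<close>. If the right-hand side is infinite there is nothing to prove.\<close>

lemma norm_integral_expm_square_le:
  fixes f :: "real \<Rightarrow> complex"
  assumes "integrable expm f"
  shows "ennreal ((norm (\<integral>r. f r \<partial>expm))\<^sup>2) \<le> (\<integral>\<^sup>+r. ennreal ((norm (f r))\<^sup>2) \<partial>expm)"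
proof (cases "(\<integral>\<^sup>+r. ennreal ((norm (f r))\<^sup>2) \<partial>expm) = \<infinity>")
  case False
  have [measurable]: "f \<in> borel_measurable borel"
    using borel_measurable_integrable[OF assms] by simp
  have i2: "integrable expm (\<lambda>r. (norm (f r))\<^sup>2)"
    using False by (intro integrableI_nonneg) (auto simp: less_top)
  have "norm (\<integral>r. f r \<partial>expm) \<le> (\<integral>r. norm (f r) \<partial>expm)"
    by (rule integral_norm_bound)
  then have "(norm (\<integral>r. f r \<partial>expm))\<^sup>2 \<le> (\<integral>r. norm (f r) \<partial>expm)\<^sup>2"
    by (rule power_mono) simp
  also have "\<dots> \<le> (\<integral>r. (norm (f r))\<^sup>2 \<partial>expm)"
    using expm.variance_positive[of "\<lambda>r. norm (f r)"] expm.variance_eq[of "\<lambda>r. norm (f r)"] assms i2 by simp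
  finally show ?thesis
    by (subst nn_integral_eq_integral[OF i2]) (auto intro: ennreal_leI)
qed simp

text \<open>Up to the factor 1 / pi, the Poisson kernel of the half-plane at height 1; it is the
  squared modulus of 1 / (1 + i r).\<close>

definition poisson_kernel :: "real \<Rightarrow> real" where
  "poisson_kernel r = 1 / (1 + r\<^sup>2)"

lemma poisson_kernel_measurable [measurable]: "poisson_kernel \<in> borel_measurable borel"
  unfolding poisson_kernel_def by measurable

lemma poisson_kernel_nonneg [simp]: "0 \<le> poisson_kernel r"
  by (simp add: poisson_kernel_def)

lemma nn_integral_poisson_kernel: "(\<integral>\<^sup>+r. ennreal (poisson_kernel r) \<partial>lborel) = ennreal pi"
proof -
  have "(\<integral>\<^sup>+r. ennreal (inverse (1 + r\<^sup>2)) \<partial>lborel) = ennreal (LBINT x=-\<infinity>..\<infinity>. inverse (1 + x^2))"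
    using Sinc_Integral.integrable_inverse_1_plus_square
    by (simp add: interval_lebesgue_integral_def set_lebesgue_integral_def set_integrable_def nn_integral_eq_integral)
  also have "\<dots> = ennreal pi"
    by (simp add: LBINT_inverse_1_plus_square)
  finally have "(\<integral>\<^sup>+r. ennreal (inverse (1 + r\<^sup>2)) \<partial>lborel) = ennreal pi" .
  then show ?thesis by (simp add: poisson_kernel_def inverse_eq_divide)
qed

text \<open>Replaces the half-line density by a weight that is a squared modulus and can be absorbed
  by division by a linear weight. For r \<ge> 0 the factor 2 comes from 1 + r^2 \<le> 2 (1 + r + r^2
  / 2) \<le> 2 exp r.\<close>

lemma exponential_density_le: "exponential_density 1 r \<le> 2 * poisson_kernel r"
proof (cases "r < 0")
  case False
  then have "1 + r + r\<^sup>2 / 2 \<le> exp r"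
    by (intro exp_lower_Taylor_quadratic) auto
  then have "1 + r\<^sup>2 \<le> 2 * exp r" using False by simp
  moreover have "0 < 1 + r\<^sup>2" by (rule add_pos_nonneg) auto
  ultimately show ?thesis
    using False by (simp add: exponential_density_def poisson_kernel_def exp_minus field_simps)
qed (simp add: exponential_density_def)

lemma nn_integral_expm_le:
  assumes [measurable]: "f \<in> borel_measurable borel"
  shows "(\<integral>\<^sup>+r. f r \<partial>expm) \<le> (\<integral>\<^sup>+r. ennreal (2 * poisson_kernel r) * f r \<partial>lborel)"
proof -
  have "(\<integral>\<^sup>+r. f r \<partial>expm) = (\<integral>\<^sup>+r. ennreal (exponential_density 1 r) * f r \<partial>lborel)"
    by (rule nn_integral_density) auto
  also have "\<dots> \<le> (\<integral>\<^sup>+r. ennreal (2 * poisson_kernel r) * f r \<partial>lborel)"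
    by (intro nn_integral_mono mult_right_mono ennreal_leI exponential_density_le) auto
  finally show ?thesis .
qed

section \<open>Translation, reflection and products for Lebesgue measure\<close>

lemma lborel_distr_reflect: "distr lborel borel (\<lambda>x::'a::euclidean_space. c - x) = lborel"
  by (subst (2) lborel_affine[of "-1" c]) (auto simp: density_1)

lemma lborel_distr_shift: "distr lborel borel (\<lambda>x::'a::euclidean_space. x + c) = lborel"
  using lborel_distr_plus[of c] by (simp add: add.commute cong: distr_cong)

lemma nn_integral_lborel_reflect:
  fixes f :: "'a::euclidean_space \<Rightarrow> ennreal"
  assumes [measurable]: "f \<in> borel_measurable borel"
  shows "(\<integral>\<^sup>+x. f (c - x) \<partial>lborel) = (\<integral>\<^sup>+x. f x \<partial>lborel)"
  by (subst (2) lborel_distr_reflect[of c, symmetric]) (simp add: nn_integral_distr)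

lemma nn_integral_lborel_shift:
  fixes f :: "'a::euclidean_space \<Rightarrow> ennreal"
  assumes [measurable]: "f \<in> borel_measurable borel"
  shows "(\<integral>\<^sup>+x. f (x + c) \<partial>lborel) = (\<integral>\<^sup>+x. f x \<partial>lborel)"
  by (subst (2) lborel_distr_shift[of c, symmetric]) (simp add: nn_integral_distr)

lemma integral_lborel_shift:
  fixes f :: "'a::euclidean_space \<Rightarrow> 'b::{banach, second_countable_topology}"
  assumes [measurable]: "f \<in> borel_measurable borel"
  shows "(\<integral>x. f (x + c) \<partial>lborel) = (\<integral>x. f x \<partial>lborel)"
  by (subst (2) lborel_distr_shift[of c, symmetric]) (simp add: integral_distr)

text \<open>The form in which the hypothesis of Fubini's theorem is checked: the integrands are
  oscillating factors times functions of separate variables, one of which may be a constant on a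
  probability space.\<close>

lemma (in pair_sigma_finite) integrable_bounded_by_product:
  fixes F :: "'a \<times> 'b \<Rightarrow> 'c::{banach, second_countable_topology}"
    and f :: "'a \<Rightarrow> 'd::{banach, second_countable_topology}"
    and g :: "'b \<Rightarrow> 'e::{banach, second_countable_topology}"
  assumes F [measurable]: "F \<in> borel_measurable (M1 \<Otimes>\<^sub>M M2)"
    and f: "integrable M1 f" and g: "integrable M2 g"
    and le: "\<And>x y. norm (F (x, y)) \<le> norm (f x) * norm (g y)"
  shows "integrable (M1 \<Otimes>\<^sub>M M2) F"
proof (rule integrableI_bounded)
  have [measurable]: "f \<in> borel_measurable M1" "g \<in> borel_measurable M2"
    using f g by auto
  have "(\<integral>\<^sup>+p. ennreal (norm (F p)) \<partial>(M1 \<Otimes>\<^sub>M M2)) = (\<integral>\<^sup>+x. \<integral>\<^sup>+y. ennreal (norm (F (x, y))) \<partial>M2 \<partial>M1)"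
    by (rule M2.nn_integral_fst[symmetric]) measurable
  also have "\<dots> \<le> (\<integral>\<^sup>+x. \<integral>\<^sup>+y. ennreal (norm (f x)) * ennreal (norm (g y)) \<partial>M2 \<partial>M1)"
    by (intro nn_integral_mono) (simp add: ennreal_mult[symmetric] le)
  also have "\<dots> = (\<integral>\<^sup>+x. ennreal (norm (f x)) \<partial>M1) * (\<integral>\<^sup>+y. ennreal (norm (g y)) \<partial>M2)"
    by (simp add: nn_integral_cmult nn_integral_multc)
  also have "\<dots> < \<infinity>"
    using f g by (auto simp: integrable_iff_bounded ennreal_mult_less_top)
  finally show "(\<integral>\<^sup>+p. ennreal (norm (F p)) \<partial>(M1 \<Otimes>\<^sub>M M2)) < \<infinity>" .
qed (rule F)

interpretation lborel_PiM: product_sigma_finite "\<lambda>_. lborel :: real measure" ..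

lemma
  fixes h :: "'a::euclidean_space \<Rightarrow> real \<Rightarrow> 'b::{real_normed_field, banach, second_countable_topology}"
  assumes h: "\<And>b. b \<in> Basis \<Longrightarrow> integrable lborel (h b)"
  shows integral_lborel_prod: "(\<integral>x. (\<Prod>b\<in>Basis. h b (x \<bullet> b)) \<partial>lborel) = (\<Prod>b\<in>Basis. \<integral>t. h b t \<partial>lborel)"
    and integrable_lborel_prod: "integrable lborel (\<lambda>x. \<Prod>b\<in>Basis. h b (x \<bullet> b))"
proof -
  have [measurable]: "b \<in> Basis \<Longrightarrow> h b \<in> borel_measurable borel" for b
    using borel_measurable_integrable[OF h] by simp
  have m: "(\<lambda>x::'a. \<Prod>b\<in>Basis. h b (x \<bullet> b)) \<in> borel_measurable borel"
    by (intro borel_measurable_prod) auto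
  have c: "(\<Sum>b\<in>Basis. f b *\<^sub>R b) \<bullet> c = f c" if "c \<in> Basis" for f :: "'a \<Rightarrow> real" and c
    using that by simp
  have "(\<integral>x. (\<Prod>b\<in>Basis. h b (x \<bullet> b)) \<partial>lborel) = (\<integral>f. (\<Prod>b\<in>Basis. h b (f b)) \<partial>(\<Pi>\<^sub>M b\<in>Basis. lborel))"
    by (subst lborel_eq, subst integral_distr) (auto simp: m intro!: Bochner_Integration.integral_cong prod.cong)
  also have "\<dots> = (\<Prod>b\<in>Basis. \<integral>t. h b t \<partial>lborel)"
    by (rule lborel_PiM.product_integral_prod) (auto simp: h)
  finally show "(\<integral>x. (\<Prod>b\<in>Basis. h b (x \<bullet> b)) \<partial>lborel) = (\<Prod>b\<in>Basis. \<integral>t. h b t \<partial>lborel)" .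
  have "integrable (\<Pi>\<^sub>M b\<in>(Basis::'a set). lborel) (\<lambda>f. \<Prod>b\<in>Basis. h b (f b))"
    by (rule lborel_PiM.product_integrable_prod) (auto simp: h)
  also have "?this \<longleftrightarrow> integrable (\<Pi>\<^sub>M b\<in>(Basis::'a set). lborel) (\<lambda>f. \<Prod>b\<in>Basis. h b ((\<Sum>b\<in>Basis. f b *\<^sub>R b) \<bullet> b))"
    by (intro Bochner_Integration.integrable_cong prod.cong refl) (simp add: c)
  finally show "integrable lborel (\<lambda>x. \<Prod>b\<in>Basis. h b (x \<bullet> b))"
    by (subst lborel_eq, subst integrable_distr_eq) (auto simp: m)
qed

section \<open>The Fourier transform\<close>

lemma cnj_measurable [measurable]:
  "f \<in> borel_measurable M \<Longrightarrow> (\<lambda>x. cnj (f x)) \<in> borel_measurable M"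
  by (rule measurable_compose[OF _ borel_measurable_continuous_onI]) (auto intro: continuous_intros)

lemma fourier_measurable [measurable]:
  assumes [measurable]: "u \<in> borel_measurable borel"
  shows "fourier u \<in> borel_measurable borel"
  unfolding fourier_def[abs_def] by measurable

lemma integrable_exp_mult:
  fixes u :: "'a::euclidean_space \<Rightarrow> complex"
  assumes "integrable lborel u"
  shows "integrable lborel (\<lambda>x. exp (- \<i> * of_real (x \<bullet> y)) * u x)"
proof -
  have [measurable]: "u \<in> borel_measurable borel" using borel_measurable_integrable[OF assms] by simp
  show ?thesis
    by (rule Bochner_Integration.integrable_bound[OF assms]) (auto simp: norm_mult)
qed

lemma norm_fourier_le: "norm (fourier u \<xi>) \<le> (\<integral>x. norm (u x) \<partial>lborel)"
  unfolding fourier_def by (rule integral_norm_bound[THEN order_trans]) (simp add: norm_mult)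

text \<open>The multiplication formula: both sides are iterated integrals of exp (- i x . \<xi>)
  f(x) g(\<xi>), taken in opposite orders.\<close>

lemma fourier_swap:
  fixes f g :: "real^'n \<Rightarrow> complex"
  assumes f: "integrable lborel f" and g: "integrable lborel g"
  shows "(\<integral>\<xi>. fourier f \<xi> * g \<xi> \<partial>lborel) = (\<integral>x. f x * fourier g x \<partial>lborel)"
proof -
  have [measurable]: "f \<in> borel_measurable borel" "g \<in> borel_measurable borel"
    using borel_measurable_integrable[OF f] borel_measurable_integrable[OF g] by auto
  let ?F = "\<lambda>x \<xi>. exp (- \<i> * of_real (x \<bullet> \<xi>)) * f x * g \<xi>"
  have "integrable (lborel \<Otimes>\<^sub>M lborel) (case_prod ?F)"
    by (rule lborel_pair.integrable_bounded_by_product[OF _ f g]) (auto simp: norm_mult)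
  from lborel_pair.Fubini_integral[OF this]
  have "(\<integral>\<xi>. (\<integral>x. ?F x \<xi> \<partial>lborel) \<partial>lborel) = (\<integral>x. (\<integral>\<xi>. ?F x \<xi> \<partial>lborel) \<partial>lborel)" .
  moreover have "(\<integral>x. ?F x \<xi> \<partial>lborel) = fourier f \<xi> * g \<xi>" for \<xi>
    unfolding fourier_def by simp
  moreover have "(\<integral>\<xi>. ?F x \<xi> \<partial>lborel) = f x * fourier g x" for x
    unfolding fourier_def
    by (subst Bochner_Integration.integral_mult_right_zero[symmetric])
       (auto intro!: Bochner_Integration.integral_cong simp: inner_commute mult_ac)
  ultimately show ?thesis by (simp only:)
qed

section \<open>The Plancherel inequality\<close>

definition gauss :: "real \<Rightarrow> 'a::euclidean_space \<Rightarrow> real" where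
  "gauss k x = (\<Prod>b\<in>Basis. exp (- (x \<bullet> b)\<^sup>2 / (2 * k\<^sup>2)))"

text \<open>The Fourier transform of \<open>gauss k\<close>: a product of normal densities of
  standard deviation 1 / k. Its total mass (2 pi)^n does not depend on k, which keeps the Plancherel
  bound uniform while the damping is removed.\<close>

definition gauss_ft :: "real \<Rightarrow> 'a::euclidean_space \<Rightarrow> real" where
  "gauss_ft k x = (\<Prod>b\<in>Basis. 2 * pi * normal_density 0 (1 / k) (x \<bullet> b))"

lemma gauss_measurable [measurable]: "gauss k \<in> borel_measurable borel"
  "gauss_ft k \<in> borel_measurable borel"
  unfolding gauss_def gauss_ft_def by (auto intro!: borel_measurable_prod)

lemma gauss_nonneg [simp]: "0 \<le> gauss k x" "0 \<le> gauss_ft k x"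
  unfolding gauss_def gauss_ft_def by (auto intro!: prod_nonneg)

lemma gauss_ft_uminus: "gauss_ft k (x - y) = gauss_ft k (y - x)"
  unfolding gauss_ft_def normal_density_def
  by (intro prod.cong refl) (simp add: inner_diff_left power2_commute)

lemma nn_integral_gauss_ft:
  assumes "0 < k"
  shows "(\<integral>\<^sup>+x. ennreal (gauss_ft k (x::'a::euclidean_space)) \<partial>lborel) = ennreal ((2 * pi) ^ DIM('a))"
proof -
  interpret prob_space "density lborel (normal_density 0 (1 / k))"
    by (rule prob_space_normal_density) (use assms in simp)
  have 1: "(\<integral>\<^sup>+x. ennreal (normal_density 0 (1 / k) x) \<partial>lborel) = 1"
    using emeasure_space_1 by (simp add: emeasure_density)
  have "(\<integral>\<^sup>+x. ennreal (gauss_ft k (x::'a)) \<partial>lborel)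
      = (\<integral>\<^sup>+x. (\<Prod>b\<in>Basis. ennreal (2 * pi * normal_density 0 (1 / k) (x \<bullet> b))) \<partial>(lborel :: 'a measure))"
    unfolding gauss_ft_def by (subst prod_ennreal) auto
  also have "\<dots> = (\<Prod>b\<in>(Basis::'a set). \<integral>\<^sup>+t. ennreal (2 * pi * normal_density 0 (1 / k) t) \<partial>lborel)"
    by (rule nn_integral_lborel_prod) auto
  also have "\<dots> = (\<Prod>b\<in>(Basis::'a set). ennreal (2 * pi))"
    by (intro prod.cong refl) (simp add: ennreal_mult nn_integral_cmult 1)
  finally show ?thesis by (simp add: ennreal_power)
qed

text \<open>The characteristic function of the standard normal distribution, rescaled by k; the
  factor \<open>sqrt (2 * pi)\<close> undoes the normalisation of the density.\<close>

lemma integral_gauss_1d: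
  assumes k: "0 < k"
  shows "integrable lborel (\<lambda>t. exp (\<i> * of_real (s * t)) * of_real (exp (- t\<^sup>2 / (2 * k\<^sup>2))))"
    and "(\<integral>t. exp (\<i> * of_real (s * t)) * of_real (exp (- t\<^sup>2 / (2 * k\<^sup>2))) \<partial>lborel)
      = of_real (2 * pi * normal_density 0 (1 / k) s)"
proof -
  let ?f = "\<lambda>t. exp (\<i> * of_real (s * k * t)) * of_real (std_normal_density t)"
  have int: "integrable lborel ?f"
    by (rule Bochner_Integration.integrable_bound[OF integrable_normal_density[of 1 0]])
       (auto simp: norm_mult)
  have "(\<integral>t. ?f t \<partial>lborel) = char std_normal_distribution (s * k)"
    unfolding char_def by (subst integral_density) (auto simp: scaleR_conv_of_real mult.commute)
  then have val: "(\<integral>t. ?f t \<partial>lborel) = of_real (exp (- (s * k)\<^sup>2 / 2))"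
    by (simp add: char_std_normal_distribution)
  have ik: "(1 / k) \<noteq> 0" using k by simp
  have hb: "has_bochner_integral lborel ?f (of_real (exp (- (s * k)\<^sup>2 / 2)))"
    using int val by (simp add: has_bochner_integral_iff)
  have "has_bochner_integral lborel (\<lambda>t. ?f (0 + (1 / k) * t)) (of_real (exp (- (s * k)\<^sup>2 / 2)) /\<^sub>R \<bar>1 / k\<bar>)"
    using hb lborel_has_bochner_integral_real_affine_iff[OF ik, where t = 0 and f = ?f] by blast
  from has_bochner_integral_mult_right[OF this, of "of_real (sqrt (2 * pi))"]
  have "has_bochner_integral lborel (\<lambda>t. exp (\<i> * of_real (s * t)) * of_real (exp (- t\<^sup>2 / (2 * k\<^sup>2))))
      (of_real (sqrt (2 * pi) * k * exp (- (s * k)\<^sup>2 / 2)))"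
    using k by (simp add: std_normal_density_def power_divide field_simps scaleR_conv_of_real)
  moreover have "sqrt (2 * pi) * k * exp (- (s * k)\<^sup>2 / 2) = 2 * pi * normal_density 0 (1 / k) s"
    using k by (simp add: normal_density_def real_sqrt_divide power_mult_distrib power_divide field_simps)
  ultimately have *: "has_bochner_integral lborel (\<lambda>t. exp (\<i> * of_real (s * t)) * of_real (exp (- t\<^sup>2 / (2 * k\<^sup>2))))
      (of_real (2 * pi * normal_density 0 (1 / k) s))" by (simp only:)
  show "integrable lborel (\<lambda>t. exp (\<i> * of_real (s * t)) * of_real (exp (- t\<^sup>2 / (2 * k\<^sup>2))))"
    "(\<integral>t. exp (\<i> * of_real (s * t)) * of_real (exp (- t\<^sup>2 / (2 * k\<^sup>2))) \<partial>lborel)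
      = of_real (2 * pi * normal_density 0 (1 / k) s)"
    using * by (auto simp: has_bochner_integral_iff)
qed

lemma gauss_fourier:
  fixes y :: "'a::euclidean_space"
  assumes k: "0 < k"
  shows "integrable lborel (\<lambda>x. exp (\<i> * of_real (y \<bullet> x)) * of_real (gauss k x))"
    and "(\<integral>x. exp (\<i> * of_real (y \<bullet> x)) * of_real (gauss k x) \<partial>lborel) = of_real (gauss_ft k y)"
proof -
  have e: "exp (\<i> * of_real (y \<bullet> x)) * of_real (gauss k x)
     = (\<Prod>b\<in>Basis. exp (\<i> * of_real ((y \<bullet> b) * (x \<bullet> b))) * of_real (exp (- (x \<bullet> b)\<^sup>2 / (2 * k\<^sup>2))))" for x
    by (simp add: gauss_def prod.distrib exp_sum euclidean_inner[of y x] sum_distrib_left)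
  show "integrable lborel (\<lambda>x. exp (\<i> * of_real (y \<bullet> x)) * of_real (gauss k x))"
    unfolding e by (rule integrable_lborel_prod) (rule integral_gauss_1d[OF k])
  show "(\<integral>x. exp (\<i> * of_real (y \<bullet> x)) * of_real (gauss k x) \<partial>lborel) = of_real (gauss_ft k y)"
    unfolding e by (subst integral_lborel_prod)
      (rule integral_gauss_1d(1)[OF k], simp only: integral_gauss_1d(2)[OF k] gauss_ft_def of_real_prod)
qed

lemma gauss_integrable: "0 < k \<Longrightarrow> integrable lborel (gauss k :: 'a::euclidean_space \<Rightarrow> real)"
  using gauss_fourier(1)[of k "0::'a"] integrable_Re by fastforce

text \<open>Schur's test for a symmetric kernel: a product of norms is at most half the sum of the
  squares, and in each half one variable occurs only in the kernel and integrates to (2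
  pi)^n.\<close>

lemma schur_gauss_ft:
  fixes f :: "'a::euclidean_space \<Rightarrow> complex"
  assumes k: "0 < k" and [measurable]: "f \<in> borel_measurable borel"
  shows "(\<integral>\<^sup>+x. \<integral>\<^sup>+y. ennreal (norm (f x) * norm (f y) * gauss_ft k (x - y)) \<partial>lborel \<partial>lborel)
     \<le> ennreal ((2 * pi) ^ DIM('a)) * (\<integral>\<^sup>+x. ennreal ((norm (f x))\<^sup>2) \<partial>lborel)"
proof -
  let ?S = "\<integral>\<^sup>+x. ennreal ((norm (f x))\<^sup>2) \<partial>lborel"
  let ?c = "ennreal ((2 * pi) ^ DIM('a))"
  have le: "norm (f x) * norm (f y) * g \<le> (norm (f x))\<^sup>2 / 2 * g + (norm (f y))\<^sup>2 / 2 * g" if "0 \<le> g" for x y g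
  proof -
    have "norm (f x) * norm (f y) \<le> (norm (f x))\<^sup>2 / 2 + (norm (f y))\<^sup>2 / 2"
      using sum_squares_bound[of "norm (f x)" "norm (f y)"] by simp
    from mult_right_mono[OF this that] show ?thesis by (simp add: algebra_simps)
  qed
  have "(\<integral>\<^sup>+x. \<integral>\<^sup>+y. ennreal (norm (f x) * norm (f y) * gauss_ft k (x - y)) \<partial>lborel \<partial>lborel)
     \<le> (\<integral>\<^sup>+x. \<integral>\<^sup>+y. ennreal ((norm (f x))\<^sup>2 / 2) * ennreal (gauss_ft k (x - y))
          + ennreal ((norm (f y))\<^sup>2 / 2) * ennreal (gauss_ft k (x - y)) \<partial>lborel \<partial>lborel)"
  proof (intro nn_integral_mono)
    fix x y :: 'a
    have "ennreal (norm (f x) * norm (f y) * gauss_ft k (x - y))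
        \<le> ennreal ((norm (f x))\<^sup>2 / 2 * gauss_ft k (x - y) + (norm (f y))\<^sup>2 / 2 * gauss_ft k (x - y))"
      by (intro ennreal_leI le) simp
    also have "\<dots> = ennreal ((norm (f x))\<^sup>2 / 2 * gauss_ft k (x - y)) + ennreal ((norm (f y))\<^sup>2 / 2 * gauss_ft k (x - y))"
      by (rule ennreal_plus) auto
    also have "\<dots> = ennreal ((norm (f x))\<^sup>2 / 2) * ennreal (gauss_ft k (x - y))
          + ennreal ((norm (f y))\<^sup>2 / 2) * ennreal (gauss_ft k (x - y))"
      by (intro arg_cong2[of _ _ _ _ "(+)"] ennreal_mult) auto
    finally show "ennreal (norm (f x) * norm (f y) * gauss_ft k (x - y)) \<le> ennreal ((norm (f x))\<^sup>2 / 2) * ennreal (gauss_ft k (x - y))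
          + ennreal ((norm (f y))\<^sup>2 / 2) * ennreal (gauss_ft k (x - y))" .
  qed
  also have "\<dots> = (\<integral>\<^sup>+x. \<integral>\<^sup>+y. ennreal ((norm (f x))\<^sup>2 / 2) * ennreal (gauss_ft k (x - y)) \<partial>lborel \<partial>lborel)
      + (\<integral>\<^sup>+x. \<integral>\<^sup>+y. ennreal ((norm (f y))\<^sup>2 / 2) * ennreal (gauss_ft k (x - y)) \<partial>lborel \<partial>lborel)"
    by (simp add: nn_integral_add)
  also have "(\<integral>\<^sup>+x. \<integral>\<^sup>+y. ennreal ((norm (f y))\<^sup>2 / 2) * ennreal (gauss_ft k (x - y)) \<partial>lborel \<partial>lborel)
      = (\<integral>\<^sup>+y. \<integral>\<^sup>+x. ennreal ((norm (f y))\<^sup>2 / 2) * ennreal (gauss_ft k (x - y)) \<partial>lborel \<partial>lborel)"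
    by (rule lborel_pair.Fubini') measurable
  also have "\<dots> = (\<integral>\<^sup>+x. \<integral>\<^sup>+y. ennreal ((norm (f x))\<^sup>2 / 2) * ennreal (gauss_ft k (x - y)) \<partial>lborel \<partial>lborel)"
    by (intro nn_integral_cong, subst gauss_ft_uminus) (rule refl)
  also have "(\<integral>\<^sup>+x. \<integral>\<^sup>+y. ennreal ((norm (f x))\<^sup>2 / 2) * ennreal (gauss_ft k (x - y)) \<partial>lborel \<partial>lborel)
      = (\<integral>\<^sup>+x. ennreal ((norm (f x))\<^sup>2 / 2) * ?c \<partial>lborel)"
    using nn_integral_lborel_reflect[of "\<lambda>y::'a. ennreal (gauss_ft k y)"]
    by (simp add: nn_integral_cmult nn_integral_gauss_ft[OF k])
  also have "\<dots> + \<dots> = (\<integral>\<^sup>+x. (ennreal ((norm (f x))\<^sup>2 / 2) + ennreal ((norm (f x))\<^sup>2 / 2)) * ?c \<partial>lborel)"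
    by (subst nn_integral_add[symmetric]) (auto simp: distrib_right)
  also have "\<dots> = ?c * ?S"
    by (simp add: ennreal_plus[symmetric] nn_integral_multc mult.commute del: ennreal_plus)
  finally show ?thesis .
qed

text \<open>An inequality admits a proof without Fourier inversion. Damping by
  \<open>gauss k\<close> makes the integrals absolutely convergent, the multiplication formula turns
  the damped square norm into a double integral with kernel \<open>gauss_ft k\<close>, Schur's test
  bounds it uniformly in k, and Fatou's lemma removes the damping.\<close>

theorem plancherel_le:
  fixes f :: "real^'n \<Rightarrow> complex"
  assumes f: "integrable lborel f"
  shows "(\<integral>\<^sup>+\<xi>. ennreal ((norm (fourier f \<xi>))\<^sup>2) \<partial>lborel)
     \<le> ennreal ((2 * pi) ^ CARD('n)) * (\<integral>\<^sup>+x. ennreal ((norm (f x))\<^sup>2) \<partial>lborel)"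
proof -
  have [measurable]: "f \<in> borel_measurable borel" using borel_measurable_integrable[OF f] by simp
  let ?R = "ennreal ((2 * pi) ^ CARD('n)) * (\<integral>\<^sup>+x. ennreal ((norm (f x))\<^sup>2) \<partial>lborel)"
  have bnd: "(\<integral>\<^sup>+\<xi>. ennreal ((norm (fourier f \<xi>))\<^sup>2 * gauss k \<xi>) \<partial>lborel) \<le> ?R" if k: "0 < k" for k
  proof -
    let ?g = "\<lambda>y \<xi>. exp (\<i> * of_real (y \<bullet> \<xi>)) * of_real (gauss k \<xi>)"
    let ?B = "\<integral>x. norm (f x) \<partial>lborel"
    \<comment> \<open>Chosen so that \<open>fourier f\<close> times \<open>h\<close> is the damped
      square, to which the multiplication formula applies.\<close>
    define h where "h \<xi> = of_real (gauss k \<xi>) * cnj (fourier f \<xi>)" for \<xi>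
    have h: "integrable lborel h"
      unfolding h_def
      by (rule Bochner_Integration.integrable_bound[OF integrable_mult_left[OF gauss_integrable[OF k], of ?B]])
         (auto simp: norm_mult intro!: mult_left_mono norm_fourier_le)
    have g: "integrable lborel (?g y)" for y :: "real^'n" by (rule gauss_fourier[OF k])
    have fg: "fourier (?g y) x = of_real (gauss_ft k (y - x))" for x y :: "real^'n"
    proof -
      have "exp (- \<i> * of_real (\<xi> \<bullet> x)) * exp (\<i> * of_real (y \<bullet> \<xi>)) = exp (\<i> * of_real ((y - x) \<bullet> \<xi>))" for \<xi>
        by (simp add: exp_add[symmetric] inner_diff_left inner_commute[of \<xi> x] right_diff_distrib)
      then show ?thesis
        unfolding fourier_def gauss_fourier(2)[OF k, symmetric]
        by (intro Bochner_Integration.integral_cong refl) (metis mult.assoc)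
    qed
    \<comment> \<open>The conjugate of \<open>fourier h\<close> is an integral of
      \<open>fourier f\<close> against \<open>?g y\<close>; a second use of the multiplication
      formula makes it the convolution of \<open>f\<close> with \<open>gauss_ft k\<close>.\<close>
    have fh: "fourier h y = cnj (\<integral>x. f x * of_real (gauss_ft k (y - x)) \<partial>lborel)" for y
    proof -
      have "cnj (fourier h y) = (\<integral>\<xi>. cnj (exp (- \<i> * of_real (\<xi> \<bullet> y)) * h \<xi>) \<partial>lborel)"
        unfolding fourier_def by (rule Bochner_Integration.integral_cnj[symmetric])
      also have "\<dots> = (\<integral>\<xi>. fourier f \<xi> * ?g y \<xi> \<partial>lborel)"
        by (intro Bochner_Integration.integral_cong refl)
           (simp add: h_def exp_cnj inner_commute mult_ac)
      also have "\<dots> = (\<integral>x. f x * of_real (gauss_ft k (y - x)) \<partial>lborel)"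
        unfolding fourier_swap[OF f g] fg ..
      finally show ?thesis by (metis complex_cnj_cnj)
    qed
    have int: "integrable lborel (\<lambda>\<xi>. (norm (fourier f \<xi>))\<^sup>2 * gauss k \<xi>)"
    proof (rule Bochner_Integration.integrable_bound[OF integrable_mult_left[OF gauss_integrable[OF k], of "?B\<^sup>2"]])
      show "AE \<xi> in lborel. norm ((norm (fourier f \<xi>))\<^sup>2 * gauss k \<xi>) \<le> norm (gauss k \<xi> * ?B\<^sup>2)"
        by (auto simp: abs_mult mult.commute intro!: mult_left_mono power_mono norm_fourier_le)
    qed measurable
    have "of_real (\<integral>\<xi>. (norm (fourier f \<xi>))\<^sup>2 * gauss k \<xi> \<partial>lborel) = (\<integral>\<xi>. fourier f \<xi> * h \<xi> \<partial>lborel)"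
      by (subst integral_complex_of_real[symmetric])
         (intro Bochner_Integration.integral_cong refl, simp only: h_def of_real_mult complex_norm_square mult_ac)
    also have "\<dots> = (\<integral>x. f x * fourier h x \<partial>lborel)" by (rule fourier_swap[OF f h])
    finally have eq: "of_real (\<integral>\<xi>. (norm (fourier f \<xi>))\<^sup>2 * gauss k \<xi> \<partial>lborel) = (\<integral>x. f x * fourier h x \<partial>lborel)" .
    have nn: "0 \<le> (\<integral>\<xi>. (norm (fourier f \<xi>))\<^sup>2 * gauss k \<xi> \<partial>lborel)"
      by (intro integral_nonneg_AE) auto
    have "(\<integral>\<^sup>+\<xi>. ennreal ((norm (fourier f \<xi>))\<^sup>2 * gauss k \<xi>) \<partial>lborel)
        = ennreal (\<integral>\<xi>. (norm (fourier f \<xi>))\<^sup>2 * gauss k \<xi> \<partial>lborel)"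
      by (rule nn_integral_eq_integral[OF int]) auto
    also have "\<dots> = ennreal (norm (\<integral>x. f x * fourier h x \<partial>lborel))"
      unfolding eq[symmetric] using nn by simp
    also have "\<dots> \<le> (\<integral>\<^sup>+x. ennreal (norm (f x * fourier h x)) \<partial>lborel)"
    proof (rule integral_norm_bound_ennreal)
      show "integrable lborel (\<lambda>x. f x * fourier h x)"
        by (rule Bochner_Integration.integrable_bound[OF integrable_mult_left[OF f, of "of_real (\<integral>x. norm (h x) \<partial>lborel)"]])
           (use borel_measurable_integrable[OF h] in \<open>auto simp: norm_mult intro!: mult_left_mono norm_fourier_le[THEN order_trans]\<close>)
    qed
    also have "\<dots> \<le> (\<integral>\<^sup>+x. \<integral>\<^sup>+y. ennreal (norm (f x) * norm (f y) * gauss_ft k (x - y)) \<partial>lborel \<partial>lborel)"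
    proof (rule nn_integral_mono)
      fix x
      have "ennreal (norm (f x * fourier h x)) = ennreal (norm (f x)) * ennreal (norm (\<integral>y. f y * of_real (gauss_ft k (x - y)) \<partial>lborel))"
        by (simp add: fh norm_mult ennreal_mult)
      also have "ennreal (norm (\<integral>y. f y * of_real (gauss_ft k (x - y)) \<partial>lborel)) \<le> (\<integral>\<^sup>+y. ennreal (norm (f y * of_real (gauss_ft k (x - y)))) \<partial>lborel)"
      \<comment> \<open>The Bochner integral of a function that is not integrable is 0, so the bound
        holds in either case.\<close>
      proof (cases "integrable lborel (\<lambda>y. f y * of_real (gauss_ft k (x - y)))")
        case True then show ?thesis by (rule integral_norm_bound_ennreal)
      qed (simp add: not_integrable_integral_eq)
      also have "ennreal (norm (f x)) * \<dots> = (\<integral>\<^sup>+y. ennreal (norm (f x) * norm (f y) * gauss_ft k (x - y)) \<partial>lborel)"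
        by (subst nn_integral_cmult[symmetric]) (auto simp: ennreal_mult norm_mult mult.assoc)
      finally show "ennreal (norm (f x * fourier h x)) \<le> (\<integral>\<^sup>+y. ennreal (norm (f x) * norm (f y) * gauss_ft k (x - y)) \<partial>lborel)"
        by (simp add: mult_left_mono)
    qed
    also have "\<dots> \<le> ?R" using schur_gauss_ft[OF k, of f] by simp
    finally show ?thesis .
  qed
  have lim: "(\<lambda>j. gauss (real (Suc j)) \<xi>) \<longlonglongrightarrow> 1" for \<xi> :: "real^'n"
  proof -
    have "(\<lambda>j. exp (- (\<xi> \<bullet> b)\<^sup>2 / (2 * (real (Suc j))\<^sup>2))) \<longlonglongrightarrow> 1" for b
      by real_asymp
    then have "(\<lambda>j. gauss (real (Suc j)) \<xi>) \<longlonglongrightarrow> (\<Prod>b\<in>(Basis::(real^'n) set). 1)"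
      unfolding gauss_def by (intro tendsto_prod)
    then show ?thesis by simp
  qed
  have "(\<integral>\<^sup>+\<xi>. ennreal ((norm (fourier f \<xi>))\<^sup>2) \<partial>lborel)
      = (\<integral>\<^sup>+\<xi>. liminf (\<lambda>j. ennreal ((norm (fourier f \<xi>))\<^sup>2 * gauss (real (Suc j)) \<xi>)) \<partial>lborel)"
  proof (rule nn_integral_cong)
    fix \<xi>
    have "(\<lambda>j. ennreal ((norm (fourier f \<xi>))\<^sup>2 * gauss (real (Suc j)) \<xi>)) \<longlonglongrightarrow> ennreal ((norm (fourier f \<xi>))\<^sup>2 * 1)"
      by (intro tendsto_ennrealI tendsto_intros lim)
    from lim_imp_Liminf[OF _ this]
    show "ennreal ((norm (fourier f \<xi>))\<^sup>2) = liminf (\<lambda>j. ennreal ((norm (fourier f \<xi>))\<^sup>2 * gauss (real (Suc j)) \<xi>))"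
      by simp
  qed
  also have "\<dots> \<le> liminf (\<lambda>j. \<integral>\<^sup>+\<xi>. ennreal ((norm (fourier f \<xi>))\<^sup>2 * gauss (real (Suc j)) \<xi>) \<partial>lborel)"
    by (rule nn_integral_liminf) auto
  also have "\<dots> \<le> limsup (\<lambda>j. \<integral>\<^sup>+\<xi>. ennreal ((norm (fourier f \<xi>))\<^sup>2 * gauss (real (Suc j)) \<xi>) \<partial>lborel)"
    by (rule Liminf_le_Limsup) auto
  also have "\<dots> \<le> ?R"
    by (rule Limsup_bounded, rule always_eventually, intro allI bnd) simp
  finally show ?thesis .
qed

section \<open>Fourier multipliers\<close>

definition fourier_multiplier :: "(real^'n \<Rightarrow> complex) \<Rightarrow> (real^'n \<Rightarrow> complex) \<Rightarrow> real^'n \<Rightarrow> complex" where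
  "fourier_multiplier m w x = (\<integral>\<xi>. exp (\<i> * of_real (x \<bullet> \<xi>)) * m \<xi> * fourier w \<xi> \<partial>lborel)"

text \<open>Makes multipliers with bounded measurable symbols absolutely convergent. Schwartz
  functions belong to this class, and it is stable under division by a linear weight, which the
  induction over coordinates requires.\<close>

definition fourier_integrable :: "(real^'n \<Rightarrow> complex) \<Rightarrow> bool" where
  "fourier_integrable w \<longleftrightarrow> integrable lborel w \<and> integrable lborel (fourier w)"

lemma fourier_integrable_measurable:
  "fourier_integrable w \<Longrightarrow> w \<in> borel_measurable borel"
  unfolding fourier_integrable_def using borel_measurable_integrable by fastforce

lemma integrable_mult_bounded:
  fixes f m :: "'a \<Rightarrow> complex"
  assumes f: "integrable M f" and [measurable]: "m \<in> borel_measurable M" and B: "\<And>x. norm (m x) \<le> B"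
  shows "integrable M (\<lambda>x. m x * f x)"
proof (rule Bochner_Integration.integrable_bound[OF integrable_mult_left[OF f, of "of_real B"]])
  have "0 \<le> B" using B order_trans norm_ge_zero by blast
  then show "AE x in M. norm (m x * f x) \<le> norm (f x * of_real B)"
    using mult_right_mono[OF B norm_ge_zero] by (auto simp: norm_mult mult.commute[of "norm (f _)"])
qed (use f in measurable)

lemma fourier_multiplier_eq: "fourier_multiplier m w x = fourier (\<lambda>\<xi>. m \<xi> * fourier w \<xi>) (0 - x)"
  unfolding fourier_multiplier_def fourier_def[of "\<lambda>\<xi>. m \<xi> * fourier w \<xi>"]
  by (simp add: mult.assoc inner_commute)

lemma fourier_multiplier_measurable [measurable]:
  assumes [measurable]: "m \<in> borel_measurable borel" "w \<in> borel_measurable borel"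
  shows "fourier_multiplier m w \<in> borel_measurable borel"
  unfolding fourier_multiplier_eq[abs_def] by measurable

text \<open>Plancherel twice: the integral over \<xi> is again a Fourier transform, up to a
  reflection. Each use contributes a factor (2 pi)^n.\<close>

lemma fourier_multiplier_le:
  fixes m w :: "real^'n \<Rightarrow> complex"
  assumes w: "fourier_integrable w" and [measurable]: "m \<in> borel_measurable borel" and K: "\<And>\<xi>. norm (m \<xi>) \<le> K"
  shows "(\<integral>\<^sup>+x. ennreal ((norm (fourier_multiplier m w x))\<^sup>2) \<partial>lborel)
    \<le> ennreal (K\<^sup>2 * (2 * pi) ^ (2 * CARD('n))) * (\<integral>\<^sup>+x. ennreal ((norm (w x))\<^sup>2) \<partial>lborel)"
proof -
  have [measurable]: "w \<in> borel_measurable borel" by (rule fourier_integrable_measurable[OF w])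
  let ?c = "ennreal ((2 * pi) ^ CARD('n))"
  have "(\<integral>\<^sup>+x. ennreal ((norm (fourier_multiplier m w x))\<^sup>2) \<partial>lborel)
      = (\<integral>\<^sup>+x. ennreal ((norm (fourier (\<lambda>\<xi>. m \<xi> * fourier w \<xi>) x))\<^sup>2) \<partial>lborel)"
    unfolding fourier_multiplier_eq by (rule nn_integral_lborel_reflect) measurable
  also have "\<dots> \<le> ?c * (\<integral>\<^sup>+\<xi>. ennreal ((norm (m \<xi> * fourier w \<xi>))\<^sup>2) \<partial>lborel)"
    using w by (intro plancherel_le integrable_mult_bounded[OF _ _ K]) (auto simp: fourier_integrable_def)
  also have "\<dots> \<le> ?c * (\<integral>\<^sup>+\<xi>. ennreal (K\<^sup>2) * ennreal ((norm (fourier w \<xi>))\<^sup>2) \<partial>lborel)"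
    by (intro mult_left_mono nn_integral_mono)
       (auto simp: norm_mult power_mult_distrib ennreal_mult[symmetric] intro!: ennreal_leI mult_right_mono power_mono K)
  also have "\<dots> = ?c * (ennreal (K\<^sup>2) * (\<integral>\<^sup>+\<xi>. ennreal ((norm (fourier w \<xi>))\<^sup>2) \<partial>lborel))"
    by (simp add: nn_integral_cmult)
  also have "\<dots> \<le> ?c * (ennreal (K\<^sup>2) * (?c * (\<integral>\<^sup>+x. ennreal ((norm (w x))\<^sup>2) \<partial>lborel)))"
    using w by (intro mult_left_mono plancherel_le) (auto simp: fourier_integrable_def)
  also have "\<dots> = ennreal (K\<^sup>2 * (2 * pi) ^ (2 * CARD('n))) * (\<integral>\<^sup>+x. ennreal ((norm (w x))\<^sup>2) \<partial>lborel)"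
  proof -
    have "ennreal (K\<^sup>2 * (2 * pi) ^ (2 * CARD('n))) = ennreal (K\<^sup>2) * (?c * ?c)"
      unfolding mult_2 power_add by (subst ennreal_mult, simp, simp, subst ennreal_mult) simp_all
    then show ?thesis by (simp only: mult_ac)
  qed
  finally show ?thesis .
qed

section \<open>Division by a linear weight and its commutation with multipliers\<close>

definition linear_weight :: "'a::euclidean_space \<Rightarrow> 'a \<Rightarrow> 'a \<Rightarrow> complex" where
  "linear_weight b z y = 1 + \<i> * of_real (z \<bullet> b - y \<bullet> b)"

lemma norm_linear_weight: "(norm (linear_weight b z y))\<^sup>2 = 1 + (z \<bullet> b - y \<bullet> b)\<^sup>2"
  by (simp add: linear_weight_def cmod_power2)

lemma linear_weight_neq_0 [simp]: "linear_weight b z y \<noteq> 0"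
  by (auto simp: linear_weight_def complex_eq_iff)

lemma linear_weight_measurable [measurable]: "linear_weight b z \<in> borel_measurable borel"
  unfolding linear_weight_def[abs_def] by measurable

lemma norm_div_linear_weight:
  "(norm (c / linear_weight b z y))\<^sup>2 = (norm c)\<^sup>2 * poisson_kernel ((z - y) \<bullet> b)"
  by (simp add: norm_divide power_divide norm_linear_weight poisson_kernel_def inner_diff_left)

text \<open>By \<open>integral_expm_cis\<close> the function 1 / l is an average over r of
  characters. Division by l thus averages modulations of \<open>g\<close>, and the Fourier transform
  of the quotient is an average of translates of \<open>fourier g\<close> by r b with unimodular
  factors. Translation invariance bounds the double integral of these translates, so the quotient is
  again \<open>fourier_integrable\<close>.\<close>

lemma
  fixes g :: "real^'n \<Rightarrow> complex"
  assumes g: "fourier_integrable g"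
  shows fourier_div_linear_weight: "fourier (\<lambda>y. g y / linear_weight b z y) \<xi>
      = (\<integral>r. exp (- \<i> * of_real (r * (z \<bullet> b))) * fourier g (\<xi> - r *\<^sub>R b) \<partial>expm)"
    and integrable_translates_fourier: "integrable (expm \<Otimes>\<^sub>M lborel)
      (\<lambda>(r, \<xi>). exp (- \<i> * of_real (r * (z \<bullet> b))) * fourier g (\<xi> - r *\<^sub>R b))"
    and fourier_integrable_div_linear_weight: "fourier_integrable (\<lambda>y. g y / linear_weight b z y)"
proof -
  have [measurable]: "g \<in> borel_measurable borel" by (rule fourier_integrable_measurable[OF g])
  have ig: "integrable lborel g" and ifg: "integrable lborel (fourier g)"
    using g by (auto simp: fourier_integrable_def)
  have nw: "1 \<le> norm (linear_weight b z y)" for y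
  proof -
    have "1\<^sup>2 \<le> (norm (linear_weight b z y))\<^sup>2" by (simp add: norm_linear_weight)
    then show ?thesis by (rule power2_le_imp_le) simp
  qed
  show *: "fourier (\<lambda>y. g y / linear_weight b z y) \<xi>
      = (\<integral>r. exp (- \<i> * of_real (r * (z \<bullet> b))) * fourier g (\<xi> - r *\<^sub>R b) \<partial>expm)" for \<xi>
  proof -
    let ?F = "\<lambda>r y. exp (- \<i> * of_real (y \<bullet> \<xi>)) * (exp (- \<i> * of_real (r * (z \<bullet> b - y \<bullet> b))) * g y)"
    have "integrable (expm \<Otimes>\<^sub>M lborel) (case_prod ?F)"
      by (rule expm_lborel.integrable_bounded_by_product[where f = "\<lambda>_. 1::real", OF _ _ ig]) (auto simp: norm_mult)
    from expm_lborel.Fubini_integral[OF this]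
    have "(\<integral>y. (\<integral>r. ?F r y \<partial>expm) \<partial>lborel) = (\<integral>r. (\<integral>y. ?F r y \<partial>lborel) \<partial>expm)" .
    moreover have "(\<integral>r. ?F r y \<partial>expm) = exp (- \<i> * of_real (y \<bullet> \<xi>)) * (g y / linear_weight b z y)" for y
      using integral_expm_cis[of "z \<bullet> b - y \<bullet> b"] by (simp add: linear_weight_def)
    moreover have "(\<integral>y. ?F r y \<partial>lborel) = exp (- \<i> * of_real (r * (z \<bullet> b))) * fourier g (\<xi> - r *\<^sub>R b)" for r
    proof -
      have "exp (- \<i> * of_real (y \<bullet> \<xi>)) * exp (- \<i> * of_real (r * (z \<bullet> b - y \<bullet> b)))
          = exp (- \<i> * of_real (r * (z \<bullet> b))) * exp (- \<i> * of_real (y \<bullet> (\<xi> - r *\<^sub>R b)))" for y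
        by (unfold exp_add[symmetric], rule arg_cong[where f = exp])
           (simp add: inner_diff_right algebra_simps)
      then show ?thesis
        unfolding fourier_def
        by (subst integral_mult_right_zero[symmetric], intro Bochner_Integration.integral_cong refl)
           (metis mult.assoc)
    qed
    ultimately show ?thesis
      unfolding fourier_def[of "\<lambda>y. g y / linear_weight b z y"] by (simp only:)
  qed
  show **: "integrable (expm \<Otimes>\<^sub>M lborel)
      (\<lambda>(r, \<xi>). exp (- \<i> * of_real (r * (z \<bullet> b))) * fourier g (\<xi> - r *\<^sub>R b))"
  proof (rule integrableI_bounded)
    have "(\<integral>\<^sup>+p. ennreal (norm (case p of (r, \<xi>) \<Rightarrow> exp (- \<i> * of_real (r * (z \<bullet> b))) * fourier g (\<xi> - r *\<^sub>R b))) \<partial>(expm \<Otimes>\<^sub>M lborel))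
       = (\<integral>\<^sup>+r. \<integral>\<^sup>+\<xi>. ennreal (norm (fourier g (\<xi> + - (r *\<^sub>R b)))) \<partial>lborel \<partial>expm)"
      by (subst lborel.nn_integral_fst[symmetric]) (auto simp: norm_mult)
    also have "\<dots> = (\<integral>\<^sup>+r. \<integral>\<^sup>+\<xi>. ennreal (norm (fourier g \<xi>)) \<partial>lborel \<partial>expm)"
      by (subst nn_integral_lborel_shift) auto
    also have "\<dots> < \<infinity>"
      using ifg expm.emeasure_space_1 by (simp add: integrable_iff_bounded)
    finally show "(\<integral>\<^sup>+p. ennreal (norm (case p of (r, \<xi>) \<Rightarrow> exp (- \<i> * of_real (r * (z \<bullet> b))) * fourier g (\<xi> - r *\<^sub>R b))) \<partial>(expm \<Otimes>\<^sub>M lborel)) < \<infinity>" .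
  qed measurable
  have "integrable lborel (fourier (\<lambda>y. g y / linear_weight b z y))"
    unfolding *[abs_def] using expm_lborel.integrable_snd[OF **] .
  moreover have "integrable lborel (\<lambda>y. g y / linear_weight b z y)"
  proof (rule Bochner_Integration.integrable_bound[OF ig])
    show "AE y in lborel. norm (g y / linear_weight b z y) \<le> norm (g y)"
    proof (rule AE_I2)
      fix y show "norm (g y / linear_weight b z y) \<le> norm (g y)"
        using nw[of y] mult_left_mono[OF nw[of y], of "norm (g y)"]
        by (simp add: norm_divide divide_le_eq)
    qed
  qed measurable
  ultimately show "fourier_integrable (\<lambda>y. g y / linear_weight b z y)"
    by (simp add: fourier_integrable_def)
qed

text \<open>Formally an integration by parts in \<xi>, but no derivative of \<open>fourier g\<close>
  is taken. The transform of the quotient is written as an average of frequency translates, the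
  translation is moved onto the symbol, and the integrand becomes N - N' along b;
  \<open>integral_expm_diff_deriv\<close> then collapses the average to N 0, the integrand of the
  left-hand side.\<close>

lemma fourier_multiplier_div_linear_weight:
  fixes g m :: "real^'n \<Rightarrow> complex"
  assumes g: "fourier_integrable g" and m: "smooth m" and b: "b \<in> Basis"
    and K: "\<And>\<xi>. norm (m \<xi>) \<le> K" "\<And>\<xi>. norm (partial_deriv b m \<xi>) \<le> K"
  shows "fourier_multiplier m g x
    = linear_weight b z x * fourier_multiplier m (\<lambda>y. g y / linear_weight b z y) x
      - fourier_multiplier (partial_deriv b m) (\<lambda>y. g y / linear_weight b z y) x"
proof -
  define w where "w = (\<lambda>y. g y / linear_weight b z y)"
  \<comment> \<open>The integrand of the right-hand side without its common factor
    \<open>fourier w\<close>.\<close>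
  define P where "P \<xi> = exp (\<i> * of_real (x \<bullet> \<xi>)) * (linear_weight b z x * m \<xi> - partial_deriv b m \<xi>)" for \<xi>
  have [measurable]: "g \<in> borel_measurable borel" by (rule fourier_integrable_measurable[OF g])
  have cm: "continuous_on UNIV m" "continuous_on UNIV (partial_deriv b m)"
    using m b by (auto intro: smooth_continuous_on smooth_partial_deriv)
  then have [measurable]: "m \<in> borel_measurable borel" "partial_deriv b m \<in> borel_measurable borel"
    by (auto intro: borel_measurable_continuous_onI)
  have [measurable]: "P \<in> borel_measurable borel" unfolding P_def[abs_def] by measurable
  define B where "B = norm (linear_weight b z x) * K + K"
  have PB: "norm (P \<xi>) \<le> B" for \<xi>
    unfolding P_def B_def norm_mult
    by (auto intro!: order_trans[OF norm_triangle_ineq4] add_mono mult_left_mono K simp: norm_mult)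
  have iw: "integrable lborel (fourier w)" and ig: "integrable lborel (fourier g)"
    using fourier_integrable_div_linear_weight[OF g, of b z] g by (auto simp: fourier_integrable_def w_def)
  have int: "integrable lborel (\<lambda>\<xi>. exp (\<i> * of_real (x \<bullet> \<xi>)) * q \<xi> * fourier w \<xi>)"
    if "\<And>\<xi>. norm (q \<xi>) \<le> K" "q \<in> borel_measurable borel" for q
    using that by (intro integrable_mult_bounded[OF iw, where B = K]) (auto simp: norm_mult)
  have "linear_weight b z x * fourier_multiplier m w x - fourier_multiplier (partial_deriv b m) w x
     = (\<integral>\<xi>. linear_weight b z x * (exp (\<i> * of_real (x \<bullet> \<xi>)) * m \<xi> * fourier w \<xi>)
          - exp (\<i> * of_real (x \<bullet> \<xi>)) * partial_deriv b m \<xi> * fourier w \<xi> \<partial>lborel)"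
    unfolding fourier_multiplier_def
    by (subst Bochner_Integration.integral_diff) (auto intro!: int integrable_mult_right K)
  also have "\<dots> = (\<integral>\<xi>. P \<xi> * fourier w \<xi> \<partial>lborel)"
    by (intro Bochner_Integration.integral_cong refl) (simp add: P_def algebra_simps)
  also have "\<dots> = (\<integral>\<xi>. (\<integral>r. P \<xi> * (exp (- \<i> * of_real (r * (z \<bullet> b))) * fourier g (\<xi> - r *\<^sub>R b)) \<partial>expm) \<partial>lborel)"
    unfolding w_def fourier_div_linear_weight[OF g] by simp
  also have "\<dots> = (\<integral>r. (\<integral>\<xi>. P \<xi> * (exp (- \<i> * of_real (r * (z \<bullet> b))) * fourier g (\<xi> - r *\<^sub>R b)) \<partial>lborel) \<partial>expm)"
  proof (rule expm_lborel.Fubini_integral)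
    have "integrable (expm \<Otimes>\<^sub>M lborel)
      (\<lambda>p. P (snd p) * (\<lambda>(r, \<xi>). exp (- \<i> * of_real (r * (z \<bullet> b))) * fourier g (\<xi> - r *\<^sub>R b)) p)"
      by (rule integrable_mult_bounded[OF integrable_translates_fourier[OF g] _ PB]) measurable
    then show "integrable (expm \<Otimes>\<^sub>M lborel)
      (\<lambda>(r, \<xi>). P \<xi> * (exp (- \<i> * of_real (r * (z \<bullet> b))) * fourier g (\<xi> - r *\<^sub>R b)))"
      by (simp add: case_prod_unfold)
  qed
  \<comment> \<open>The substitution \<xi> = \<eta> + r b moves the translation from
    \<open>fourier g\<close>, which is merely integrable, to the smooth factor
    \<open>P\<close>.\<close>
  also have "\<dots> = (\<integral>r. (\<integral>\<eta>. P (\<eta> + r *\<^sub>R b) * (exp (- \<i> * of_real (r * (z \<bullet> b))) * fourier g \<eta>) \<partial>lborel) \<partial>expm)"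
  proof (rule Bochner_Integration.integral_cong[OF refl])
    fix r
    show "(\<integral>\<xi>. P \<xi> * (exp (- \<i> * of_real (r * (z \<bullet> b))) * fourier g (\<xi> - r *\<^sub>R b)) \<partial>lborel)
       = (\<integral>\<eta>. P (\<eta> + r *\<^sub>R b) * (exp (- \<i> * of_real (r * (z \<bullet> b))) * fourier g \<eta>) \<partial>lborel)"
      by (subst integral_lborel_shift[of _ "r *\<^sub>R b", symmetric]) auto
  qed
  also have "\<dots> = (\<integral>\<eta>. (\<integral>r. P (\<eta> + r *\<^sub>R b) * (exp (- \<i> * of_real (r * (z \<bullet> b))) * fourier g \<eta>) \<partial>expm) \<partial>lborel)"
  proof (rule expm_lborel.Fubini_integral[symmetric])
    show "integrable (expm \<Otimes>\<^sub>M lborel)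
      (\<lambda>(r, \<eta>). P (\<eta> + r *\<^sub>R b) * (exp (- \<i> * of_real (r * (z \<bullet> b))) * fourier g \<eta>))"
      by (rule expm_lborel.integrable_bounded_by_product[where f = "\<lambda>_. B", OF _ _ ig])
         (auto simp: norm_mult intro!: mult_right_mono order_trans[OF PB])
  qed
  also have "\<dots> = (\<integral>\<eta>. exp (\<i> * of_real (x \<bullet> \<eta>)) * m \<eta> * fourier g \<eta> \<partial>lborel)"
  proof (rule Bochner_Integration.integral_cong[OF refl])
    fix \<eta>
    \<comment> \<open>The phase collects exp (i x . (\<eta> + r b)) and exp (- i r z . b). Its
      derivative brings down i (x . b - z . b), which is 1 - l(x); hence the phase times l(x) m -
      d_b m is N - N'.\<close>
    define e where "e r = exp (\<i> * (of_real (x \<bullet> \<eta>) + of_real r * of_real (x \<bullet> b - z \<bullet> b)))" for r :: real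
    define N where "N r = e r * m (\<eta> + r *\<^sub>R b)" for r
    define N' where "N' r = e r * partial_deriv b m (\<eta> + r *\<^sub>R b)
        + \<i> * of_real (x \<bullet> b - z \<bullet> b) * e r * m (\<eta> + r *\<^sub>R b)" for r
    have ne: "norm (e r) = 1" for r
      unfolding e_def of_real_mult[symmetric] of_real_add[symmetric] by simp
    have eb: "exp (\<i> * of_real (x \<bullet> (\<eta> + r *\<^sub>R b))) * exp (- \<i> * of_real (r * (z \<bullet> b))) = e r" for r
      unfolding e_def
      by (unfold exp_add[symmetric], rule arg_cong[where f = exp]) (simp add: inner_add_right algebra_simps)
    have "P (\<eta> + r *\<^sub>R b) * (exp (- \<i> * of_real (r * (z \<bullet> b))) * fourier g \<eta>) = (N r - N' r) * fourier g \<eta>" for r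
    proof -
      have "P (\<eta> + r *\<^sub>R b) * (exp (- \<i> * of_real (r * (z \<bullet> b))) * fourier g \<eta>)
        = (exp (\<i> * of_real (x \<bullet> (\<eta> + r *\<^sub>R b))) * exp (- \<i> * of_real (r * (z \<bullet> b))))
          * (linear_weight b z x * m (\<eta> + r *\<^sub>R b) - partial_deriv b m (\<eta> + r *\<^sub>R b)) * fourier g \<eta>"
        unfolding P_def by (simp only: mult_ac)
      also have "\<dots> = (N r - N' r) * fourier g \<eta>"
        unfolding eb N_def N'_def linear_weight_def by (simp add: algebra_simps)
      finally show ?thesis .
    qed
    then have "(\<integral>r. P (\<eta> + r *\<^sub>R b) * (exp (- \<i> * of_real (r * (z \<bullet> b))) * fourier g \<eta>) \<partial>expm)
       = (\<integral>r. (N r - N' r) \<partial>expm) * fourier g \<eta>"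
      by (simp only: integral_mult_left_zero)
    also have "(\<integral>r. (N r - N' r) \<partial>expm) = N 0"
    proof (rule integral_expm_diff_deriv[where B = "K + \<bar>x \<bullet> b - z \<bullet> b\<bar> * K"])
      fix r :: real
      have K0: "0 \<le> K" using K(1) order_trans norm_ge_zero by blast
      have "((\<lambda>c. exp (\<i> * (of_real (x \<bullet> \<eta>) + c * of_real (x \<bullet> b - z \<bullet> b)))) has_field_derivative
          \<i> * of_real (x \<bullet> b - z \<bullet> b) * exp (\<i> * (of_real (x \<bullet> \<eta>) + of_real r * of_real (x \<bullet> b - z \<bullet> b)))) (at (of_real r))"
        by (auto intro!: derivative_eq_intros)
      from has_vector_derivative_real_field[OF this]
      have "(e has_vector_derivative \<i> * of_real (x \<bullet> b - z \<bullet> b) * e r) (at r)"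
        unfolding e_def[abs_def] .
      from has_vector_derivative_mult[OF this smooth_has_vector_derivative[OF m b, of \<eta> r]]
      show "(N has_vector_derivative N' r) (at r)"
        unfolding N_def[abs_def] N'_def by (simp add: algebra_simps)
      show "norm (N r) \<le> K + \<bar>x \<bullet> b - z \<bullet> b\<bar> * K"
        using K(1)[of "\<eta> + r *\<^sub>R b"] K0 by (simp add: N_def norm_mult ne add_increasing2)
      show "norm (N' r) \<le> K + \<bar>x \<bullet> b - z \<bullet> b\<bar> * K"
        unfolding N'_def
        by (rule order_trans[OF norm_triangle_ineq])
           (auto simp: norm_mult ne of_real_diff[symmetric] simp del: of_real_diff intro!: add_mono mult_left_mono K)
    next
      show "continuous_on UNIV N'"
        unfolding N'_def e_def
        by (intro continuous_intros continuous_on_compose2[OF cm(1)] continuous_on_compose2[OF cm(2)]) auto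
    qed
    also have "N 0 = exp (\<i> * of_real (x \<bullet> \<eta>)) * m \<eta>"
      by (simp add: N_def e_def)
    finally show "(\<integral>r. P (\<eta> + r *\<^sub>R b) * (exp (- \<i> * of_real (r * (z \<bullet> b))) * fourier g \<eta>) \<partial>expm)
        = exp (\<i> * of_real (x \<bullet> \<eta>)) * m \<eta> * fourier g \<eta>" .
  qed
  finally show ?thesis unfolding w_def fourier_multiplier_def[of m g] by simp
qed

text \<open>The order is counted by list length, so that a partial derivative lowers
  \<open>k\<close> by one and keeps the same \<open>K\<close>.\<close>

definition bdd_smooth :: "nat \<Rightarrow> real \<Rightarrow> ('a::euclidean_space \<Rightarrow> complex) \<Rightarrow> bool" where
  "bdd_smooth k K f \<longleftrightarrow> smooth f \<and>
    (\<forall>bs. set bs \<subseteq> Basis \<and> length bs \<le> k \<longrightarrow> (\<forall>x. norm (partial_derivs bs f x) \<le> K))"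

lemma bdd_smooth_smooth: "bdd_smooth k K f \<Longrightarrow> smooth f"
  by (simp add: bdd_smooth_def)

lemma bdd_smooth_mono: "bdd_smooth k K f \<Longrightarrow> j \<le> k \<Longrightarrow> bdd_smooth j K f"
  unfolding bdd_smooth_def by (meson order_trans)

lemma bdd_smooth_bound: "bdd_smooth k K f \<Longrightarrow> norm (f x) \<le> K"
  unfolding bdd_smooth_def by (metis empty_subsetI le0 list.set(1) list.size(3) partial_derivs_Nil)

lemma bdd_smooth_measurable: "bdd_smooth k K f \<Longrightarrow> f \<in> borel_measurable borel"
  by (intro borel_measurable_continuous_onI smooth_continuous_on) (rule bdd_smooth_smooth)

lemma bdd_smooth_partial_deriv:
  assumes "bdd_smooth (Suc k) K f" "b \<in> Basis"
  shows "bdd_smooth k K (partial_deriv b f)"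
proof -
  have "norm (partial_derivs bs (partial_deriv b f) x) \<le> K" if "set bs \<subseteq> Basis" "length bs \<le> k" for bs x
    using that assms unfolding bdd_smooth_def
    by (auto dest!: spec[of _ "bs @ [b]"] simp: partial_derivs_append)
  then show ?thesis
    using assms by (auto simp: bdd_smooth_def intro: smooth_partial_deriv)
qed

text \<open>Induction over the coordinates. One factor of the weight is the squared modulus of 1 /
  l: on the left it cancels the l in front of T_m w, where w = g / l, and on the right it is
  absorbed in w. The multipliers m and d_b m remain, both with one order of smoothness less. A
  squared difference is at most twice the sum of squares, and there are two such terms, so each
  coordinate costs a factor 4.\<close>

lemma weighted_fourier_multiplier_le:
  fixes g m :: "real^'n \<Rightarrow> complex"
  assumes "fourier_integrable g" "bdd_smooth (length bs) K m" "set bs \<subseteq> Basis"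
  shows "(\<integral>\<^sup>+x. ennreal ((norm (fourier_multiplier m g x))\<^sup>2 * (\<Prod>b\<leftarrow>bs. poisson_kernel ((z - x) \<bullet> b))) \<partial>lborel)
    \<le> ennreal (4 ^ length bs * (K\<^sup>2 * (2 * pi) ^ (2 * CARD('n)))) *
      (\<integral>\<^sup>+y. ennreal ((norm (g y))\<^sup>2 * (\<Prod>b\<leftarrow>bs. poisson_kernel ((z - y) \<bullet> b))) \<partial>lborel)"
  using assms
proof (induction bs arbitrary: g m)
  case Nil
  then show ?case
    using fourier_multiplier_le[OF Nil(1) bdd_smooth_measurable[OF Nil(2)] bdd_smooth_bound[OF Nil(2)]] by simp
next
  case (Cons b bs)
  define w where "w = (\<lambda>y. g y / linear_weight b z y)"
  have b: "b \<in> Basis" "set bs \<subseteq> Basis" using Cons.prems by auto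
  have m0: "bdd_smooth (length bs) K m"
    using Cons.prems(2) by (rule bdd_smooth_mono) simp
  have m1: "bdd_smooth (length bs) K (partial_deriv b m)"
    using Cons.prems(2) b by (intro bdd_smooth_partial_deriv) auto
  have w: "fourier_integrable w" unfolding w_def by (rule fourier_integrable_div_linear_weight[OF Cons.prems(1)])
  have [measurable]: "g \<in> borel_measurable borel" "w \<in> borel_measurable borel"
      "m \<in> borel_measurable borel" "partial_deriv b m \<in> borel_measurable borel"
    by (auto intro: fourier_integrable_measurable[OF Cons.prems(1)] fourier_integrable_measurable[OF w]
       bdd_smooth_measurable[OF m0] bdd_smooth_measurable[OF m1])
  let ?\<kappa> = "\<lambda>x. \<Prod>b\<leftarrow>bs. poisson_kernel ((z - x) \<bullet> b)"
  let ?c = "ennreal (4 ^ length bs * (K\<^sup>2 * (2 * pi) ^ (2 * CARD('n))))"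
  have k0: "0 \<le> ?\<kappa> x" for x by (intro prod_list_nonneg) auto
  have [measurable]: "?\<kappa> \<in> borel_measurable borel"
    by (induction bs) auto
  have pt: "(norm (fourier_multiplier m g x))\<^sup>2 * poisson_kernel ((z - x) \<bullet> b)
     \<le> 2 * (norm (fourier_multiplier m w x))\<^sup>2 + 2 * (norm (fourier_multiplier (partial_deriv b m) w x))\<^sup>2" for x
  proof -
    let ?A = "fourier_multiplier m w x" and ?B = "fourier_multiplier (partial_deriv b m) w x"
    let ?L = "linear_weight b z x"
    have eq: "fourier_multiplier m g x = ?L * ?A - ?B"
      unfolding w_def
      by (rule fourier_multiplier_div_linear_weight[OF Cons.prems(1) bdd_smooth_smooth[OF m0] b(1)
          bdd_smooth_bound[OF m0] bdd_smooth_bound[OF m1]])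
    have "(norm (fourier_multiplier m g x))\<^sup>2 * poisson_kernel ((z - x) \<bullet> b)
        = (norm (fourier_multiplier m g x / ?L))\<^sup>2"
      by (simp add: norm_div_linear_weight)
    also have "fourier_multiplier m g x / ?L = ?A - ?B / ?L"
      by (simp add: eq diff_divide_distrib)
    also have "(norm (?A - ?B / ?L))\<^sup>2 \<le> (norm ?A + norm (?B / ?L))\<^sup>2"
      by (intro power_mono norm_triangle_ineq4) auto
    also have "\<dots> \<le> 2 * (norm ?A)\<^sup>2 + 2 * (norm (?B / ?L))\<^sup>2"
      using zero_le_power2[of "norm ?A - norm (?B / ?L)"] by (simp add: power2_eq_square algebra_simps)
    \<comment> \<open>The kernel is at most 1, so division by l may be dropped in the second term,
      where no factor l has to be cancelled.\<close>
    also have "(norm (?B / ?L))\<^sup>2 \<le> (norm ?B)\<^sup>2"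
      unfolding norm_div_linear_weight
      by (rule mult_left_le) (auto simp: poisson_kernel_def divide_le_eq add_pos_nonneg)
    finally show ?thesis by simp
  qed
  have "(\<integral>\<^sup>+x. ennreal ((norm (fourier_multiplier m g x))\<^sup>2 * (\<Prod>b\<leftarrow>b # bs. poisson_kernel ((z - x) \<bullet> b))) \<partial>lborel)
     \<le> (\<integral>\<^sup>+x. 2 * ennreal ((norm (fourier_multiplier m w x))\<^sup>2 * ?\<kappa> x)
          + 2 * ennreal ((norm (fourier_multiplier (partial_deriv b m) w x))\<^sup>2 * ?\<kappa> x) \<partial>lborel)"
  proof (rule nn_integral_mono)
    fix x
    have "(norm (fourier_multiplier m g x))\<^sup>2 * (\<Prod>b\<leftarrow>b # bs. poisson_kernel ((z - x) \<bullet> b))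
      \<le> (2 * (norm (fourier_multiplier m w x))\<^sup>2 + 2 * (norm (fourier_multiplier (partial_deriv b m) w x))\<^sup>2) * ?\<kappa> x"
      using mult_right_mono[OF pt[of x] k0[of x]] by (simp add: mult.assoc)
    then have "ennreal ((norm (fourier_multiplier m g x))\<^sup>2 * (\<Prod>b\<leftarrow>b # bs. poisson_kernel ((z - x) \<bullet> b)))
      \<le> ennreal (2 * ((norm (fourier_multiplier m w x))\<^sup>2 * ?\<kappa> x) + 2 * ((norm (fourier_multiplier (partial_deriv b m) w x))\<^sup>2 * ?\<kappa> x))"
      by (intro ennreal_leI) (simp add: algebra_simps)
    also have "\<dots> = 2 * ennreal ((norm (fourier_multiplier m w x))\<^sup>2 * ?\<kappa> x)
          + 2 * ennreal ((norm (fourier_multiplier (partial_deriv b m) w x))\<^sup>2 * ?\<kappa> x)"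
      using k0[of x] by (simp add: ennreal_plus ennreal_mult)
    finally show "ennreal ((norm (fourier_multiplier m g x))\<^sup>2 * (\<Prod>b\<leftarrow>b # bs. poisson_kernel ((z - x) \<bullet> b)))
      \<le> 2 * ennreal ((norm (fourier_multiplier m w x))\<^sup>2 * ?\<kappa> x)
          + 2 * ennreal ((norm (fourier_multiplier (partial_deriv b m) w x))\<^sup>2 * ?\<kappa> x)" .
  qed
  also have "\<dots> = 2 * (\<integral>\<^sup>+x. ennreal ((norm (fourier_multiplier m w x))\<^sup>2 * ?\<kappa> x) \<partial>lborel)
          + 2 * (\<integral>\<^sup>+x. ennreal ((norm (fourier_multiplier (partial_deriv b m) w x))\<^sup>2 * ?\<kappa> x) \<partial>lborel)"
    by (simp add: nn_integral_add nn_integral_cmult)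
  also have "\<dots> \<le> 2 * (?c * (\<integral>\<^sup>+y. ennreal ((norm (w y))\<^sup>2 * ?\<kappa> y) \<partial>lborel))
      + 2 * (?c * (\<integral>\<^sup>+y. ennreal ((norm (w y))\<^sup>2 * ?\<kappa> y) \<partial>lborel))"
    by (intro add_mono mult_left_mono Cons.IH w m0 m1 b) auto
  also have "\<dots> = 4 * ?c * (\<integral>\<^sup>+y. ennreal ((norm (w y))\<^sup>2 * ?\<kappa> y) \<partial>lborel)"
    by (simp add: mult.assoc[symmetric] distrib_right[symmetric])
  also have "4 * ?c = ennreal (4 ^ length (b # bs) * (K\<^sup>2 * (2 * pi) ^ (2 * CARD('n))))"
    by (simp add: ennreal_mult mult_ac)
  also have "(\<lambda>y. (norm (w y))\<^sup>2 * ?\<kappa> y) = (\<lambda>y. (norm (g y))\<^sup>2 * (\<Prod>b\<leftarrow>b # bs. poisson_kernel ((z - y) \<bullet> b)))"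
    by (simp add: w_def norm_div_linear_weight mult.assoc)
  finally show ?case .
qed

section \<open>The \<open>L\<^sup>2\<close> bound for pseudo-differential operators\<close>

text \<open>The operator 1 - d_b, inverted on bounded smooth functions with bounded derivative by
  exponential averaging along b (\<open>integral_expm_diff_deriv\<close>). It at most doubles a
  common bound for the derivatives.\<close>

definition id_minus_deriv :: "'a::euclidean_space \<Rightarrow> ('a \<Rightarrow> complex) \<Rightarrow> 'a \<Rightarrow> complex" where
  "id_minus_deriv b f x = f x - partial_deriv b f x"

lemma bdd_smooth_id_minus_deriv:
  assumes f: "bdd_smooth (Suc k) K f" and b: "b \<in> Basis"
  shows "bdd_smooth k (2 * K) (id_minus_deriv b f)"
proof -
  have f': "bdd_smooth k K (partial_deriv b f)" by (rule bdd_smooth_partial_deriv[OF f b])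
  note sm = bdd_smooth_smooth[OF f] bdd_smooth_smooth[OF f']
  have "norm (partial_derivs bs (id_minus_deriv b f) x) \<le> 2 * K" if bs: "set bs \<subseteq> Basis" "length bs \<le> k" for bs x
  proof -
    have "norm (partial_derivs bs f x) \<le> K" "norm (partial_derivs bs (partial_deriv b f) x) \<le> K"
      using f f' bs unfolding bdd_smooth_def by auto
    moreover have "partial_derivs bs (id_minus_deriv b f) x = partial_derivs bs f x - partial_derivs bs (partial_deriv b f) x"
      unfolding id_minus_deriv_def[abs_def] by (simp add: partial_derivs_diff[OF sm bs(1)])
    ultimately show ?thesis
      using norm_triangle_ineq4[of "partial_derivs bs f x" "partial_derivs bs (partial_deriv b f) x"] by simp
  qed
  then show ?thesis
    using smooth_diff[OF sm] by (simp add: bdd_smooth_def id_minus_deriv_def[abs_def])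
qed

lemma bdd_smooth_foldr_id_minus_deriv:
  assumes "bdd_smooth (length bs + k) K f" "set bs \<subseteq> Basis"
  shows "bdd_smooth k (2 ^ length bs * K) (foldr id_minus_deriv bs f)"
  using assms
proof (induction bs arbitrary: k)
  case (Cons b bs)
  then have "bdd_smooth (Suc k) (2 ^ length bs * K) (foldr id_minus_deriv bs f)"
    by simp
  from bdd_smooth_id_minus_deriv[OF this, of b] Cons.prems show ?case by (simp add: mult.assoc)
qed simp

lemma bdd_smooth_slice:
  assumes "bdd_smooth k K (\<rho> :: 'a::euclidean_space \<times> 'b::euclidean_space \<Rightarrow> complex)"
  shows "bdd_smooth k K (\<lambda>\<xi>. \<rho> (z, \<xi>))"
proof -
  have eq: "partial_derivs bs (\<lambda>\<xi>. \<rho> (z, \<xi>)) = (\<lambda>\<xi>. partial_derivs (map (Pair 0) bs) \<rho> (z, \<xi>))" for bs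
    by (rule ext) (simp add: partial_derivs_Pair_right)
  have sub: "set (map (Pair 0) bs) \<subseteq> (Basis :: ('a \<times> 'b) set)" if "set bs \<subseteq> Basis" for bs
    using that by (auto simp: Basis_prod_def)
  have \<rho>: "smooth \<rho>" using assms by (rule bdd_smooth_smooth)
  have "smooth (\<lambda>\<xi>. \<rho> (z, \<xi>))"
    unfolding smooth_def eq
  proof (intro allI impI conjI ballI)
    fix bs :: "'b list" assume bs: "set bs \<subseteq> Basis"
    show "continuous_on UNIV (\<lambda>\<xi>. partial_derivs (map (Pair 0) bs) \<rho> (z, \<xi>))"
      by (rule continuous_on_compose2[OF smooth_continuous_on[OF smooth_partial_derivs[OF \<rho> sub[OF bs]]]])
         (auto intro!: continuous_intros)
    fix b :: 'b and \<xi> assume b: "b \<in> Basis"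
    have "((\<lambda>s. partial_derivs (map (Pair 0) bs) \<rho> ((z, \<xi>) + s *\<^sub>R (0, b))) has_vector_derivative
        partial_deriv (0, b) (partial_derivs (map (Pair 0) bs) \<rho>) ((z, \<xi>) + 0 *\<^sub>R (0, b))) (at 0)"
      by (rule smooth_has_vector_derivative[OF smooth_partial_derivs[OF \<rho> sub[OF bs]]]) (use b in \<open>auto simp: Basis_prod_def\<close>)
    then show "(\<lambda>s. partial_derivs (map (Pair 0) bs) \<rho> (z, \<xi> + s *\<^sub>R b)) differentiable at 0"
      by (auto intro: differentiableI_vector)
  qed
  moreover have "norm (partial_derivs bs (\<lambda>\<xi>. \<rho> (z, \<xi>)) x) \<le> K" if "set bs \<subseteq> Basis" "length bs \<le> k" for bs x
    unfolding eq using assms that sub[OF that(1)] unfolding bdd_smooth_def by (auto dest!: spec[of _ "map (Pair 0) bs"])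
  ultimately show ?thesis by (auto simp: bdd_smooth_def)
qed

text \<open>A one-dimensional Sobolev inequality in z with x held fixed: \<sigma>(z, .) is the
  exponential average of (1 - d_b) \<sigma>(z + r b, .), Fubini's theorem passes the average through
  the multiplier, and Jensen's inequality squares it. Keeping x and z separate lets the coordinates
  of z be treated one after another.\<close>

lemma sobolev_step:
  fixes \<sigma> :: "(real^'n) \<times> (real^'n) \<Rightarrow> complex"
  assumes u: "fourier_integrable u" and \<sigma>: "bdd_smooth 1 K \<sigma>" and b: "b \<in> Basis"
  shows "ennreal ((norm (fourier_multiplier (\<lambda>\<xi>. \<sigma> (z, \<xi>)) u x))\<^sup>2)
    \<le> (\<integral>\<^sup>+r. ennreal (2 * poisson_kernel r) *
          ennreal ((norm (fourier_multiplier (\<lambda>\<xi>. id_minus_deriv (b, 0) \<sigma> (z + r *\<^sub>R b, \<xi>)) u x))\<^sup>2) \<partial>lborel)"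
proof -
  have b': "(b, 0) \<in> Basis" using b by (auto simp: Basis_prod_def)
  let ?D = "id_minus_deriv (b, 0) \<sigma>"
  have D: "bdd_smooth 0 (2 * K) ?D" using bdd_smooth_id_minus_deriv[of 0 K \<sigma>, OF _ b'] \<sigma> by simp
  have iu: "integrable lborel (fourier u)" using u by (simp add: fourier_integrable_def)
  have [measurable]: "u \<in> borel_measurable borel" by (rule fourier_integrable_measurable[OF u])
  have [measurable]: "?D \<in> borel_measurable (borel \<Otimes>\<^sub>M borel)"
    using bdd_smooth_measurable[OF D] by (simp add: borel_prod)
  let ?F = "\<lambda>r \<xi>. exp (\<i> * of_real (x \<bullet> \<xi>)) * ?D (z + r *\<^sub>R b, \<xi>) * fourier u \<xi>"
  have int: "integrable (expm \<Otimes>\<^sub>M lborel) (case_prod ?F)"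
    by (rule expm_lborel.integrable_bounded_by_product[where f = "\<lambda>_. 2 * K", OF _ _ iu])
       (auto simp: norm_mult intro!: mult_right_mono order_trans[OF bdd_smooth_bound[OF D]])
  have rep: "\<sigma> (z, \<xi>) = (\<integral>r. ?D (z + r *\<^sub>R b, \<xi>) \<partial>expm)" for \<xi>
  proof -
    have "(\<integral>r. (\<sigma> ((z, \<xi>) + r *\<^sub>R (b, 0)) - partial_deriv (b, 0) \<sigma> ((z, \<xi>) + r *\<^sub>R (b, 0))) \<partial>expm) = \<sigma> ((z, \<xi>) + 0 *\<^sub>R (b, 0))"
    proof (rule integral_expm_diff_deriv)
      show "((\<lambda>r. \<sigma> ((z, \<xi>) + r *\<^sub>R (b, 0))) has_vector_derivative partial_deriv (b, 0) \<sigma> ((z, \<xi>) + r *\<^sub>R (b, 0))) (at r)" for r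
        by (rule smooth_has_vector_derivative[OF bdd_smooth_smooth[OF \<sigma>] b'])
      show "continuous_on UNIV (\<lambda>r. partial_deriv (b, 0) \<sigma> ((z, \<xi>) + r *\<^sub>R (b, 0)))"
        by (rule continuous_on_compose2[OF smooth_continuous_on[OF smooth_partial_deriv[OF bdd_smooth_smooth[OF \<sigma>] b']]])
           (auto intro!: continuous_intros)
      show "norm (\<sigma> ((z, \<xi>) + r *\<^sub>R (b, 0))) \<le> K" for r by (rule bdd_smooth_bound[OF \<sigma>])
      show "norm (partial_deriv (b, 0) \<sigma> ((z, \<xi>) + r *\<^sub>R (b, 0))) \<le> K" for r
        using bdd_smooth_bound[OF bdd_smooth_partial_deriv[of 0 K \<sigma>, OF _ b']] \<sigma> by simp
    qed
    then show ?thesis by (simp add: id_minus_deriv_def)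
  qed
  have "fourier_multiplier (\<lambda>\<xi>. \<sigma> (z, \<xi>)) u x = (\<integral>\<xi>. (\<integral>r. ?F r \<xi> \<partial>expm) \<partial>lborel)"
    unfolding fourier_multiplier_def rep by (simp add: mult.assoc mult.left_commute[of "exp _"])
  also have "\<dots> = (\<integral>r. (\<integral>\<xi>. ?F r \<xi> \<partial>lborel) \<partial>expm)"
    by (rule expm_lborel.Fubini_integral[OF int])
  finally have eq: "fourier_multiplier (\<lambda>\<xi>. \<sigma> (z, \<xi>)) u x
      = (\<integral>r. fourier_multiplier (\<lambda>\<xi>. ?D (z + r *\<^sub>R b, \<xi>)) u x \<partial>expm)"
    unfolding fourier_multiplier_def .
  have i: "integrable expm (\<lambda>r. fourier_multiplier (\<lambda>\<xi>. ?D (z + r *\<^sub>R b, \<xi>)) u x)"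
    unfolding fourier_multiplier_def using expm_lborel.integrable_fst'[OF int] by simp
  have [measurable]: "(\<lambda>r. fourier_multiplier (\<lambda>\<xi>. ?D (z + r *\<^sub>R b, \<xi>)) u x) \<in> borel_measurable borel"
    using borel_measurable_integrable[OF i] by simp
  show ?thesis
    unfolding eq
    by (rule order_trans[OF norm_integral_expm_square_le[OF i]], rule nn_integral_expm_le) measurable
qed

text \<open>\<open>h bs\<close> is the function obtained from \<open>h []\<close> after treating the coordinates in \<open>bs\<close>.\<close>

lemma iterate_coordinates:
  fixes h :: "'a::euclidean_space list \<Rightarrow> 'a \<Rightarrow> ennreal"
  assumes meas: "\<And>bs. set bs \<subseteq> Basis \<Longrightarrow> distinct bs \<Longrightarrow> h bs \<in> borel_measurable borel"
    and k [measurable]: "k \<in> borel_measurable borel"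
    and step: "\<And>bs b z. set (b # bs) \<subseteq> Basis \<Longrightarrow> distinct (b # bs) \<Longrightarrow>
      h bs z \<le> (\<integral>\<^sup>+r. k r * h (b # bs) (z + r *\<^sub>R b) \<partial>lborel)"
    and bs: "set bs \<subseteq> Basis" "distinct bs"
  shows "h [] z \<le> (\<integral>\<^sup>+y. (\<Prod>b\<in>set bs. k (y b)) * h bs (z + (\<Sum>b\<in>set bs. y b *\<^sub>R b)) \<partial>(\<Pi>\<^sub>M b\<in>set bs. lborel))"
  using bs
proof (induction bs)
  case Nil
  then show ?case by (simp add: PiM_empty)
next
  case (Cons b bs)
  have [measurable]: "h bs \<in> borel_measurable borel" "h (b # bs) \<in> borel_measurable borel"
    using Cons.prems meas by auto
  let ?S = "set bs"
  have "h [] z \<le> (\<integral>\<^sup>+y. (\<Prod>b\<in>?S. k (y b)) * h bs (z + (\<Sum>b\<in>?S. y b *\<^sub>R b)) \<partial>(\<Pi>\<^sub>M b\<in>?S. lborel))"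
    using Cons by auto
  also have "\<dots> \<le> (\<integral>\<^sup>+y. (\<Prod>b\<in>?S. k (y b)) *
      (\<integral>\<^sup>+r. k r * h (b # bs) (z + (\<Sum>b\<in>?S. y b *\<^sub>R b) + r *\<^sub>R b) \<partial>lborel) \<partial>(\<Pi>\<^sub>M b\<in>?S. lborel))"
    by (intro nn_integral_mono mult_left_mono step Cons.prems) auto
  also have "\<dots> = (\<integral>\<^sup>+y. (\<integral>\<^sup>+r. (\<Prod>b\<in>?S. k (y b)) * (k r * h (b # bs) (z + (\<Sum>b\<in>?S. y b *\<^sub>R b) + r *\<^sub>R b)) \<partial>lborel) \<partial>(\<Pi>\<^sub>M b\<in>?S. lborel))"
    by (intro nn_integral_cong nn_integral_cmult[symmetric]) measurable
  \<comment> \<open>The new variable r becomes the coordinate with index b of a larger product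
    measure; since b is not in \<open>bs\<close>, the update leaves the old factors alone.\<close>
  also have "\<dots> = (\<integral>\<^sup>+y. (\<integral>\<^sup>+r. (\<Prod>c\<in>insert b ?S. k ((y(b := r)) c)) *
      h (b # bs) (z + (\<Sum>c\<in>insert b ?S. (y(b := r)) c *\<^sub>R c)) \<partial>lborel) \<partial>(\<Pi>\<^sub>M b\<in>?S. lborel))"
  proof (intro nn_integral_cong)
    fix y r
    have nb: "b \<notin> ?S" using Cons.prems by simp
    have "(\<Prod>c\<in>?S. k ((y(b := r)) c)) = (\<Prod>c\<in>?S. k (y c))"
      using nb by (intro prod.cong) auto
    moreover have "(\<Sum>c\<in>?S. (y(b := r)) c *\<^sub>R c) = (\<Sum>c\<in>?S. y c *\<^sub>R c)"
      using nb by (intro sum.cong) auto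
    ultimately show "(\<Prod>b\<in>?S. k (y b)) * (k r * h (b # bs) (z + (\<Sum>b\<in>?S. y b *\<^sub>R b) + r *\<^sub>R b))
      = (\<Prod>c\<in>insert b ?S. k ((y(b := r)) c)) * h (b # bs) (z + (\<Sum>c\<in>insert b ?S. (y(b := r)) c *\<^sub>R c))"
      using nb by (simp add: mult_ac add_ac)
  qed
  also have "\<dots> = (\<integral>\<^sup>+y. (\<Prod>c\<in>insert b ?S. k (y c)) *
      h (b # bs) (z + (\<Sum>c\<in>insert b ?S. y c *\<^sub>R c)) \<partial>(\<Pi>\<^sub>M b\<in>insert b ?S. lborel))"
  proof (rule lborel_PiM.product_nn_integral_insert[symmetric])
    have c: "(\<lambda>y. y c) \<in> borel_measurable (\<Pi>\<^sub>M b\<in>insert b ?S. (lborel :: real measure))" if "c \<in> insert b ?S" for c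
      using measurable_component_singleton[OF that, of "\<lambda>_. lborel :: real measure"] by simp
    have "(\<lambda>y. z + (\<Sum>c\<in>insert b ?S. y c *\<^sub>R c)) \<in> borel_measurable (\<Pi>\<^sub>M b\<in>insert b ?S. lborel)"
      by (intro borel_measurable_add borel_measurable_const borel_measurable_sum borel_measurable_scaleR c)
    then show "(\<lambda>y. (\<Prod>c\<in>insert b ?S. k (y c)) * h (b # bs) (z + (\<Sum>c\<in>insert b ?S. y c *\<^sub>R c)))
        \<in> borel_measurable (\<Pi>\<^sub>M b\<in>insert b ?S. lborel)"
      by (intro borel_measurable_times_ennreal borel_measurable_prod_ennreal)
         (auto intro: measurable_compose[OF c k] measurable_compose)
  qed (use Cons.prems in auto)
  finally show ?case by simp
qed

lemma nn_integral_lborel_PiM: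
  fixes f :: "'a::euclidean_space \<Rightarrow> ennreal"
  assumes [measurable]: "f \<in> borel_measurable borel" "k \<in> borel_measurable borel"
  shows "(\<integral>\<^sup>+y. (\<Prod>b\<in>Basis. k (y b)) * f (z + (\<Sum>b\<in>Basis. y b *\<^sub>R b)) \<partial>(\<Pi>\<^sub>M b\<in>(Basis :: 'a set). lborel))
     = (\<integral>\<^sup>+s. (\<Prod>b\<in>Basis. k (s \<bullet> b)) * f (z + s) \<partial>lborel)"
proof -
  have "(\<integral>\<^sup>+s. (\<Prod>b\<in>Basis. k (s \<bullet> b)) * f (z + s) \<partial>lborel)
    = (\<integral>\<^sup>+y. (\<Prod>c\<in>Basis. k ((\<Sum>b\<in>Basis. y b *\<^sub>R b) \<bullet> c)) * f (z + (\<Sum>b\<in>Basis. y b *\<^sub>R b)) \<partial>(\<Pi>\<^sub>M b\<in>(Basis :: 'a set). lborel))"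
    by (subst lborel_eq, subst nn_integral_distr) (auto intro!: borel_measurable_times_ennreal borel_measurable_prod_ennreal)
  then show ?thesis by (auto intro!: nn_integral_cong)
qed

definition poisson_prod :: "'a::euclidean_space \<Rightarrow> real" where
  "poisson_prod s = (\<Prod>b\<in>Basis. poisson_kernel (s \<bullet> b))"

lemma poisson_prod_measurable [measurable]: "poisson_prod \<in> borel_measurable borel"
  unfolding poisson_prod_def[abs_def] by (intro borel_measurable_prod) measurable

lemma poisson_prod_nonneg [simp]: "0 \<le> poisson_prod s"
  unfolding poisson_prod_def by (intro prod_nonneg) auto

lemma nn_integral_poisson_prod:
  "(\<integral>\<^sup>+s. ennreal (poisson_prod (s :: 'a::euclidean_space)) \<partial>lborel) = ennreal (pi ^ DIM('a))"
proof -
  have "(\<integral>\<^sup>+s. ennreal (poisson_prod (s :: 'a)) \<partial>lborel) = (\<integral>\<^sup>+s. (\<Prod>b\<in>Basis. ennreal (poisson_kernel (s \<bullet> b))) \<partial>(lborel :: 'a measure))"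
    unfolding poisson_prod_def by (subst prod_ennreal) auto
  also have "\<dots> = (\<Prod>b\<in>(Basis :: 'a set). \<integral>\<^sup>+t. ennreal (poisson_kernel t) \<partial>lborel)"
    by (rule nn_integral_lborel_prod) auto
  finally show ?thesis by (simp add: nn_integral_poisson_kernel ennreal_power)
qed

lemma basis_enumeration:
  obtains bs :: "'a::euclidean_space list" where "set bs = Basis" "distinct bs" "length bs = DIM('a)"
  using finite_distinct_list[OF finite_Basis] distinct_card by metis

text \<open>In the constant, 2^n comes from comparing the exponential density with the kernel in n
  coordinates, 4^n from moving the weight through the multiplier, 2^n K bounds the symbol after n
  operators 1 - d_b, (2 pi)^(2 n) is due to Plancherel, and pi^n is the integral of
  \<open>poisson_prod\<close>.\<close>

theorem fourier_multiplier_diagonal_le: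
  fixes \<sigma> :: "(real^'n) \<times> (real^'n) \<Rightarrow> complex"
  assumes u: "fourier_integrable u" and \<sigma>: "bdd_smooth (2 * CARD('n)) K \<sigma>"
  shows "(\<integral>\<^sup>+x. ennreal ((norm (fourier_multiplier (\<lambda>\<xi>. \<sigma> (x, \<xi>)) u x))\<^sup>2) \<partial>lborel)
    \<le> ennreal (2 ^ CARD('n) * 4 ^ CARD('n) * ((2 ^ CARD('n) * K)\<^sup>2 * (2 * pi) ^ (2 * CARD('n))) * pi ^ CARD('n)) *
      (\<integral>\<^sup>+x. ennreal ((norm (u x))\<^sup>2) \<partial>lborel)"
proof -
  obtain bs :: "(real^'n) list" where bs: "set bs = Basis" "distinct bs" "length bs = CARD('n)"
    using basis_enumeration[where 'a = "real^'n"] by auto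
  define D where "D cs = foldr id_minus_deriv (map (\<lambda>b. (b, 0)) cs) \<sigma>" for cs :: "(real^'n) list"
  define h where "h x cs z = ennreal ((norm (fourier_multiplier (\<lambda>\<xi>. D cs (z, \<xi>)) u x))\<^sup>2)" for x cs z
  let ?n = "CARD('n)"
  have [measurable]: "u \<in> borel_measurable borel" by (rule fourier_integrable_measurable[OF u])
  have D: "bdd_smooth (2 * ?n - length cs) (2 ^ length cs * K) (D cs)" and len: "length cs \<le> ?n"
    if "set cs \<subseteq> Basis" "distinct cs" for cs
  proof -
    have "card (set cs) \<le> card (Basis :: (real^'n) set)" by (rule card_mono) (use that in auto)
    then show l: "length cs \<le> ?n" using that by (simp add: distinct_card)
    show "bdd_smooth (2 * ?n - length cs) (2 ^ length cs * K) (D cs)"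
      unfolding D_def
      using bdd_smooth_foldr_id_minus_deriv[of "map (\<lambda>b. (b, 0)) cs" "2 * ?n - length cs" K \<sigma>] \<sigma> l that
      by (auto simp: Basis_prod_def image_subset_iff)
  qed
  have Dm: "D cs \<in> borel_measurable (borel \<Otimes>\<^sub>M borel)" if "set cs \<subseteq> Basis" "distinct cs" for cs
    using bdd_smooth_measurable[OF D[OF that]] by (simp add: borel_prod)
  define \<rho> where "\<rho> = D bs"
  \<comment> \<open>Half of the 2 n orders of smoothness has been spent on the x-directions; the
    remaining n are what the weighted estimate in \<xi> consumes.\<close>
  have \<rho>: "bdd_smooth ?n (2 ^ ?n * K) \<rho>"
    using D[of bs] bs by (simp add: \<rho>_def)
  have [measurable]: "\<rho> \<in> borel_measurable (borel \<Otimes>\<^sub>M borel)"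
    unfolding \<rho>_def using bs by (intro Dm) auto
  define f where "f z x = ennreal ((norm (fourier_multiplier (\<lambda>\<xi>. \<rho> (z, \<xi>)) u x))\<^sup>2)" for z x
  have [measurable]: "(\<lambda>(z, x). f z x) \<in> borel_measurable (borel \<Otimes>\<^sub>M borel)"
    unfolding f_def fourier_multiplier_def by measurable
  \<comment> \<open>The iteration starts on the diagonal z = x. Once all coordinates are treated, z
    = x + s ranges over the whole space, with the weight centred at x.\<close>
  have sob: "ennreal ((norm (fourier_multiplier (\<lambda>\<xi>. \<sigma> (x, \<xi>)) u x))\<^sup>2)
     \<le> (\<integral>\<^sup>+z. ennreal (2 ^ ?n * poisson_prod (z - x)) * f z x \<partial>lborel)" for x
  proof -
    have "h x [] x \<le> (\<integral>\<^sup>+y. (\<Prod>b\<in>set bs. ennreal (2 * poisson_kernel (y b))) * h x bs (x + (\<Sum>b\<in>set bs. y b *\<^sub>R b)) \<partial>(\<Pi>\<^sub>M b\<in>set bs. lborel))"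
    proof (rule iterate_coordinates)
      fix cs :: "(real^'n) list" assume "set cs \<subseteq> Basis" "distinct cs"
      note [measurable] = Dm[OF this]
      show "h x cs \<in> borel_measurable borel"
        unfolding h_def fourier_multiplier_def by measurable
    next
      fix cs :: "(real^'n) list" and b z assume *: "set (b # cs) \<subseteq> Basis" "distinct (b # cs)"
      have l: "length (b # cs) \<le> ?n" by (rule len[OF *])
      have "bdd_smooth 1 (2 ^ length cs * K) (D cs)"
        by (rule bdd_smooth_mono[OF D]) (use * l in auto)
      from sobolev_step[OF u this, of b z x] *
      show "h x cs z \<le> (\<integral>\<^sup>+r. ennreal (2 * poisson_kernel r) * h x (b # cs) (z + r *\<^sub>R b) \<partial>lborel)"
        by (simp add: h_def D_def)
    qed (use bs in auto)
    also have "\<dots> = (\<integral>\<^sup>+s. (\<Prod>b\<in>Basis. ennreal (2 * poisson_kernel (s \<bullet> b))) * f (x + s) x \<partial>lborel)"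
      unfolding bs h_def \<rho>_def[symmetric] f_def[symmetric]
      by (rule nn_integral_lborel_PiM) measurable
    also have "\<dots> = (\<integral>\<^sup>+s. ennreal (2 ^ ?n * poisson_prod ((s + x) - x)) * f (s + x) x \<partial>lborel)"
      by (intro nn_integral_cong arg_cong2[of _ _ _ _ times])
         (auto simp: poisson_prod_def prod_ennreal prod.distrib add.commute)
    also have "\<dots> = (\<integral>\<^sup>+z. ennreal (2 ^ ?n * poisson_prod (z - x)) * f z x \<partial>lborel)"
      by (rule nn_integral_lborel_shift) measurable
    finally show ?thesis by (simp add: h_def D_def)
  qed
  let ?C = "4 ^ ?n * ((2 ^ ?n * K)\<^sup>2 * (2 * pi) ^ (2 * ?n))"
  let ?U = "\<integral>\<^sup>+x. ennreal ((norm (u x))\<^sup>2) \<partial>lborel"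
  have pl: "(\<Prod>b\<leftarrow>bs. poisson_kernel (s \<bullet> b)) = poisson_prod s" for s
    unfolding poisson_prod_def bs(1)[symmetric] by (rule prod.distinct_set_conv_list[OF bs(2), symmetric])
  \<comment> \<open>For fixed z the symbol is independent of x and the weight is centred at z, so
    the weighted multiplier estimate applies.\<close>
  have w: "(\<integral>\<^sup>+x. ennreal (poisson_prod (z - x)) * f z x \<partial>lborel)
     \<le> ennreal ?C * (\<integral>\<^sup>+y. ennreal ((norm (u y))\<^sup>2 * poisson_prod (z - y)) \<partial>lborel)" for z
  proof -
    have "bdd_smooth (length bs) (2 ^ ?n * K) (\<lambda>\<xi>. \<rho> (z, \<xi>))"
      using bdd_smooth_slice[OF \<rho>] bs by simp
    from weighted_fourier_multiplier_le[OF u this, of z] bs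
    show ?thesis by (simp only: pl bs f_def) (simp add: ennreal_mult mult.commute)
  qed
  have "(\<integral>\<^sup>+x. ennreal ((norm (fourier_multiplier (\<lambda>\<xi>. \<sigma> (x, \<xi>)) u x))\<^sup>2) \<partial>lborel)
     \<le> (\<integral>\<^sup>+x. \<integral>\<^sup>+z. ennreal (2 ^ ?n * poisson_prod (z - x)) * f z x \<partial>lborel \<partial>lborel)"
    by (intro nn_integral_mono sob)
  also have "\<dots> = (\<integral>\<^sup>+z. \<integral>\<^sup>+x. ennreal (2 ^ ?n * poisson_prod (z - x)) * f z x \<partial>lborel \<partial>lborel)"
    by (rule lborel_pair.Fubini') measurable
  also have "\<dots> = (\<integral>\<^sup>+z. ennreal (2 ^ ?n) * (\<integral>\<^sup>+x. ennreal (poisson_prod (z - x)) * f z x \<partial>lborel) \<partial>lborel)"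
    by (intro nn_integral_cong, subst nn_integral_cmult[symmetric]) (auto simp: ennreal_mult mult.assoc)
  also have "\<dots> \<le> (\<integral>\<^sup>+z. ennreal (2 ^ ?n) * (ennreal ?C * (\<integral>\<^sup>+y. ennreal ((norm (u y))\<^sup>2 * poisson_prod (z - y)) \<partial>lborel)) \<partial>lborel)"
    by (intro nn_integral_mono mult_left_mono w) auto
  also have "\<dots> = ennreal (2 ^ ?n) * (ennreal ?C * (\<integral>\<^sup>+z. \<integral>\<^sup>+y. ennreal ((norm (u y))\<^sup>2 * poisson_prod (z - y)) \<partial>lborel \<partial>lborel))"
    by (subst nn_integral_cmult, measurable, subst nn_integral_cmult, measurable)
  also have "(\<integral>\<^sup>+z. \<integral>\<^sup>+y. ennreal ((norm (u y))\<^sup>2 * poisson_prod (z - y)) \<partial>lborel \<partial>lborel)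
     = (\<integral>\<^sup>+y. \<integral>\<^sup>+z. ennreal ((norm (u y))\<^sup>2 * poisson_prod (z - y)) \<partial>lborel \<partial>lborel)"
    by (rule lborel_pair.Fubini') measurable
  \<comment> \<open>After the exchange of integrals the weight is the only factor that depends on z;
    its integral is pi^n for every y.\<close>
  also have "\<dots> = (\<integral>\<^sup>+y. ennreal ((norm (u y))\<^sup>2) * ennreal (pi ^ ?n) \<partial>lborel)"
  proof (intro nn_integral_cong)
    fix y
    have "(\<integral>\<^sup>+z. ennreal ((norm (u y))\<^sup>2 * poisson_prod (z - y)) \<partial>lborel)
       = ennreal ((norm (u y))\<^sup>2) * (\<integral>\<^sup>+z. ennreal (poisson_prod (z + - y)) \<partial>lborel)"
      by (subst nn_integral_cmult[symmetric]) (auto simp: ennreal_mult)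
    also have "(\<integral>\<^sup>+z. ennreal (poisson_prod (z + - y)) \<partial>lborel) = (\<integral>\<^sup>+z. ennreal (poisson_prod (z :: real^'n)) \<partial>lborel)"
      by (rule nn_integral_lborel_shift) measurable
    finally show "(\<integral>\<^sup>+z. ennreal ((norm (u y))\<^sup>2 * poisson_prod (z - y)) \<partial>lborel) = ennreal ((norm (u y))\<^sup>2) * ennreal (pi ^ ?n)"
      by (simp add: nn_integral_poisson_prod)
  qed
  also have "\<dots> = ?U * ennreal (pi ^ ?n)"
    by (rule nn_integral_multc) measurable
  also have "ennreal (2 ^ ?n) * (ennreal ?C * (?U * ennreal (pi ^ ?n))) = ennreal (2 ^ ?n * ?C * pi ^ ?n) * ?U"
  proof -
    have "ennreal (2 ^ ?n * ?C * pi ^ ?n) = ennreal (2 ^ ?n) * ennreal ?C * ennreal (pi ^ ?n)"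
      by (subst ennreal_mult, simp, simp, subst ennreal_mult) simp_all
    then show ?thesis by (simp only: mult_ac)
  qed
  finally show ?thesis by (simp only: mult.assoc)
qed

section \<open>Schwartz functions\<close>

text \<open>With arbitrary lists of basis vectors in place of multi-indices, closure under a
  derivative amounts to appending one direction.\<close>

lemma schwartz_iff:
  fixes f :: "real^'n \<Rightarrow> complex"
  shows "schwartz f \<longleftrightarrow> smooth f \<and>
    (\<forall>k bs. set bs \<subseteq> Basis \<longrightarrow> (\<exists>C. \<forall>x. (1 + norm x) ^ k * norm (partial_derivs bs f x) \<le> C))"
proof (intro iffI conjI allI impI)
  fix k and bs :: "(real^'n) list" assume f: "schwartz f" and bs: "set bs \<subseteq> Basis"
  obtain \<alpha> where "\<And>f :: real^'n \<Rightarrow> complex. smooth f \<Longrightarrow> partial_derivs bs f = multi_deriv \<alpha> f"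
    using partial_derivs_multi_deriv[OF bs] by blast
  then show "\<exists>C. \<forall>x. (1 + norm x) ^ k * norm (partial_derivs bs f x) \<le> C"
    using f by (auto simp: schwartz_def)
next
  assume *: "smooth f \<and> (\<forall>k bs. set bs \<subseteq> Basis \<longrightarrow> (\<exists>C. \<forall>x. (1 + norm x) ^ k * norm (partial_derivs bs f x) \<le> C))"
  have "set (map (\<lambda>i. axis i 1) (multiindex_list \<beta>)) \<subseteq> (Basis :: (real^'n) set)" for \<beta> :: "'n multiindex"
    by (auto simp: Basis_vec_def)
  then show "schwartz f"
    using * by (auto simp: schwartz_def multi_deriv_def)
qed (auto simp: schwartz_def)

lemma schwartz_smooth: "schwartz f \<Longrightarrow> smooth f"
  by (simp add: schwartz_def)

lemma schwartz_measurable: "schwartz f \<Longrightarrow> f \<in> borel_measurable borel"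
  by (intro borel_measurable_continuous_onI smooth_continuous_on schwartz_smooth)

lemma schwartz_diff:
  assumes "schwartz f" "schwartz g"
  shows "schwartz (\<lambda>x. f x - g x)"
  unfolding schwartz_iff
proof (intro conjI allI impI)
  note sm = assms[THEN schwartz_smooth]
  show "smooth (\<lambda>x. f x - g x)" by (rule smooth_diff[OF sm])
  fix k and bs :: "(real^'a) list" assume bs: "set bs \<subseteq> Basis"
  obtain C D where "\<And>x. (1 + norm x) ^ k * norm (partial_derivs bs f x) \<le> C"
      "\<And>x. (1 + norm x) ^ k * norm (partial_derivs bs g x) \<le> D"
    using assms bs unfolding schwartz_iff by metis
  then have "(1 + norm x) ^ k * norm (partial_derivs bs (\<lambda>x. f x - g x) x) \<le> C + D" for x
    unfolding partial_derivs_diff[OF sm bs]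
    by (intro order_trans[OF mult_left_mono[OF norm_triangle_ineq4]]) (auto simp: distrib_left intro!: add_mono)
  then show "\<exists>C. \<forall>x. (1 + norm x) ^ k * norm (partial_derivs bs (\<lambda>x. f x - g x) x) \<le> C" by blast
qed

lemma schwartz_cmult:
  assumes "schwartz f"
  shows "schwartz (\<lambda>x. c * f x)"
  unfolding schwartz_iff
proof (intro conjI allI impI)
  note sm = assms[THEN schwartz_smooth]
  show "smooth (\<lambda>x. c * f x)" by (rule smooth_cmult[OF sm])
  fix k and bs :: "(real^'a) list" assume bs: "set bs \<subseteq> Basis"
  obtain C where "\<And>x. (1 + norm x) ^ k * norm (partial_derivs bs f x) \<le> C"
    using assms bs unfolding schwartz_iff by metis
  then have "(1 + norm x) ^ k * norm (partial_derivs bs (\<lambda>x. c * f x) x) \<le> norm c * C" for x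
    unfolding partial_derivs_cmult[OF sm bs] norm_mult
    by (subst mult.left_commute) (auto intro!: mult_left_mono)
  then show "\<exists>C. \<forall>x. (1 + norm x) ^ k * norm (partial_derivs bs (\<lambda>x. c * f x) x) \<le> C" by blast
qed

lemma schwartz_add:
  assumes "schwartz f" "schwartz g"
  shows "schwartz (\<lambda>x. f x + g x)"
  using schwartz_diff[OF assms(1) schwartz_cmult[OF assms(2), of "-1"]] by simp

lemma schwartz_partial_deriv:
  fixes f :: "real^'n \<Rightarrow> complex"
  assumes "schwartz f" "b \<in> Basis"
  shows "schwartz (partial_deriv b f)"
  unfolding schwartz_iff
proof (intro conjI allI impI)
  show "smooth (partial_deriv b f)" using assms by (auto intro: smooth_partial_deriv schwartz_smooth)
  fix k and bs :: "(real^'n) list" assume "set bs \<subseteq> Basis"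
  then have "set (bs @ [b]) \<subseteq> Basis" using assms by auto
  from assms(1)[unfolded schwartz_iff, THEN conjunct2, rule_format, OF this, of k]
  show "\<exists>C. \<forall>x. (1 + norm x) ^ k * norm (partial_derivs bs (partial_deriv b f) x) \<le> C"
    by (simp add: partial_derivs_append)
qed

lemma schwartz_id_minus_deriv:
  "schwartz f \<Longrightarrow> b \<in> Basis \<Longrightarrow> schwartz (id_minus_deriv b f)"
  unfolding id_minus_deriv_def[abs_def] by (intro schwartz_diff schwartz_partial_deriv)

section \<open>Integrability of Schwartz functions and of their Fourier transforms\<close>

lemma poisson_prod_ge: "1 \<le> (1 + norm (x :: 'a::euclidean_space)) ^ (2 * DIM('a)) * poisson_prod x"
proof -
  have "1 / (1 + (x \<bullet> b)\<^sup>2) \<ge> 1 / (1 + norm x)\<^sup>2" if "b \<in> Basis" for b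
  proof -
    have "(x \<bullet> b)\<^sup>2 \<le> (norm x)\<^sup>2" using Basis_le_norm[OF that, of x] by (simp add: abs_le_square_iff[symmetric])
    then have "1 + (x \<bullet> b)\<^sup>2 \<le> (1 + norm x)\<^sup>2"
      using norm_ge_zero[of x] unfolding power2_sum one_power2 mult_1_right by linarith
    then show ?thesis by (intro frac_le) (auto intro: add_pos_nonneg)
  qed
  then have "(\<Prod>b\<in>(Basis :: 'a set). 1 / (1 + norm x)\<^sup>2) \<le> poisson_prod x"
    unfolding poisson_prod_def poisson_kernel_def by (intro prod_mono) auto
  moreover have "(\<Prod>b\<in>(Basis :: 'a set). 1 / (1 + norm x)\<^sup>2) = 1 / (1 + norm x) ^ (2 * DIM('a))"
    by (simp add: power_one_over power_mult)
  ultimately show ?thesis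
    by (simp add: divide_le_eq mult.commute add_pos_nonneg)
qed

lemma poisson_prod_integrable: "integrable lborel (poisson_prod :: 'a::euclidean_space \<Rightarrow> real)"
  by (rule integrableI_nonneg) (auto simp: nn_integral_poisson_prod)

text \<open>Decay of order 2 n is turned into domination by the fixed integrable product
  \<open>poisson_prod\<close>, by \<open>poisson_prod_ge\<close>.\<close>

lemma schwartz_bound:
  fixes f :: "real^'n \<Rightarrow> complex"
  assumes "schwartz f"
  obtains C where "\<And>x. norm (f x) \<le> C * poisson_prod x" "\<And>x. norm (f x) \<le> C"
proof -
  obtain C where C: "\<And>x. (1 + norm x) ^ (2 * CARD('n)) * norm (f x) \<le> C"
    using assms[unfolded schwartz_iff, THEN conjunct2, rule_format, of "[]" "2 * CARD('n)"] by auto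
  obtain D where D: "\<And>x. (1 + norm x) ^ 0 * norm (f x) \<le> D"
    using assms[unfolded schwartz_iff, THEN conjunct2, rule_format, of "[]" 0] by auto
  show ?thesis
  proof (rule that[of "max C D"])
    fix x
    have "norm (f x) \<le> norm (f x) * ((1 + norm x) ^ (2 * CARD('n)) * poisson_prod x)"
      using poisson_prod_ge[of x] mult_left_mono[of 1 "(1 + norm x) ^ (2 * CARD('n)) * poisson_prod x" "norm (f x)"] by simp
    also have "\<dots> = ((1 + norm x) ^ (2 * CARD('n)) * norm (f x)) * poisson_prod x" by (simp only: mult_ac)
    also have "\<dots> \<le> max C D * poisson_prod x"
      using C[of x] by (intro mult_right_mono) auto
    finally show "norm (f x) \<le> max C D * poisson_prod x" .
    show "norm (f x) \<le> max C D" using D[of x] by simp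
  qed
qed

lemma schwartz_integrable:
  assumes "schwartz f"
  shows "integrable lborel f"
proof -
  obtain C where C: "\<And>x. norm (f x) \<le> C * poisson_prod x" using schwartz_bound[OF assms] by metis
  show ?thesis
    by (rule Bochner_Integration.integrable_bound[OF integrable_mult_right[OF poisson_prod_integrable, of C]])
       (use schwartz_measurable[OF assms] C in \<open>auto intro: order_trans[OF C abs_ge_self]\<close>)
qed

lemma schwartz_square_integrable:
  assumes "schwartz f"
  shows "square_integrable f"
proof -
  obtain C where C: "\<And>x. norm (f x) \<le> C" using schwartz_bound[OF assms] by metis
  have [measurable]: "f \<in> borel_measurable borel" by (rule schwartz_measurable[OF assms])
  have "integrable lborel (\<lambda>x. (norm (f x))\<^sup>2)"
  proof (rule Bochner_Integration.integrable_bound[OF integrable_mult_right[OF integrable_norm[OF schwartz_integrable[OF assms]], of C]])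
    show "AE x in lborel. norm ((norm (f x))\<^sup>2) \<le> norm (C * norm (f x))"
    proof (rule AE_I2)
      fix x
      have "(norm (f x))\<^sup>2 \<le> C * norm (f x)" unfolding power2_eq_square by (intro mult_right_mono C) auto
      then show "norm ((norm (f x))\<^sup>2) \<le> norm (C * norm (f x))" by simp
    qed
  qed measurable
  then show ?thesis by (simp add: square_integrable_def)
qed

text \<open>f is the exponential average of the translates of g = (1 - d_b) f, and a translation
  multiplies the transform by a character. By \<open>integral_expm_cis\<close> the transform of f is
  that of g divided by 1 - i (\<xi> . b), whose squared modulus is the reciprocal of the
  kernel.\<close>

lemma norm_fourier_id_minus_deriv:
  assumes f: "schwartz f" and b: "b \<in> Basis"
  shows "(norm (fourier f \<xi>))\<^sup>2 = (norm (fourier (id_minus_deriv b f) \<xi>))\<^sup>2 * poisson_kernel (\<xi> \<bullet> b)"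
proof -
  define g where "g = id_minus_deriv b f"
  have g: "schwartz g" unfolding g_def by (rule schwartz_id_minus_deriv[OF f b])
  have [measurable]: "g \<in> borel_measurable borel" by (rule schwartz_measurable[OF g])
  obtain C where C: "\<And>x. norm (f x) \<le> C" using schwartz_bound[OF f] by metis
  obtain D where D: "\<And>x. norm (partial_deriv b f x) \<le> D" using schwartz_bound[OF schwartz_partial_deriv[OF f b]] by metis
  have rep: "f y = (\<integral>r. g (y + r *\<^sub>R b) \<partial>expm)" for y
  proof -
    have "(\<integral>r. (f (y + r *\<^sub>R b) - partial_deriv b f (y + r *\<^sub>R b)) \<partial>expm) = f (y + 0 *\<^sub>R b)"
    proof (rule integral_expm_diff_deriv[where B = "max C D"])
      show "((\<lambda>r. f (y + r *\<^sub>R b)) has_vector_derivative partial_deriv b f (y + r *\<^sub>R b)) (at r)" for r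
        by (rule smooth_has_vector_derivative[OF schwartz_smooth[OF f] b])
      show "continuous_on UNIV (\<lambda>r. partial_deriv b f (y + r *\<^sub>R b))"
        by (rule continuous_on_compose2[OF smooth_continuous_on[OF smooth_partial_deriv[OF schwartz_smooth[OF f] b]]])
           (auto intro!: continuous_intros)
    qed (auto intro: order_trans[OF C] order_trans[OF D])
    then show ?thesis by (simp add: g_def id_minus_deriv_def)
  qed
  let ?F = "\<lambda>r y. exp (- \<i> * of_real (y \<bullet> \<xi>)) * g (y + r *\<^sub>R b)"
  have int: "integrable (expm \<Otimes>\<^sub>M lborel) (case_prod ?F)"
  proof (rule integrableI_bounded)
    have "(\<integral>\<^sup>+p. ennreal (norm (case_prod ?F p)) \<partial>(expm \<Otimes>\<^sub>M lborel)) = (\<integral>\<^sup>+r. \<integral>\<^sup>+y. ennreal (norm (g (y + r *\<^sub>R b))) \<partial>lborel \<partial>expm)"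
      by (subst lborel.nn_integral_fst[symmetric]) (auto simp: norm_mult)
    also have "\<dots> = (\<integral>\<^sup>+r. \<integral>\<^sup>+y. ennreal (norm (g y)) \<partial>lborel \<partial>expm)"
      by (subst nn_integral_lborel_shift) auto
    also have "\<dots> < \<infinity>"
      using schwartz_integrable[OF g] expm.emeasure_space_1 by (simp add: integrable_iff_bounded)
    finally show "(\<integral>\<^sup>+p. ennreal (norm (case_prod ?F p)) \<partial>(expm \<Otimes>\<^sub>M lborel)) < \<infinity>" .
  qed measurable
  have shift: "(\<integral>y. ?F r y \<partial>lborel) = exp (- \<i> * of_real (r * (- (\<xi> \<bullet> b)))) * fourier g \<xi>" for r
  proof -
    have "exp (- \<i> * of_real (y \<bullet> \<xi>)) * g (y + r *\<^sub>R b)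
        = exp (- \<i> * of_real (r * (- (\<xi> \<bullet> b)))) * (exp (- \<i> * of_real ((y + r *\<^sub>R b) \<bullet> \<xi>)) * g (y + r *\<^sub>R b))" for y
    proof -
      have "exp (- \<i> * of_real (y \<bullet> \<xi>)) = exp (- \<i> * of_real (r * (- (\<xi> \<bullet> b)))) * exp (- \<i> * of_real ((y + r *\<^sub>R b) \<bullet> \<xi>))"
        by (unfold exp_add[symmetric], rule arg_cong[where f = exp])
           (simp add: inner_add_left inner_commute[of b \<xi>] algebra_simps)
      then show ?thesis by (simp only: mult.assoc)
    qed
    then have "(\<integral>y. ?F r y \<partial>lborel)
      = exp (- \<i> * of_real (r * (- (\<xi> \<bullet> b)))) * (\<integral>y. exp (- \<i> * of_real ((y + r *\<^sub>R b) \<bullet> \<xi>)) * g (y + r *\<^sub>R b) \<partial>lborel)"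
      by (simp only: integral_mult_right_zero)
    also have "(\<integral>y. exp (- \<i> * of_real ((y + r *\<^sub>R b) \<bullet> \<xi>)) * g (y + r *\<^sub>R b) \<partial>lborel) = fourier g \<xi>"
      unfolding fourier_def by (rule integral_lborel_shift) measurable
    finally show ?thesis .
  qed
  have "fourier f \<xi> = (\<integral>y. (\<integral>r. ?F r y \<partial>expm) \<partial>lborel)"
    unfolding fourier_def rep by simp
  also have "\<dots> = (\<integral>r. (\<integral>y. ?F r y \<partial>lborel) \<partial>expm)"
    by (rule expm_lborel.Fubini_integral[OF int])
  also have "\<dots> = (\<integral>r. exp (- \<i> * of_real (r * (- (\<xi> \<bullet> b)))) \<partial>expm) * fourier g \<xi>"
    unfolding shift by (rule integral_mult_left_zero)
  also have "\<dots> = fourier g \<xi> / (1 + \<i> * of_real (- (\<xi> \<bullet> b)))"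
    unfolding integral_expm_cis by simp
  finally show ?thesis
    by (simp add: g_def norm_divide power_divide cmod_power2 poisson_kernel_def)
qed

text \<open>One operator 1 - d_b per coordinate gains only the square root of the kernel, which is
  not integrable. Two gain the kernel itself, hence the doubled operator in
  \<open>D\<close>.\<close>

lemma schwartz_fourier_integrable:
  fixes f :: "real^'n \<Rightarrow> complex"
  assumes f: "schwartz f"
  shows "fourier_integrable f"
proof -
  obtain bs :: "(real^'n) list" where bs: "set bs = Basis" "distinct bs" "length bs = CARD('n)"
    using basis_enumeration[where 'a = "real^'n"] by auto
  define D where "D cs = foldr (\<lambda>b f. id_minus_deriv b (id_minus_deriv b f)) cs f" for cs
  have D: "schwartz (D cs)" if "set cs \<subseteq> Basis" for cs
    using that by (induction cs) (auto simp: D_def f intro!: schwartz_id_minus_deriv)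
  have "norm (fourier f \<xi>) = norm (fourier (D cs) \<xi>) * (\<Prod>b\<leftarrow>cs. poisson_kernel (\<xi> \<bullet> b))"
    if "set cs \<subseteq> Basis" for cs \<xi>
    using that
  proof (induction cs)
    case (Cons b cs)
    have b: "b \<in> Basis" and cs: "set cs \<subseteq> Basis" using Cons.prems by auto
    have "(norm (fourier (D cs) \<xi>))\<^sup>2 = (norm (fourier (D (b # cs)) \<xi>))\<^sup>2 * (poisson_kernel (\<xi> \<bullet> b))\<^sup>2"
      using norm_fourier_id_minus_deriv[OF D[OF cs] b, of \<xi>]
        norm_fourier_id_minus_deriv[OF schwartz_id_minus_deriv[OF D[OF cs] b] b, of \<xi>]
      by (simp add: D_def power2_eq_square[of "poisson_kernel _"])
    then have "(norm (fourier (D cs) \<xi>))\<^sup>2 = (norm (fourier (D (b # cs)) \<xi>) * poisson_kernel (\<xi> \<bullet> b))\<^sup>2"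
      by (simp add: power_mult_distrib)
    then have "norm (fourier (D cs) \<xi>) = norm (fourier (D (b # cs)) \<xi>) * poisson_kernel (\<xi> \<bullet> b)"
      by (rule power2_eq_imp_eq) auto
    then show ?case using Cons.IH[OF cs] by simp
  qed (simp add: D_def)
  from this[of bs] have eq: "norm (fourier f \<xi>) = norm (fourier (D bs) \<xi>) * poisson_prod \<xi>" for \<xi>
    unfolding poisson_prod_def bs(1)[symmetric] prod.distinct_set_conv_list[OF bs(2)] by simp
  have [measurable]: "f \<in> borel_measurable borel" by (rule schwartz_measurable[OF f])
  have "integrable lborel (fourier f)"
  proof (rule Bochner_Integration.integrable_bound[OF integrable_mult_right[OF poisson_prod_integrable, of "\<integral>x. norm (D bs x) \<partial>lborel"]])
    show "AE \<xi> in lborel. norm (fourier f \<xi>) \<le> norm ((\<integral>x. norm (D bs x) \<partial>lborel) * poisson_prod \<xi>)"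
      unfolding eq by (auto simp: abs_mult intro!: mult_right_mono order_trans[OF norm_fourier_le])
  qed measurable
  then show ?thesis using schwartz_integrable[OF f] by (simp add: fourier_integrable_def)
qed

section \<open>Pseudo-differential operators on Schwartz functions\<close>

lemma pdo_eq_fourier_multiplier:
  "pdo \<sigma> u x = of_real ((2 * pi) powr (- real CARD('n))) * fourier_multiplier (\<sigma> x) u (x :: real^'n)"
  by (simp add: pdo_def fourier_multiplier_def)

lemma pdo_measurable:
  assumes "(\<lambda>(x, \<xi>). \<sigma> x \<xi>) \<in> borel_measurable borel" and [measurable]: "u \<in> borel_measurable borel"
  shows "pdo \<sigma> u \<in> borel_measurable borel"
proof -
  have [measurable]: "(\<lambda>(x, \<xi>). \<sigma> x \<xi>) \<in> borel_measurable (borel \<Otimes>\<^sub>M borel)"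
    using assms(1) by (simp add: borel_prod)
  show ?thesis unfolding pdo_def[abs_def] by measurable
qed

text \<open>The constant of \<open>fourier_multiplier_diagonal_le\<close> with K^2 taken out, times
  the square of the normalisation (2 pi)^(-n); the root passes from squared norms to norms.\<close>

definition pdo_const :: "'n::finite itself \<Rightarrow> real" where
  "pdo_const _ = sqrt (((2 * pi) powr (- real CARD('n)))\<^sup>2 *
     (2 ^ CARD('n) * 4 ^ CARD('n) * ((2 ^ CARD('n))\<^sup>2 * (2 * pi) ^ (2 * CARD('n))) * pi ^ CARD('n)))"

lemma pdo_schwartz_bound:
  fixes \<phi> :: "real^'n \<Rightarrow> complex"
  assumes \<sigma>: "bdd_smooth (2 * CARD('n)) K (\<lambda>(x, \<xi>). \<sigma> x \<xi>)" and \<phi>: "schwartz \<phi>"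
  shows "square_integrable (pdo \<sigma> \<phi>)"
    and "norm (abs_L2 (pdo \<sigma> \<phi>)) \<le> pdo_const TYPE('n) * K * norm (abs_L2 \<phi>)"
proof -
  let ?k = "(2 * pi) powr (- real CARD('n)) :: real"
  let ?C = "2 ^ CARD('n) * 4 ^ CARD('n) * ((2 ^ CARD('n) * K)\<^sup>2 * (2 * pi) ^ (2 * CARD('n))) * pi ^ CARD('n)"
  have K: "0 \<le> K" using bdd_smooth_bound[OF \<sigma>] order_trans norm_ge_zero by blast
  have [measurable]: "\<phi> \<in> borel_measurable borel" by (rule schwartz_measurable[OF \<phi>])
  have [measurable]: "pdo \<sigma> \<phi> \<in> borel_measurable borel"
    by (intro pdo_measurable bdd_smooth_measurable[OF \<sigma>]) measurable
  have si: "square_integrable \<phi>" by (rule schwartz_square_integrable[OF \<phi>])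
  have eqn: "(\<integral>\<^sup>+x. ennreal ((norm (\<phi> x))\<^sup>2) \<partial>lborel) = ennreal ((norm (abs_L2 \<phi>))\<^sup>2)"
    unfolding norm_abs_L2[OF si] using si
    by (subst nn_integral_eq_integral) (auto simp: square_integrable_def integral_nonneg_AE)
  have "(\<integral>\<^sup>+x. ennreal ((norm (pdo \<sigma> \<phi> x))\<^sup>2) \<partial>lborel) =
      (\<integral>\<^sup>+x. ennreal (?k\<^sup>2) * ennreal ((norm (fourier_multiplier (\<sigma> x) \<phi> x))\<^sup>2) \<partial>lborel)"
    unfolding pdo_eq_fourier_multiplier
    by (intro nn_integral_cong) (simp add: norm_mult power_mult_distrib ennreal_mult)
  also have "\<dots> = ennreal (?k\<^sup>2) * (\<integral>\<^sup>+x. ennreal ((norm (fourier_multiplier (\<sigma> x) \<phi> x))\<^sup>2) \<partial>lborel)"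
  proof (rule nn_integral_cmult)
    have [measurable]: "(\<lambda>(x, \<xi>). \<sigma> x \<xi>) \<in> borel_measurable (borel \<Otimes>\<^sub>M borel)"
      using bdd_smooth_measurable[OF \<sigma>] by (simp add: borel_prod)
    show "(\<lambda>x. ennreal ((norm (fourier_multiplier (\<sigma> x) \<phi> x))\<^sup>2)) \<in> borel_measurable lborel"
      unfolding fourier_multiplier_def by measurable
  qed
  also have "\<dots> \<le> ennreal (?k\<^sup>2) * (ennreal ?C * (\<integral>\<^sup>+x. ennreal ((norm (\<phi> x))\<^sup>2) \<partial>lborel))"
    using fourier_multiplier_diagonal_le[OF schwartz_fourier_integrable[OF \<phi>] \<sigma>]
    by (intro mult_left_mono) auto
  also have "\<dots> = ennreal (?k\<^sup>2 * ?C * (norm (abs_L2 \<phi>))\<^sup>2)"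
    unfolding eqn by (subst ennreal_mult[symmetric], simp, simp, subst ennreal_mult[symmetric]) (simp_all add: mult.assoc)
  also have "?k\<^sup>2 * ?C * (norm (abs_L2 \<phi>))\<^sup>2 = (pdo_const TYPE('n) * K * norm (abs_L2 \<phi>))\<^sup>2"
    unfolding pdo_const_def by (simp add: power_mult_distrib mult_ac)
  finally have le: "(\<integral>\<^sup>+x. ennreal ((norm (pdo \<sigma> \<phi> x))\<^sup>2) \<partial>lborel) \<le> ennreal ((pdo_const TYPE('n) * K * norm (abs_L2 \<phi>))\<^sup>2)" .
  have int: "integrable lborel (\<lambda>x. (norm (pdo \<sigma> \<phi> x))\<^sup>2)"
    by (rule integrableI_nonneg) (use le in \<open>auto intro: order.strict_trans1\<close>)
  then show si2: "square_integrable (pdo \<sigma> \<phi>)" by (simp add: square_integrable_def)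
  have "ennreal ((norm (abs_L2 (pdo \<sigma> \<phi>)))\<^sup>2) = (\<integral>\<^sup>+x. ennreal ((norm (pdo \<sigma> \<phi> x))\<^sup>2) \<partial>lborel)"
    unfolding norm_abs_L2[OF si2] by (subst nn_integral_eq_integral[OF int]) (auto simp: integral_nonneg_AE)
  with le have "(norm (abs_L2 (pdo \<sigma> \<phi>)))\<^sup>2 \<le> (pdo_const TYPE('n) * K * norm (abs_L2 \<phi>))\<^sup>2"
    by (metis ennreal_le_iff zero_le_power2)
  then show "norm (abs_L2 (pdo \<sigma> \<phi>)) \<le> pdo_const TYPE('n) * K * norm (abs_L2 \<phi>)"
    by (rule power2_le_imp_le) (use K in \<open>auto simp: pdo_const_def\<close>)
qed

text \<open>The form f - c g covers differences, sums and multiples at once, and is kept through the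
  extension to \<open>L2\<close>.\<close>

lemma fourier_lincomb:
  assumes "integrable lborel f" "integrable lborel g"
  shows "fourier (\<lambda>x. f x - c * g x) \<xi> = fourier f \<xi> - c * fourier g \<xi>"
proof -
  have "fourier (\<lambda>x. f x - c * g x) \<xi> = (\<integral>x. exp (- \<i> * of_real (x \<bullet> \<xi>)) * f x - c * (exp (- \<i> * of_real (x \<bullet> \<xi>)) * g x) \<partial>lborel)"
    unfolding fourier_def by (intro Bochner_Integration.integral_cong refl) (simp add: right_diff_distrib mult.left_commute)
  also have "\<dots> = fourier f \<xi> - c * fourier g \<xi>"
    unfolding fourier_def
    by (subst Bochner_Integration.integral_diff) (intro integrable_mult_right integrable_exp_mult assms | rule refl | simp)+
  finally show ?thesis .
qed

lemma pdo_lincomb: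
  assumes \<sigma>: "bdd_smooth k K (\<lambda>(x, \<xi>). \<sigma> x \<xi>)" and f: "schwartz f" and g: "schwartz g"
  shows "pdo \<sigma> (\<lambda>x. f x - c * g x) = (\<lambda>x. pdo \<sigma> f x - c * pdo \<sigma> g x)"
proof
  fix x
  have [measurable]: "\<sigma> x \<in> borel_measurable borel" and K: "\<And>\<xi>. norm (\<sigma> x \<xi>) \<le> K"
    using bdd_smooth_measurable[OF bdd_smooth_slice[OF \<sigma>, of x]] bdd_smooth_bound[OF bdd_smooth_slice[OF \<sigma>, of x]] by auto
  have i: "integrable lborel (\<lambda>\<xi>. exp (\<i> * of_real (x \<bullet> \<xi>)) * \<sigma> x \<xi> * fourier h \<xi>)" if "schwartz h" for h
    using schwartz_fourier_integrable[OF that]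
    by (intro integrable_mult_bounded[where B = K]) (auto simp: norm_mult K fourier_integrable_def)
  have "fourier_multiplier (\<sigma> x) (\<lambda>x. f x - c * g x) x
    = (\<integral>\<xi>. exp (\<i> * of_real (x \<bullet> \<xi>)) * \<sigma> x \<xi> * fourier f \<xi> - c * (exp (\<i> * of_real (x \<bullet> \<xi>)) * \<sigma> x \<xi> * fourier g \<xi>) \<partial>lborel)"
    unfolding fourier_multiplier_def fourier_lincomb[OF schwartz_integrable[OF f] schwartz_integrable[OF g]]
    by (intro Bochner_Integration.integral_cong refl) (simp add: right_diff_distrib mult_ac)
  also have "\<dots> = fourier_multiplier (\<sigma> x) f x - c * fourier_multiplier (\<sigma> x) g x"
    unfolding fourier_multiplier_def
    by (subst Bochner_Integration.integral_diff) (auto intro!: integrable_mult_right i f g)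
  finally show "pdo \<sigma> (\<lambda>x. f x - c * g x) x = pdo \<sigma> f x - c * pdo \<sigma> g x"
    by (simp add: pdo_eq_fourier_multiplier right_diff_distrib mult.left_commute)
qed

section \<open>Gaussian-type Schwartz functions\<close>

lemma real_polynomial_function_directional_derivative:
  assumes "real_polynomial_function p"
  shows "\<exists>p'. real_polynomial_function p' \<and>
    (\<forall>x. ((\<lambda>s. p (x + s *\<^sub>R b)) has_real_derivative p' x) (at 0))"
  using assms
proof induction
  case (linear f)
  have "((\<lambda>s. f (x + s *\<^sub>R b)) has_real_derivative f b) (at 0)" for x
    unfolding linear_add[OF bounded_linear.linear[OF linear]] linear_scale[OF bounded_linear.linear[OF linear]]
    by (auto intro!: derivative_eq_intros)
  then show ?case by (intro exI[of _ "\<lambda>_. f b"]) auto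
next
  case (const c)
  show ?case by (intro exI[of _ "\<lambda>_. 0"]) auto
next
  case (add f g)
  then obtain f' g' where "real_polynomial_function f'" "real_polynomial_function g'"
    "\<And>x. ((\<lambda>s. f (x + s *\<^sub>R b)) has_real_derivative f' x) (at 0)"
    "\<And>x. ((\<lambda>s. g (x + s *\<^sub>R b)) has_real_derivative g' x) (at 0)" by blast
  then show ?case
    by (intro exI[of _ "\<lambda>x. f' x + g' x"]) (auto intro: DERIV_add)
next
  case (mult f g)
  then obtain f' g' where *: "real_polynomial_function f'" "real_polynomial_function g'"
    "\<And>x. ((\<lambda>s. f (x + s *\<^sub>R b)) has_real_derivative f' x) (at 0)"
    "\<And>x. ((\<lambda>s. g (x + s *\<^sub>R b)) has_real_derivative g' x) (at 0)" by blast
  have "((\<lambda>s. f (x + s *\<^sub>R b) * g (x + s *\<^sub>R b)) has_real_derivative f' x * g x + g' x * f x) (at 0)" for x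
    using DERIV_mult[OF *(3)[of x] *(4)[of x]] by simp
  then show ?case using *(1,2) mult(1,2)
    by (intro exI[of _ "\<lambda>x. f' x * g x + g' x * f x"]) auto
qed

lemma real_polynomial_function_growth:
  fixes p :: "'a::euclidean_space \<Rightarrow> real"
  assumes "real_polynomial_function p"
  shows "\<exists>A M. 0 \<le> A \<and> (\<forall>x. \<bar>p x\<bar> \<le> A * (1 + norm x) ^ M)"
  using assms
proof induction
  case (linear f)
  obtain K where K: "0 < K" "\<And>x. norm (f x) \<le> norm x * K" using bounded_linear.pos_bounded[OF linear] by blast
  have "\<bar>f x\<bar> \<le> K * (1 + norm x) ^ 1" for x
    using K(2)[of x] K(1) by (simp add: algebra_simps)
  then show ?case using K(1) by (intro exI[of _ K] exI[of _ 1]) auto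
next
  case (const c)
  show ?case by (intro exI[of _ "\<bar>c\<bar>"] exI[of _ 0]) auto
next
  case (add f g)
  then obtain A M B N where *: "0 \<le> A" "\<And>x. \<bar>f x\<bar> \<le> A * (1 + norm x) ^ M" "0 \<le> B" "\<And>x. \<bar>g x\<bar> \<le> B * (1 + norm x) ^ N"
    by metis
  have "\<bar>f x + g x\<bar> \<le> (A + B) * (1 + norm x) ^ (M + N)" for x
  proof -
    have "\<bar>f x + g x\<bar> \<le> A * (1 + norm x) ^ M + B * (1 + norm x) ^ N"
      using *(2)[of x] *(4)[of x] by linarith
    also have "\<dots> \<le> A * (1 + norm x) ^ (M + N) + B * (1 + norm x) ^ (M + N)"
      using * by (intro add_mono mult_left_mono power_increasing) auto
    finally show ?thesis by (simp add: distrib_right)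
  qed
  then show ?case using * by (intro exI[of _ "A + B"] exI[of _ "M + N"]) auto
next
  case (mult f g)
  then obtain A M B N where *: "0 \<le> A" "\<And>x. \<bar>f x\<bar> \<le> A * (1 + norm x) ^ M" "0 \<le> B" "\<And>x. \<bar>g x\<bar> \<le> B * (1 + norm x) ^ N"
    by metis
  have "\<bar>f x * g x\<bar> \<le> (A * B) * (1 + norm x) ^ (M + N)" for x
  proof -
    have "\<bar>f x * g x\<bar> \<le> (A * (1 + norm x) ^ M) * (B * (1 + norm x) ^ N)"
      unfolding abs_mult using * by (intro mult_mono) auto
    then show ?thesis by (simp add: power_add mult_ac)
  qed
  then show ?case using * by (intro exI[of _ "A * B"] exI[of _ "M + N"]) auto
qed

lemma continuous_on_real_polynomial_function: "real_polynomial_function p \<Longrightarrow> continuous_on S p"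
  using continuous_on_polymonial_function real_polynomial_function_eq by blast

lemma real_polynomial_function_sum:
  assumes "\<And>i. i \<in> I \<Longrightarrow> real_polynomial_function (f i)"
  shows "real_polynomial_function (\<lambda>x. \<Sum>i\<in>I. f i x)"
  using assms by (induction I rule: infinite_finite_induct) auto

lemma real_polynomial_function_pow:
  "real_polynomial_function f \<Longrightarrow> real_polynomial_function (\<lambda>x. f x ^ n)"
  by (induction n) auto

text \<open>Polynomials times exp (- q) are stable under differentiation: p exp (- q) becomes (p1 -
  p q1) exp (- q), with directional derivatives p1 and q1. The polynomial growth is then beaten by
  \<open>decay\<close>.\<close>

lemma schwartz_poly_exp:
  fixes p q :: "real^'n \<Rightarrow> real"
  assumes p: "real_polynomial_function p" and q: "real_polynomial_function q"
    and decay: "\<And>N. \<exists>C. \<forall>x. (1 + norm x) ^ N * exp (- q x) \<le> C"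
  shows "schwartz (\<lambda>x. complex_of_real (p x * exp (- q x)))"
proof -
  have step: "\<exists>p''. real_polynomial_function p'' \<and> (\<forall>x. ((\<lambda>s. complex_of_real (p' (x + s *\<^sub>R b) * exp (- q (x + s *\<^sub>R b))))
      has_vector_derivative complex_of_real (p'' x * exp (- q x))) (at 0))"
    if pp: "real_polynomial_function p'" for p' b
  proof -
    obtain p1 where p1: "real_polynomial_function p1" "\<And>x. ((\<lambda>s. p' (x + s *\<^sub>R b)) has_real_derivative p1 x) (at 0)"
      using real_polynomial_function_directional_derivative[OF pp] by blast
    obtain q1 where q1: "real_polynomial_function q1" "\<And>x. ((\<lambda>s. q (x + s *\<^sub>R b)) has_real_derivative q1 x) (at 0)"
      using real_polynomial_function_directional_derivative[OF q] by blast
    have "((\<lambda>s. p' (x + s *\<^sub>R b) * exp (- q (x + s *\<^sub>R b))) has_real_derivative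
        (p1 x + (-1) * (p' x * q1 x)) * exp (- q x)) (at 0)" for x
      by (rule DERIV_cong, (rule derivative_eq_intros p1(2) q1(2) refl)+) (simp add: algebra_simps)
    then have "((\<lambda>s. complex_of_real (p' (x + s *\<^sub>R b) * exp (- q (x + s *\<^sub>R b)))) has_vector_derivative
        complex_of_real ((p1 x + (-1) * (p' x * q1 x)) * exp (- q x))) (at 0)" for x
      by (intro has_vector_derivative_of_real) (simp add: has_real_derivative_iff_has_vector_derivative)
    moreover have "real_polynomial_function (\<lambda>x. p1 x + (-1) * (p' x * q1 x))"
      using p1(1) q1(1) pp by auto
    ultimately show ?thesis by blast
  qed
  have ex: "\<exists>p'. real_polynomial_function p' \<and>
      partial_derivs bs (\<lambda>x. complex_of_real (p x * exp (- q x))) = (\<lambda>x. complex_of_real (p' x * exp (- q x)))" for bs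
  proof (induction bs)
    case Nil show ?case using p by auto
  next
    case (Cons b bs)
    then obtain p' where p': "real_polynomial_function p'"
      "partial_derivs bs (\<lambda>x. complex_of_real (p x * exp (- q x))) = (\<lambda>x. complex_of_real (p' x * exp (- q x)))" by blast
    obtain p'' where p'': "real_polynomial_function p''"
      "\<And>x. ((\<lambda>s. complex_of_real (p' (x + s *\<^sub>R b) * exp (- q (x + s *\<^sub>R b))))
      has_vector_derivative complex_of_real (p'' x * exp (- q x))) (at 0)"
      using step[OF p'(1)] by blast
    show ?case
      using p''(1) partial_deriv_eqI[OF p''(2)] by (intro exI[of _ p'']) (auto simp only: partial_derivs_Cons p'(2))
  qed
  show ?thesis
    unfolding schwartz_iff smooth_def
  proof (intro conjI allI impI ballI)
    fix bs :: "(real^'n) list"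
    obtain p' where p': "real_polynomial_function p'"
      "partial_derivs bs (\<lambda>x. complex_of_real (p x * exp (- q x))) = (\<lambda>x. complex_of_real (p' x * exp (- q x)))"
      using ex by blast
    show "continuous_on UNIV (partial_derivs bs (\<lambda>x. complex_of_real (p x * exp (- q x))))"
      unfolding p'(2) by (intro continuous_intros continuous_on_real_polynomial_function p' q)
    show "(\<lambda>s. partial_derivs bs (\<lambda>x. complex_of_real (p x * exp (- q x))) (x + s *\<^sub>R b)) differentiable (at 0)" for x b
      unfolding p'(2) using step[OF p'(1), of b] by (auto intro: differentiableI_vector)
    fix k
    obtain A M where A: "0 \<le> A" "\<And>x. \<bar>p' x\<bar> \<le> A * (1 + norm x) ^ M" using real_polynomial_function_growth[OF p'(1)] by blast
    obtain C where C: "\<And>x. (1 + norm x) ^ (k + M) * exp (- q x) \<le> C" using decay by blast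
    have "(1 + norm x) ^ k * norm (complex_of_real (p' x * exp (- q x))) \<le> A * C" for x
    proof -
      have "(1 + norm x) ^ k * norm (complex_of_real (p' x * exp (- q x))) = (1 + norm x) ^ k * exp (- q x) * \<bar>p' x\<bar>"
        unfolding norm_of_real by (simp add: abs_mult)
      also have "\<dots> \<le> (1 + norm x) ^ k * exp (- q x) * (A * (1 + norm x) ^ M)"
        by (intro mult_left_mono A) auto
      also have "\<dots> = A * ((1 + norm x) ^ (k + M) * exp (- q x))" by (simp add: power_add mult_ac)
      also have "\<dots> \<le> A * C" by (intro mult_left_mono C A)
      finally show ?thesis .
    qed
    then show "\<exists>C. \<forall>x. (1 + norm x) ^ k * norm (partial_derivs bs (\<lambda>x. complex_of_real (p x * exp (- q x))) x) \<le> C"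
      unfolding p'(2) by blast
  qed
qed

text \<open>The affine coordinate that carries the i-th side of a nondegenerate box onto the
  interval (-1, 1).\<close>

definition box_coord :: "'a::euclidean_space \<Rightarrow> 'a \<Rightarrow> 'a \<Rightarrow> 'a \<Rightarrow> real" where
  "box_coord a b i x = (2 * (x \<bullet> i) - (a \<bullet> i + b \<bullet> i)) / (b \<bullet> i - a \<bullet> i)"

text \<open>A smooth substitute for the indicator function of \<open>box a b\<close>, which is its limit
  for \<open>k \<longlonglongrightarrow> \<infinity>\<close> away from the boundary.\<close>

definition box_bump :: "nat \<Rightarrow> 'a::euclidean_space \<Rightarrow> 'a \<Rightarrow> 'a \<Rightarrow> complex" where
  "box_bump k a b x = of_real (exp (- (\<Sum>i\<in>Basis. ((box_coord a b i x)\<^sup>2) ^ Suc k)))"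

lemma power_Suc_ge: "0 \<le> (v::real) \<Longrightarrow> v - 1 \<le> v ^ Suc k"
proof (cases "1 \<le> v")
  case True
  then have "v ^ 1 \<le> v ^ Suc k" by (intro power_increasing) auto
  then show ?thesis by simp
next
  case False
  moreover assume "0 \<le> v"
  ultimately show ?thesis using zero_le_power[of v "Suc k"] by linarith
qed

text \<open>A Gaussian majorant independent of k, as dominated convergence requires. The dimension
  in the exponent collects the terms -1 of \<open>power_Suc_ge\<close>, one per coordinate.\<close>

lemma box_bump_le:
  fixes x :: "'a::euclidean_space"
  shows "norm (box_bump k a b x) \<le> exp (real DIM('a) - (\<Sum>i\<in>Basis. (box_coord a b i x)\<^sup>2))"
proof -
  have "(\<Sum>i\<in>(Basis::'a set). (box_coord a b i x)\<^sup>2 - 1) \<le> (\<Sum>i\<in>Basis. ((box_coord a b i x)\<^sup>2) ^ Suc k)"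
    by (intro sum_mono power_Suc_ge) auto
  then show ?thesis
    by (simp add: box_bump_def sum_subtractf del: power_Suc)
qed

text \<open>With s the sum of the squares, 1 + norm x is at most A (1 + s), and (1 + s)^N is at most
  N! exp (1 + s) by a single term of the exponential series; the factor exp (- s) cancels this
  growth.\<close>

lemma box_coord_decay:
  fixes a b :: "'a::euclidean_space"
  assumes ab: "\<And>i. i \<in> Basis \<Longrightarrow> a \<bullet> i < b \<bullet> i"
  shows "\<exists>C. \<forall>x. (1 + norm x) ^ N * exp (real DIM('a) - (\<Sum>i\<in>Basis. (box_coord a b i x)\<^sup>2)) \<le> C"
proof -
  define B where "B = 1 + (\<Sum>i\<in>(Basis::'a set). \<bar>a \<bullet> i\<bar> + \<bar>b \<bullet> i\<bar>)"
  have B: "1 \<le> B" unfolding B_def by (auto intro!: sum_nonneg)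
  have nb: "norm x \<le> B * (1 + (\<Sum>i\<in>Basis. (box_coord a b i x)\<^sup>2)) * real DIM('a)" for x :: 'a
  proof -
    have "\<bar>x \<bullet> i\<bar> \<le> B * (1 + (\<Sum>i\<in>Basis. (box_coord a b i x)\<^sup>2))" if i: "i \<in> Basis" for i
    proof -
      let ?t = "box_coord a b i x"
      have "x \<bullet> i = (a \<bullet> i + b \<bullet> i) / 2 + ?t * ((b \<bullet> i - a \<bullet> i) / 2)"
        using ab[OF i] unfolding box_coord_def by (simp add: field_simps)
      then have "\<bar>x \<bullet> i\<bar> \<le> \<bar>(a \<bullet> i + b \<bullet> i) / 2\<bar> + \<bar>?t\<bar> * \<bar>(b \<bullet> i - a \<bullet> i) / 2\<bar>"
        by (metis abs_triangle_ineq abs_mult)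
      also have "\<dots> \<le> (\<bar>a \<bullet> i\<bar> + \<bar>b \<bullet> i\<bar>) / 2 + \<bar>?t\<bar> * ((\<bar>a \<bullet> i\<bar> + \<bar>b \<bullet> i\<bar>) / 2)"
        by (intro add_mono mult_left_mono) auto
      also have "\<dots> = ((\<bar>a \<bullet> i\<bar> + \<bar>b \<bullet> i\<bar>) / 2) * (1 + \<bar>?t\<bar>)"
        by (simp only: distrib_left mult_1_right mult.commute[of "\<bar>?t\<bar>"])
      also have "\<dots> \<le> (\<bar>a \<bullet> i\<bar> + \<bar>b \<bullet> i\<bar>) * (1 + ?t\<^sup>2)"
      proof -
        have "0 \<le> (1 - \<bar>?t\<bar>)\<^sup>2" by simp
        then have "2 * \<bar>?t\<bar> \<le> 1 + ?t\<^sup>2" by (simp add: power2_diff)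
        then have "1 + \<bar>?t\<bar> \<le> 2 * (1 + ?t\<^sup>2)" using zero_le_power2[of ?t] by argo
        then have "((\<bar>a \<bullet> i\<bar> + \<bar>b \<bullet> i\<bar>) / 2) * (1 + \<bar>?t\<bar>) \<le> ((\<bar>a \<bullet> i\<bar> + \<bar>b \<bullet> i\<bar>) / 2) * (2 * (1 + ?t\<^sup>2))"
          by (intro mult_left_mono) auto
        also have "((\<bar>a \<bullet> i\<bar> + \<bar>b \<bullet> i\<bar>) / 2) * (2 * (1 + ?t\<^sup>2)) = (\<bar>a \<bullet> i\<bar> + \<bar>b \<bullet> i\<bar>) * (1 + ?t\<^sup>2)"
          by simp
        finally show ?thesis .
      qed
      also have "\<dots> \<le> B * (1 + (\<Sum>i\<in>Basis. (box_coord a b i x)\<^sup>2))"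
      proof (intro mult_mono)
        have "\<bar>a \<bullet> i\<bar> + \<bar>b \<bullet> i\<bar> \<le> (\<Sum>i\<in>(Basis::'a set). \<bar>a \<bullet> i\<bar> + \<bar>b \<bullet> i\<bar>)"
          by (rule member_le_sum[OF i]) auto
        then show "\<bar>a \<bullet> i\<bar> + \<bar>b \<bullet> i\<bar> \<le> B" by (simp add: B_def)
        have "?t\<^sup>2 \<le> (\<Sum>i\<in>Basis. (box_coord a b i x)\<^sup>2)"
          by (rule member_le_sum[OF i]) auto
        then show "1 + ?t\<^sup>2 \<le> 1 + (\<Sum>i\<in>Basis. (box_coord a b i x)\<^sup>2)" by simp
      qed (use B in auto)
      finally show ?thesis .
    qed
    then have "(\<Sum>i\<in>Basis. \<bar>x \<bullet> i\<bar>) \<le> (\<Sum>i\<in>(Basis::'a set). B * (1 + (\<Sum>i\<in>Basis. (box_coord a b i x)\<^sup>2)))"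
      by (intro sum_mono)
    with norm_le_l1[of x] show ?thesis by (simp add: mult_ac)
  qed
  define A where "A = 1 + B * real DIM('a)"
  have A: "1 \<le> A" using B by (simp add: A_def)
  have "(1 + norm x) ^ N * exp (real DIM('a) - (\<Sum>i\<in>Basis. (box_coord a b i x)\<^sup>2)) \<le> A ^ N * fact N * exp (1 + real DIM('a))" for x
  proof -
    define s where "s = (\<Sum>i\<in>Basis. (box_coord a b i x)\<^sup>2)"
    have s: "0 \<le> s" unfolding s_def by (auto intro!: sum_nonneg)
    have "1 + norm x \<le> A * (1 + s)"
      using nb[of x] s by (simp add: A_def s_def[symmetric] algebra_simps)
    then have "(1 + norm x) ^ N \<le> (A * (1 + s)) ^ N" by (intro power_mono) auto
    also have "\<dots> = A ^ N * (1 + s) ^ N" by (rule power_mult_distrib)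
    also have "(1 + s) ^ N \<le> fact N * exp (1 + s)"
    proof -
      have "(1 + s) ^ N /\<^sub>R fact N \<le> exp (1 + s)"
      proof (cases "N = 0")
        case False
        have "summable (\<lambda>n. (1 + s) ^ n /\<^sub>R fact n)" by (rule summable_exp_generic)
        from sum_le_suminf[OF this, of "{N}"] s show ?thesis
          unfolding exp_def by simp
      qed (use s in \<open>simp add: exp_def[symmetric]\<close>)
      then show ?thesis by (simp add: field_simps)
    qed
    finally have "(1 + norm x) ^ N \<le> A ^ N * (fact N * exp (1 + s))" using A by (simp add: mult_left_mono)
    then have "(1 + norm x) ^ N * exp (real DIM('a) - s) \<le> A ^ N * (fact N * exp (1 + s)) * exp (real DIM('a) - s)"
      by (intro mult_right_mono) auto
    also have "\<dots> = A ^ N * fact N * (exp (1 + s) * exp (real DIM('a) - s))" by (simp only: mult_ac)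
    also have "exp (1 + s) * exp (real DIM('a) - s) = exp (1 + real DIM('a))" by (simp add: exp_add[symmetric])
    finally show ?thesis unfolding s_def .
  qed
  then show ?thesis by blast
qed

lemma schwartz_box_bump:
  fixes a b :: "real^'n"
  assumes ab: "\<And>i. i \<in> Basis \<Longrightarrow> a \<bullet> i < b \<bullet> i"
  shows "schwartz (box_bump k a b)"
proof -
  have "schwartz (\<lambda>x. complex_of_real (1 * exp (- (\<Sum>i\<in>Basis. ((box_coord a b i x)\<^sup>2) ^ Suc k))))"
  proof (rule schwartz_poly_exp)
    have "real_polynomial_function (box_coord a b i)" for i
    proof -
      have "real_polynomial_function (\<lambda>x. (2 / (b \<bullet> i - a \<bullet> i)) * (x \<bullet> i) + (- (a \<bullet> i + b \<bullet> i) / (b \<bullet> i - a \<bullet> i)))"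
        by (intro real_polynomial_function.intros bounded_linear_inner_left)
      also have "(\<lambda>x. (2 / (b \<bullet> i - a \<bullet> i)) * (x \<bullet> i) + (- (a \<bullet> i + b \<bullet> i) / (b \<bullet> i - a \<bullet> i))) = box_coord a b i"
        by (auto simp: box_coord_def diff_divide_distrib add_divide_distrib)
      finally show ?thesis .
    qed
    then show "real_polynomial_function (\<lambda>x. \<Sum>i\<in>Basis. ((box_coord a b i x)\<^sup>2) ^ Suc k)"
      by (intro real_polynomial_function_sum real_polynomial_function_pow)
    fix N
    obtain C where C: "\<And>x. (1 + norm x) ^ N * exp (real CARD('n) - (\<Sum>i\<in>Basis. (box_coord a b i x)\<^sup>2)) \<le> C"
      using box_coord_decay[OF ab, of N] by auto
    have "(1 + norm x) ^ N * exp (- (\<Sum>i\<in>Basis. ((box_coord a b i x)\<^sup>2) ^ Suc k)) \<le> C" for x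
    proof -
      have "(1 + norm x) ^ N * exp (- (\<Sum>i\<in>Basis. ((box_coord a b i x)\<^sup>2) ^ Suc k))
          \<le> (1 + norm x) ^ N * exp (real CARD('n) - (\<Sum>i\<in>Basis. (box_coord a b i x)\<^sup>2))"
        using box_bump_le[of k a b x] by (intro mult_left_mono) (auto simp: box_bump_def simp del: power_Suc)
      then show ?thesis using C[of x] by linarith
    qed
    then show "\<exists>C. \<forall>x. (1 + norm x) ^ N * exp (- (\<Sum>i\<in>Basis. ((box_coord a b i x)\<^sup>2) ^ Suc k)) \<le> C" by blast
  qed auto
  then show ?thesis unfolding box_bump_def[abs_def] by simp
qed

section \<open>A countable dense set of Schwartz functions\<close>

lemma abs_L2_add:
  "square_integrable f \<Longrightarrow> square_integrable g \<Longrightarrow> abs_L2 f + abs_L2 g = abs_L2 (\<lambda>x. f x + g x)"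
  by (simp add: plus_L2.abs_eq L2_eq_def)

lemma abs_L2_cmult:
  "square_integrable f \<Longrightarrow> scaleC_L2 c (abs_L2 f) = abs_L2 (\<lambda>x. c * f x)"
  by (simp add: scaleC_L2.abs_eq L2_eq_def)

lemma abs_L2_zero: "abs_L2 (\<lambda>_. 0) = 0"
  by (simp add: zero_L2_def)

lemma norm_scaleC_L2: "norm (scaleC_L2 c f) = norm c * norm f"
proof -
  obtain g where g: "square_integrable g" "f = abs_L2 g" by (rule L2_cases)
  show ?thesis
    unfolding g(2) abs_L2_cmult[OF g(1)] norm_abs_L2[OF g(1)] norm_abs_L2[OF square_integrable_cmult[OF g(1)]]
    by (simp add: norm_mult power_mult_distrib real_sqrt_mult)
qed

lemma scaleC_L2_diff: "scaleC_L2 c (f - g) = scaleC_L2 c f - scaleC_L2 c g"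
  by transfer (auto simp: L2_eq_def right_diff_distrib intro!: square_integrable_cmult square_integrable_diff)

lemma tendsto_scaleC_L2:
  assumes "(f \<longlongrightarrow> l) F"
  shows "((\<lambda>x. scaleC_L2 c (f x)) \<longlongrightarrow> scaleC_L2 c l) F"
proof -
  have "((\<lambda>x. norm c * norm (f x - l)) \<longlongrightarrow> norm c * 0) F"
    using assms by (intro tendsto_intros) (simp add: tendsto_norm_zero LIM_zero)
  then have "((\<lambda>x. norm (scaleC_L2 c (f x) - scaleC_L2 c l)) \<longlongrightarrow> 0) F"
    by (simp add: scaleC_L2_diff[symmetric] norm_scaleC_L2)
  then show ?thesis by (simp add: tendsto_norm_zero_iff LIM_zero_iff)
qed

text \<open>The pointwise limit inherits the majorant w, so 4 w^2 dominates the squared differences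
  and ordinary dominated convergence applies to them.\<close>

lemma L2_dominated_convergence:
  fixes f :: "nat \<Rightarrow> 'a::euclidean_space \<Rightarrow> complex"
  assumes f: "\<And>k. f k \<in> borel_measurable borel" "g \<in> borel_measurable borel"
    and lim: "AE x in lborel. (\<lambda>k. f k x) \<longlonglongrightarrow> g x"
    and bound: "\<And>k. AE x in lborel. norm (f k x) \<le> w x"
    and w: "w \<in> borel_measurable borel" "integrable lborel (\<lambda>x. (w x)\<^sup>2)"
  shows "square_integrable (f k)" "square_integrable g"
    and "(\<lambda>k. abs_L2 (f k)) \<longlonglongrightarrow> abs_L2 g"
proof -
  note [measurable] = f w(1)
  have sq: "AE x in lborel. norm ((norm (f k x))\<^sup>2) \<le> (w x)\<^sup>2" for k
    using bound[of k] by eventually_elim (auto intro!: power_mono)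
  have fk: "square_integrable (f k)" for k
    unfolding square_integrable_def
    using Bochner_Integration.integrable_bound[OF w(2), of "\<lambda>x. (norm (f k x))\<^sup>2"] sq[of k] by simp
  then show "square_integrable (f k)" .
  have bound': "AE x in lborel. \<forall>k. norm (f k x) \<le> w x"
    using bound by (simp add: AE_all_countable)
  have gw: "AE x in lborel. norm (g x) \<le> w x"
    using lim bound'
  proof eventually_elim
    fix x assume "(\<lambda>k. f k x) \<longlonglongrightarrow> g x" "\<forall>k. norm (f k x) \<le> w x"
    then show "norm (g x) \<le> w x" by (intro LIMSEQ_le_const2[OF tendsto_norm]) auto
  qed
  have g2: "AE x in lborel. norm ((norm (g x))\<^sup>2) \<le> (w x)\<^sup>2"
    using gw by eventually_elim (auto intro!: power_mono)
  then show g: "square_integrable g"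
    unfolding square_integrable_def
    using Bochner_Integration.integrable_bound[OF w(2), of "\<lambda>x. (norm (g x))\<^sup>2"] by simp
  have "(\<lambda>k. \<integral>x. (norm (f k x - g x))\<^sup>2 \<partial>lborel) \<longlonglongrightarrow> (\<integral>x. 0 \<partial>(lborel :: 'a measure))"
  proof (rule integral_dominated_convergence[where w = "\<lambda>x. 4 * (w x)\<^sup>2"])
    show "AE x in lborel. (\<lambda>k. (norm (f k x - g x))\<^sup>2) \<longlonglongrightarrow> 0"
      using lim
    proof eventually_elim
      fix x assume "(\<lambda>k. f k x) \<longlonglongrightarrow> g x"
      then have "(\<lambda>k. (norm (f k x - g x))\<^sup>2) \<longlonglongrightarrow> (norm (g x - g x))\<^sup>2" by (intro tendsto_intros)
      then show "(\<lambda>k. (norm (f k x - g x))\<^sup>2) \<longlonglongrightarrow> 0" by simp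
    qed
    show "AE x in lborel. norm ((norm (f k x - g x))\<^sup>2) \<le> 4 * (w x)\<^sup>2" for k
      using bound[of k] gw
    proof eventually_elim
      fix x assume *: "norm (f k x) \<le> w x" "norm (g x) \<le> w x"
      have "norm (f k x - g x) \<le> 2 * w x" using * norm_triangle_ineq4[of "f k x" "g x"] by linarith
      then have "(norm (f k x - g x))\<^sup>2 \<le> (2 * w x)\<^sup>2" by (intro power_mono) auto
      then show "norm ((norm (f k x - g x))\<^sup>2) \<le> 4 * (w x)\<^sup>2" by (simp add: power_mult_distrib)
    qed
  qed (use w in auto)
  then have "(\<lambda>k. sqrt (\<integral>x. (norm (f k x - g x))\<^sup>2 \<partial>lborel)) \<longlonglongrightarrow> sqrt 0"
    by (intro tendsto_real_sqrt) simp
  moreover have "sqrt (\<integral>x. (norm (f k x - g x))\<^sup>2 \<partial>lborel) = norm (abs_L2 (f k) - abs_L2 g)" for k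
    unfolding abs_L2_diff[OF fk g] norm_abs_L2[OF square_integrable_diff[OF fk g]] ..
  ultimately show "(\<lambda>k. abs_L2 (f k)) \<longlonglongrightarrow> abs_L2 g"
    by (simp add: tendsto_norm_zero_iff LIM_zero_iff)
qed

text \<open>Inside the box all coordinates have modulus below 1 and their powers vanish; outside the
  closed box one of them exceeds 1 and its powers diverge. On the boundary a coordinate of modulus 1
  contributes the constant 1 to the exponent, so these points are left out.\<close>

lemma box_bump_tendsto_indicator:
  fixes a b :: "'a::euclidean_space"
  assumes ab: "\<And>i. i \<in> Basis \<Longrightarrow> a \<bullet> i < b \<bullet> i"
    and x: "x \<in> box a b \<or> x \<notin> cbox a b"
  shows "(\<lambda>k. box_bump k a b x) \<longlonglongrightarrow> indicator (box a b) x"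
proof -
  have t: "(box_coord a b i x)\<^sup>2 < 1 \<longleftrightarrow> a \<bullet> i < x \<bullet> i \<and> x \<bullet> i < b \<bullet> i"
    "(box_coord a b i x)\<^sup>2 \<le> 1 \<longleftrightarrow> a \<bullet> i \<le> x \<bullet> i \<and> x \<bullet> i \<le> b \<bullet> i" if "i \<in> Basis" for i
    using ab[OF that] unfolding abs_square_less_1 abs_square_le_1 box_coord_def
    by (auto simp: abs_less_iff abs_le_iff divide_less_eq le_divide_eq minus_divide_left field_simps)
  consider "x \<in> box a b" | "x \<notin> cbox a b" using x by blast
  then show ?thesis
  proof cases
    case 1
    then have "(\<lambda>k. ((box_coord a b i x)\<^sup>2) ^ Suc k) \<longlonglongrightarrow> 0" if "i \<in> Basis" for i
      using t(1)[OF that] that by (intro LIMSEQ_Suc LIMSEQ_realpow_zero) (auto simp: mem_box)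
    then have "(\<lambda>k. \<Sum>i\<in>Basis. ((box_coord a b i x)\<^sup>2) ^ Suc k) \<longlonglongrightarrow> (\<Sum>i\<in>(Basis::'a set). 0)"
      by (intro tendsto_sum)
    then have "(\<lambda>k. complex_of_real (exp (- (\<Sum>i\<in>Basis. ((box_coord a b i x)\<^sup>2) ^ Suc k)))) \<longlonglongrightarrow> complex_of_real (exp (- (\<Sum>i\<in>(Basis::'a set). 0)))"
      by (intro tendsto_of_real tendsto_exp tendsto_minus)
    then show ?thesis using 1 by (simp add: box_bump_def)
  next
    case 2
    then obtain i where i: "i \<in> Basis" "\<not> (a \<bullet> i \<le> x \<bullet> i \<and> x \<bullet> i \<le> b \<bullet> i)" by (auto simp: mem_box)
    then have t1: "1 < (box_coord a b i x)\<^sup>2" using t(2)[OF i(1)] by auto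
    have "filterlim (\<lambda>k. ((box_coord a b i x)\<^sup>2) ^ Suc k) at_top sequentially"
      using filterlim_realpow_sequentially_gt1[of "(box_coord a b i x)\<^sup>2"] t1
      by (subst filterlim_sequentially_Suc) (intro filterlim_at_infinity_imp_filterlim_at_top always_eventually allI zero_less_power[of "(box_coord a b i x)\<^sup>2"], auto)
    then have "filterlim (\<lambda>k. \<Sum>i\<in>Basis. ((box_coord a b i x)\<^sup>2) ^ Suc k) at_top sequentially"
      by (rule filterlim_at_top_mono) (auto intro!: always_eventually member_le_sum[OF i(1), of "\<lambda>i. ((box_coord a b i x)\<^sup>2) ^ Suc _"] simp del: power_Suc)
    then have "(\<lambda>k. exp (- (\<Sum>i\<in>Basis. ((box_coord a b i x)\<^sup>2) ^ Suc k))) \<longlonglongrightarrow> 0"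
      by (intro filterlim_compose[OF exp_at_bot] filterlim_uminus_at_bot[THEN iffD1]) (simp add: filterlim_uminus_at_bot)
    then have "(\<lambda>k. complex_of_real (exp (- (\<Sum>i\<in>Basis. ((box_coord a b i x)\<^sup>2) ^ Suc k)))) \<longlonglongrightarrow> complex_of_real 0"
      by (rule tendsto_of_real)
    moreover have "x \<notin> box a b" using 2 box_subset_cbox by blast
    ultimately show ?thesis by (simp add: box_bump_def)
  qed
qed

text \<open>By \<open>box_coord_decay\<close> the majorant is at most C times
  \<open>poisson_prod\<close>, which is square-integrable because it is integrable and at most 1.
  The boundary of the box is a null set.\<close>

lemma box_bump_dominated:
  fixes a b :: "real^'n"
  assumes ab: "\<And>i. i \<in> Basis \<Longrightarrow> a \<bullet> i < b \<bullet> i"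
  shows "square_integrable (indicator (box a b) :: real^'n \<Rightarrow> complex)"
    and "(\<lambda>k. abs_L2 (box_bump k a b)) \<longlonglongrightarrow> abs_L2 (indicator (box a b))"
proof -
  obtain C where C: "\<And>x. (1 + norm x) ^ (2 * CARD('n)) * exp (real CARD('n) - (\<Sum>i\<in>Basis. (box_coord a b i x)\<^sup>2)) \<le> C"
    using box_coord_decay[OF ab, of "2 * CARD('n)"] by auto
  have C0: "0 \<le> C" using C[of 0] order_trans[rotated, OF C[of 0]] by auto
  have bnd: "norm (box_bump k a b x) \<le> C * poisson_prod x" for k x
  proof -
    let ?e = "exp (real CARD('n) - (\<Sum>i\<in>Basis. (box_coord a b i x)\<^sup>2))"
    have "norm (box_bump k a b x) \<le> ?e" using box_bump_le[of k a b x] by simp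
    also have "\<dots> \<le> ?e * ((1 + norm x) ^ (2 * CARD('n)) * poisson_prod x)"
      using poisson_prod_ge[of x] by simp
    also have "\<dots> = ((1 + norm x) ^ (2 * CARD('n)) * ?e) * poisson_prod x" by (simp only: mult_ac)
    also have "\<dots> \<le> C * poisson_prod x" by (intro mult_right_mono C) auto
    finally show ?thesis .
  qed
  have pp1: "poisson_prod x \<le> 1" for x :: "real^'n"
    unfolding poisson_prod_def poisson_kernel_def by (rule prod_le_1) (auto simp: divide_le_eq add_pos_nonneg)
  have "integrable lborel (\<lambda>x. (C * poisson_prod (x :: real^'n))\<^sup>2)"
  proof (rule Bochner_Integration.integrable_bound[OF integrable_mult_right[OF poisson_prod_integrable, of "C\<^sup>2"]])
    show "AE x::real^'n in lborel. norm ((C * poisson_prod x)\<^sup>2) \<le> norm (C\<^sup>2 * poisson_prod x)"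
    proof (rule AE_I2)
      fix x :: "real^'n"
      have "(poisson_prod x)\<^sup>2 \<le> poisson_prod x"
        unfolding power2_eq_square using pp1[of x] by (intro mult_left_le) auto
      then show "norm ((C * poisson_prod x)\<^sup>2) \<le> norm (C\<^sup>2 * poisson_prod x)"
        by (simp add: power_mult_distrib mult_left_mono)
    qed
  qed measurable
  moreover have "AE x in lborel. (\<lambda>k. box_bump k a b x) \<longlonglongrightarrow> indicator (box a b) x"
  proof -
    have "emeasure lborel (cbox a b - box a b) = 0"
      using emeasure_Diff[of lborel "box a b" "cbox a b"] box_subset_cbox[of a b]
      by (simp add: emeasure_lborel_cbox_eq emeasure_lborel_box_eq)
    then have "AE x in lborel. x \<notin> cbox a b - box a b"
      by (intro AE_not_in) (simp add: null_sets_def)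
    then show ?thesis
      by eventually_elim (intro box_bump_tendsto_indicator ab, auto)
  qed
  moreover have "box_bump k a b \<in> borel_measurable borel" for k
    by (rule schwartz_measurable[OF schwartz_box_bump[OF ab]])
  ultimately show "square_integrable (indicator (box a b) :: real^'n \<Rightarrow> complex)"
    "(\<lambda>k. abs_L2 (box_bump k a b)) \<longlonglongrightarrow> abs_L2 (indicator (box a b))"
    using L2_dominated_convergence[of "\<lambda>k. box_bump k a b" "indicator (box a b)" "\<lambda>x. C * poisson_prod x"] bnd
    by auto
qed

section \<open>Rational boxes: generating the Borel sets and spanning \<open>L2\<close>\<close>

definition rational_vectors :: "'a::euclidean_space set" where
  "rational_vectors = {a. \<forall>i\<in>Basis. a \<bullet> i \<in> \<rat>}"

lemma countable_rational_vectors: "countable (rational_vectors :: 'a::euclidean_space set)"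
proof -
  have "rational_vectors \<subseteq> (\<lambda>f. \<Sum>i\<in>Basis. f i *\<^sub>R i) ` (Basis \<rightarrow>\<^sub>E \<rat> :: ('a \<Rightarrow> real) set)"
  proof
    fix a :: 'a assume a: "a \<in> rational_vectors"
    have "a = (\<Sum>i\<in>Basis. restrict (\<lambda>i. a \<bullet> i) Basis i *\<^sub>R i)"
      by (simp add: euclidean_representation)
    moreover have "restrict (\<lambda>i. a \<bullet> i) Basis \<in> (Basis \<rightarrow>\<^sub>E \<rat>)" using a by (auto simp: rational_vectors_def)
    ultimately show "a \<in> (\<lambda>f. \<Sum>i\<in>Basis. f i *\<^sub>R i) ` (Basis \<rightarrow>\<^sub>E \<rat>)" by blast
  qed
  moreover have "countable (Basis \<rightarrow>\<^sub>E \<rat> :: ('a \<Rightarrow> real) set)"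
    by (intro countable_PiE) (auto simp: countable_rat)
  ultimately show ?thesis by (meson countable_image countable_subset)
qed

definition rational_boxes :: "'a::euclidean_space set set" where
  "rational_boxes = (\<lambda>(a, b). box a b) ` (rational_vectors \<times> rational_vectors)"

lemma borel_eq_rational_boxes: "borel = sigma UNIV (rational_boxes :: 'a::euclidean_space set set)"
proof (rule borel_eq_sigmaI1[OF borel_def, where F = id, simplified])
  fix M :: "'a set" assume M: "open M"
  have cnt: "countable (Basis \<rightarrow>\<^sub>E \<rat> \<times> \<rat> :: ('a \<Rightarrow> real \<times> real) set)"
    by (intro countable_PiE) (auto simp: countable_rat)
  have rb: "box (\<Sum>i\<in>Basis. fst (f i) *\<^sub>R i) (\<Sum>i\<in>Basis. snd (f i) *\<^sub>R i) \<in> rational_boxes"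
    if "f \<in> (Basis \<rightarrow>\<^sub>E \<rat> \<times> \<rat>)" for f :: "'a \<Rightarrow> real \<times> real"
  proof -
    have "f i \<in> \<rat> \<times> \<rat>" if "i \<in> Basis" for i using \<open>f \<in> _\<close> that by (auto simp: PiE_def Pi_def)
    then show ?thesis
      unfolding rational_boxes_def rational_vectors_def by (auto simp: mem_Times_iff intro!: image_eqI)
  qed
  show "M \<in> sigma_sets UNIV rational_boxes"
    by (subst open_UNION_box[OF M])
       (intro sigma_sets_UNION countable_image countable_subset[OF _ cnt], auto intro: rb)
qed (auto simp: rational_boxes_def)

lemma box_Int_rational:
  assumes "A \<in> rational_boxes" "B \<in> rational_boxes"
  shows "A \<inter> (B :: 'a::euclidean_space set) \<in> rational_boxes"
proof -
  obtain a b c d where *: "A = box a b" "B = box c d" "a \<in> rational_vectors" "b \<in> rational_vectors"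
      "c \<in> rational_vectors" "d \<in> rational_vectors"
    using assms by (auto simp: rational_boxes_def)
  let ?l = "\<Sum>i\<in>Basis. max (a \<bullet> i) (c \<bullet> i) *\<^sub>R i" and ?u = "\<Sum>i\<in>Basis. min (b \<bullet> i) (d \<bullet> i) *\<^sub>R i"
  have "A \<inter> B = box ?l ?u" unfolding *(1,2) by (rule box_Int_box)
  moreover have "?l \<in> rational_vectors" "?u \<in> rational_vectors"
    using *(3-) by (auto simp: rational_vectors_def max_def min_def)
  ultimately show ?thesis by (auto simp: rational_boxes_def)
qed

text \<open>A Dynkin-class argument. The functions with class in V form a set W that is closed under
  linear combinations and dominated limits. It contains the indicators of rational boxes, by
  intersection stability those of Borel sets within a cube, then simple functions cut off by a cube,
  and finally all square-integrable functions.\<close>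

lemma L2_generated_by_rational_boxes:
  fixes V :: "(real^'n) L2 set"
  assumes zero: "0 \<in> V" and add: "\<And>f g. f \<in> V \<Longrightarrow> g \<in> V \<Longrightarrow> f + g \<in> V"
    and scale: "\<And>c f. f \<in> V \<Longrightarrow> scaleC_L2 c f \<in> V"
    and cl: "closed V"
    and box: "\<And>a b. a \<in> rational_vectors \<Longrightarrow> b \<in> rational_vectors \<Longrightarrow> (\<And>i. i \<in> Basis \<Longrightarrow> a \<bullet> i < b \<bullet> i)
      \<Longrightarrow> abs_L2 (indicator (box a b)) \<in> V"
  shows "f \<in> V"
proof -
  define W where "W = {h. square_integrable h \<and> abs_L2 h \<in> V}"
  have W_zero: "(\<lambda>_. 0) \<in> W" using zero by (simp add: W_def square_integrable_zero abs_L2_zero)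
  have W_add: "(\<lambda>x. h x + k x) \<in> W" if "h \<in> W" "k \<in> W" for h k
    using that add by (auto simp: W_def square_integrable_add abs_L2_add[symmetric])
  have W_scale: "(\<lambda>x. c * h x) \<in> W" if "h \<in> W" for h c
    using that scale by (auto simp: W_def square_integrable_cmult abs_L2_cmult[symmetric])
  have W_diff: "(\<lambda>x. h x - k x) \<in> W" if "h \<in> W" "k \<in> W" for h k
    using W_add[OF that(1) W_scale[OF that(2), of "-1"]] by simp
  have W_sum: "(\<lambda>x. \<Sum>i\<in>I. h i x) \<in> W" if "\<And>i. i \<in> I \<Longrightarrow> h i \<in> W" for I :: "'z set" and h
    using that by (induction I rule: infinite_finite_induct) (auto simp: W_zero W_add)
  have W_lim: "g \<in> W" if "\<And>k. h k \<in> W" "g \<in> borel_measurable borel" "AE x in lborel. (\<lambda>k. h k x) \<longlonglongrightarrow> g x"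
      "\<And>k. AE x in lborel. norm (h k x) \<le> w x" "w \<in> borel_measurable borel" "integrable lborel (\<lambda>x. (w x)\<^sup>2)"
    for h g and w :: "real^'n \<Rightarrow> real"
  proof -
    have hm: "h k \<in> borel_measurable borel" for k using that(1)[of k] by (simp add: W_def square_integrable_def)
    note * = L2_dominated_convergence[OF hm that(2-6)]
    have "abs_L2 g \<in> V"
      by (rule closed_sequentially[OF cl _ *(3)]) (use that(1) in \<open>auto simp: W_def\<close>)
    with *(2) show ?thesis by (simp add: W_def)
  qed
  have W_box: "indicator B \<in> W" if B_rat: "B \<in> rational_boxes" for B
  proof -
    obtain a b where B: "B = box a b" "a \<in> rational_vectors" "b \<in> rational_vectors"
      using B_rat by (auto simp: rational_boxes_def)
    show ?thesis
    proof (cases "\<forall>i\<in>Basis. a \<bullet> i < b \<bullet> i")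
      case True
      then show ?thesis using B box[OF B(2,3)] box_bump_dominated(1)[of a b] by (auto simp: W_def)
    next
      case False
      then have "B = {}" using B(1) by (auto simp: box_eq_empty not_less)
      then show ?thesis using W_zero by (simp add: indicator_def[abs_def])
    qed
  qed
  \<comment> \<open>Cutting with bounded cubes keeps indicators square-integrable and supplies the
    majorant \<open>indicator (Q j)\<close> for countable disjoint unions.\<close>
  define Q where "Q j = box (- (real j *\<^sub>R One)) (real j *\<^sub>R (One :: real^'n))" for j
  have Q: "Q j \<in> rational_boxes" for j
    unfolding rational_boxes_def Q_def by (auto simp: rational_vectors_def inner_Basis)
  have ind_sq: "integrable lborel (\<lambda>x. (indicator (Q j) x :: real)\<^sup>2)" for j
  proof -
    have "(\<lambda>x. (norm (indicator (Q j) x :: complex))\<^sup>2) = (\<lambda>x. (indicator (Q j) x :: real)\<^sup>2)"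
      by (auto simp: indicator_def)
    then show ?thesis using W_box[OF Q[of j]] by (simp add: W_def square_integrable_def)
  qed
  have W_set: "indicator (A \<inter> Q j) \<in> W" if "A \<in> sets borel" for A j
  proof -
    have A: "A \<in> sigma_sets UNIV rational_boxes" using that unfolding borel_eq_rational_boxes by simp
    have IS: "Int_stable (rational_boxes :: (real^'n) set set)" by (auto simp: Int_stable_def box_Int_rational)
    have sub: "rational_boxes \<subseteq> Pow (UNIV :: (real^'n) set)" by auto
    have borel: "B \<in> sets borel" if "B \<in> sigma_sets UNIV rational_boxes" for B :: "(real^'n) set"
      using that unfolding borel_eq_rational_boxes by simp
    show ?thesis
      using IS sub A
    proof (induction rule: sigma_sets_induct_disjoint)
      case (basic A)
      then show ?case by (intro W_box box_Int_rational Q)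
    next
      case empty
      show ?case using W_zero by simp
    next
      case (compl A)
      have "(\<lambda>x. indicator (Q j) x - indicator (A \<inter> Q j) x :: complex) \<in> W"
        by (rule W_diff[OF W_box[OF Q] compl(2)])
      also have "(\<lambda>x. indicator (Q j) x - indicator (A \<inter> Q j) x :: complex) = indicator ((UNIV - A) \<inter> Q j)"
        by (auto simp: indicator_def)
      finally show ?case .
    next
      case (union A)
      have Am: "A i \<in> sets borel" for i using union(2) by (intro borel) auto
      show ?case
      proof (rule W_lim[of "\<lambda>k x. \<Sum>i<k. indicator (A i \<inter> Q j) x" _ "indicator (Q j)"])
        show "(\<lambda>x. \<Sum>i<k. indicator (A i \<inter> Q j) x) \<in> W" for k by (intro W_sum union)
        have disj: "disjoint_family (\<lambda>i. A i \<inter> Q j)" using union(1) by (auto simp: disjoint_family_on_def)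
        have sums: "(\<lambda>i. indicator (A i \<inter> Q j) x) sums (indicator ((\<Union>i. A i) \<inter> Q j) x :: complex)" for x
        proof (cases "\<exists>i. x \<in> A i \<inter> Q j")
          case True
          then obtain i where i: "x \<in> A i \<inter> Q j" by blast
          have "x \<notin> A k \<inter> Q j" if "k \<noteq> i" for k
            using disjoint_family_onD[OF disj, of i k] i that by auto
          then have "(\<lambda>k. indicator (A k \<inter> Q j) x) = (\<lambda>k. if k = i then 1 else 0 :: complex)"
            using i by (auto simp: indicator_def)
          then show ?thesis using i sums_single[of i "\<lambda>_. 1::complex"] by (auto simp: indicator_def)
        next
          case False
          then have "(\<lambda>k. indicator (A k \<inter> Q j) x) = (\<lambda>k. 0 :: complex)" "indicator ((\<Union>i. A i) \<inter> Q j) x = (0 :: complex)"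
            by (auto simp: indicator_def)
          then show ?thesis by simp
        qed
        then show "AE x in lborel. (\<lambda>k. \<Sum>i<k. indicator (A i \<inter> Q j) x) \<longlonglongrightarrow> (indicator ((\<Union>i. A i) \<inter> Q j) x :: complex)"
          by (auto simp: sums_def)
        show "AE x in lborel. norm (\<Sum>i<k. indicator (A i \<inter> Q j) x :: complex) \<le> indicator (Q j) x" for k
        proof (rule AE_I2)
          fix x
          have "(\<Sum>i<k. indicator (A i \<inter> Q j) x :: complex) = of_real (\<Sum>i<k. indicator (A i \<inter> Q j) x)"
            unfolding of_real_sum by (intro sum.cong) (auto simp: indicator_def)
          also have "(\<Sum>i<k. indicator (A i \<inter> Q j) x :: real) = indicator (\<Union>i<k. A i \<inter> Q j) x"
            using disj by (intro indicator_UN_disjoint[symmetric]) (auto simp: disjoint_family_on_def)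
          finally show "norm (\<Sum>i<k. indicator (A i \<inter> Q j) x :: complex) \<le> indicator (Q j) x"
            by (auto simp: indicator_def)
        qed
        show "indicator ((\<Union>i. A i) \<inter> Q j) \<in> borel_measurable borel" using Am by (auto simp: Q_def)
        show "(indicator (Q j) :: real^'n \<Rightarrow> real) \<in> borel_measurable borel" by (auto simp: Q_def)
      qed (rule ind_sq)
    qed
  qed
  obtain g where g: "square_integrable g" "f = abs_L2 g" by (rule L2_cases)
  have [measurable]: "g \<in> borel_measurable borel" using g(1) by (simp add: square_integrable_def)
  obtain s where s: "\<And>i. simple_function borel (s i)" "\<And>x. (\<lambda>i. s i x) \<longlonglongrightarrow> g x" "\<And>i x. norm (s i x) \<le> 2 * norm (g x)"
    using borel_measurable_implies_sequence_metric[of g borel 0] by (auto simp: dist_norm)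
  have "g \<in> W"
  proof (rule W_lim[of "\<lambda>j x. s j x * indicator (Q j) x" _ "\<lambda>x. 2 * norm (g x)"])
    fix j
    have "(\<lambda>x. \<Sum>y\<in>range (s j). y * indicator (s j -` {y} \<inter> Q j) x) \<in> W"
      using simple_functionD[OF s(1)[of j]] by (intro W_sum W_scale W_set) auto
    also have "(\<lambda>x. \<Sum>y\<in>range (s j). y * indicator (s j -` {y} \<inter> Q j) x) = (\<lambda>x. s j x * indicator (Q j) x)"
    proof
      fix x
      have fin: "finite (range (s j))" using simple_functionD(1)[OF s(1)[of j]] by simp
      have "(\<Sum>y\<in>range (s j). y * indicator (s j -` {y} \<inter> Q j) x) = (\<Sum>y\<in>range (s j). if y = s j x then y * indicator (Q j) x else 0)"
        by (intro sum.cong) (auto simp: indicator_def)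
      also have "\<dots> = s j x * indicator (Q j) x" using fin by (simp add: sum.delta)
      finally show "(\<Sum>y\<in>range (s j). y * indicator (s j -` {y} \<inter> Q j) x) = s j x * indicator (Q j) x" .
    qed
    finally show "(\<lambda>x. s j x * indicator (Q j) x) \<in> W" .
    show "AE x in lborel. norm (s j x * indicator (Q j) x) \<le> 2 * norm (g x)"
      using s(3)[of j] by (auto simp: indicator_def)
  next
    show "AE x in lborel. (\<lambda>j. s j x * indicator (Q j) x) \<longlonglongrightarrow> g x"
    proof (rule AE_I2)
      fix x
      have "eventually (\<lambda>j. x \<in> Q j) sequentially"
      proof -
        obtain m :: nat where m: "norm x < real m" using reals_Archimedean2 by blast
        have "x \<in> Q j" if "m \<le> j" for j
        proof -
          have "\<bar>x \<bullet> i\<bar> < real j" if "i \<in> Basis" for i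
            using Basis_le_norm[OF that, of x] m \<open>m \<le> j\<close> by linarith
          then show ?thesis by (auto simp: Q_def mem_box abs_less_iff minus_less_iff)
        qed
        then show ?thesis by (auto simp: eventually_sequentially)
      qed
      then have "eventually (\<lambda>j. s j x = s j x * indicator (Q j) x) sequentially"
        by eventually_elim simp
      from s(2)[of x] this show "(\<lambda>j. s j x * indicator (Q j) x) \<longlonglongrightarrow> g x"
        by (rule Lim_transform_eventually)
    qed
    show "integrable lborel (\<lambda>x. (2 * norm (g x))\<^sup>2)"
      using g(1) by (simp add: square_integrable_def power_mult_distrib)
  qed measurable
  then show ?thesis using g(2) by (simp add: W_def)
qed

text \<open>Finite combinations of bumps over rational boxes, with every exponent k and with
  coefficients from a countable dense set. The bumps tend to indicators as k grows, so the closure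
  is a closed subspace that contains the indicators of the nondegenerate rational boxes.\<close>

lemma countable_dense_schwartz:
  obtains D :: "(real^'n \<Rightarrow> complex) set"
  where "countable D" "\<And>\<phi>. \<phi> \<in> D \<Longrightarrow> schwartz \<phi>" "closure (abs_L2 ` D) = (UNIV :: (real^'n) L2 set)"
proof -
  obtain Z :: "complex set" where Z: "countable Z" "\<And>X. open X \<Longrightarrow> X \<noteq> {} \<Longrightarrow> \<exists>d\<in>Z. d \<in> X"
    by (rule countable_dense_setE) blast
  define I where "I = {(k, a, b). (k :: nat, a :: real^'n, b) \<in> UNIV \<times> rational_vectors \<times> rational_vectors \<and> (\<forall>i\<in>Basis. a \<bullet> i < b \<bullet> i)}"
  have I: "countable I"
    by (rule countable_subset[of _ "UNIV \<times> rational_vectors \<times> rational_vectors"])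
       (auto simp: I_def countable_rational_vectors)
  define comb where "comb ps x = (\<Sum>(c, k, a, b)\<leftarrow>ps. c * box_bump k a b x)"
    for ps :: "(complex \<times> nat \<times> (real^'n) \<times> (real^'n)) list" and x
  define D where "D = comb ` lists (Z \<times> I)"
  have sch: "schwartz (box_bump k a b)" if "(k, a, b) \<in> I" for k a b
    using that by (intro schwartz_box_bump) (auto simp: I_def)
  have zero_sch: "schwartz (\<lambda>x::real^'n. 0)"
    using schwartz_cmult[OF schwartz_box_bump[of 0 "One::real^'n" 0], of 0] by simp
  have comb_Cons: "comb ((c, k, a, b) # ps) = (\<lambda>x. c * box_bump k a b x + comb ps x)" for c k a b ps
    by (auto simp: comb_def)
  have comb_Nil: "comb [] = (\<lambda>_. 0)" by (auto simp: comb_def)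
  have D_sch: "schwartz (comb ps)" if "ps \<in> lists (Z \<times> I)" for ps
    using that
  proof induction
    case Nil show ?case using zero_sch by (simp add: comb_Nil)
  next
    case (Cons p ps)
    obtain c k a b where p: "p = (c, k, a, b)" by (cases p) auto
    show ?case unfolding p comb_Cons
      by (intro schwartz_add schwartz_cmult sch Cons.IH) (use Cons.hyps p in auto)
  qed
  note si = schwartz_square_integrable
  let ?V = "closure (abs_L2 ` D)"
  have add: "f + g \<in> ?V" if fg: "f \<in> ?V" "g \<in> ?V" for f g
  proof -
    obtain F G where FG: "\<And>n. F n \<in> abs_L2 ` D" "F \<longlonglongrightarrow> f" "\<And>n. G n \<in> abs_L2 ` D" "G \<longlonglongrightarrow> g"
      using fg unfolding closure_sequential by blast
    have "F n + G n \<in> abs_L2 ` D" for n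
    proof -
      obtain ps qs where *: "ps \<in> lists (Z \<times> I)" "F n = abs_L2 (comb ps)" "qs \<in> lists (Z \<times> I)" "G n = abs_L2 (comb qs)"
        using FG(1)[of n] FG(3)[of n] by (auto simp: D_def)
      have "F n + G n = abs_L2 (comb (ps @ qs))"
        unfolding *(2,4) abs_L2_add[OF si[OF D_sch[OF *(1)]] si[OF D_sch[OF *(3)]]]
        by (rule arg_cong[of _ _ abs_L2]) (auto simp: comb_def)
      moreover have "ps @ qs \<in> lists (Z \<times> I)" using * by auto
      ultimately show ?thesis by (auto simp: D_def)
    qed
    moreover have "(\<lambda>n. F n + G n) \<longlonglongrightarrow> f + g" by (intro tendsto_add FG)
    ultimately show ?thesis unfolding closure_sequential by (intro exI[of _ "\<lambda>n. F n + G n"]) auto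
  qed
  \<comment> \<open>Z is merely dense, so the combinations need not be stable under scalars. Scaling
    is shown for a single bump by approximating the factor, then for combinations, then for
    limits.\<close>
  have single: "scaleC_L2 c (abs_L2 (box_bump k a b)) \<in> ?V" if "(k, a, b) \<in> I" for c k a b
  proof -
    have "\<exists>z\<in>Z. dist z c < 1 / real (Suc n)" for n
      using Z(2)[of "ball c (1 / real (Suc n))"] by (auto simp: dist_commute)
    then obtain z where z: "\<And>n. z n \<in> Z" "\<And>n. dist (z n) c < 1 / real (Suc n)" by metis
    have lim0: "(\<lambda>n. norm (z n - c)) \<longlonglongrightarrow> 0"
      by (rule tendsto_sandwich[OF _ _ tendsto_const LIMSEQ_Suc[OF lim_1_over_n]])
         (use z(2) in \<open>auto intro!: always_eventually less_imp_le simp: dist_norm\<close>)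
    have "(\<lambda>n. scaleC_L2 (z n) (abs_L2 (box_bump k a b))) \<longlonglongrightarrow> scaleC_L2 c (abs_L2 (box_bump k a b))"
    proof (rule LIM_zero_cancel, rule tendsto_norm_zero_cancel)
      have "scaleC_L2 (z n) (abs_L2 (box_bump k a b)) - scaleC_L2 c (abs_L2 (box_bump k a b))
          = scaleC_L2 (z n - c) (abs_L2 (box_bump k a b))" for n
        using si[OF sch[OF that]]
        by (simp add: abs_L2_cmult abs_L2_diff square_integrable_cmult left_diff_distrib)
      then show "(\<lambda>n. norm (scaleC_L2 (z n) (abs_L2 (box_bump k a b)) - scaleC_L2 c (abs_L2 (box_bump k a b)))) \<longlonglongrightarrow> 0"
        using tendsto_mult_left_zero[OF lim0] by (simp add: norm_scaleC_L2)
    qed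
    moreover have "scaleC_L2 (z n) (abs_L2 (box_bump k a b)) \<in> abs_L2 ` D" for n
    proof -
      have "scaleC_L2 (z n) (abs_L2 (box_bump k a b)) = abs_L2 (comb [(z n, k, a, b)])"
        unfolding abs_L2_cmult[OF si[OF sch[OF that]]] comb_Cons comb_Nil by simp
      then show ?thesis using z(1) that by (auto simp: D_def)
    qed
    ultimately show ?thesis unfolding closure_sequential
      by (intro exI[of _ "\<lambda>n. scaleC_L2 (z n) (abs_L2 (box_bump k a b))"]) auto
  qed
  have zero: "0 \<in> ?V"
  proof -
    have "abs_L2 (comb []) \<in> abs_L2 ` D" by (auto simp: D_def)
    then have "abs_L2 (comb []) \<in> ?V" by (rule subsetD[OF closure_subset])
    then show ?thesis by (simp add: comb_Nil abs_L2_zero)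
  qed
  have scaleD: "scaleC_L2 c (abs_L2 (comb ps)) \<in> ?V" if "ps \<in> lists (Z \<times> I)" for c ps
    using that
  proof induction
    case Nil
    have "scaleC_L2 c (abs_L2 (\<lambda>_::real^'n. 0)) = abs_L2 (\<lambda>_. 0)"
      by (simp add: abs_L2_cmult square_integrable_zero)
    then show ?case using zero by (simp add: comb_Nil abs_L2_zero)
  next
    case (Cons p ps)
    obtain d k a b where p: "p = (d, k, a, b)" by (cases p) auto
    have kab: "(k, a, b) \<in> I" using Cons.hyps p by auto
    have ps: "ps \<in> lists (Z \<times> I)" using Cons.hyps by auto
    have "scaleC_L2 c (abs_L2 (comb (p # ps))) = scaleC_L2 (c * d) (abs_L2 (box_bump k a b)) + scaleC_L2 c (abs_L2 (comb ps))"
      using si[OF sch[OF kab]] si[OF D_sch[OF ps]]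
      unfolding p comb_Cons
      by (simp add: abs_L2_cmult abs_L2_add square_integrable_cmult square_integrable_add distrib_left mult.assoc)
    then show ?case using add[OF single[OF kab] Cons.IH] by simp
  qed
  have scale: "scaleC_L2 c f \<in> ?V" if fV: "f \<in> ?V" for c f
  proof -
    obtain F where F: "\<And>n. F n \<in> abs_L2 ` D" "F \<longlonglongrightarrow> f" using fV unfolding closure_sequential by blast
    have "scaleC_L2 c (F n) \<in> ?V" for n
    proof -
      obtain ps where "ps \<in> lists (Z \<times> I)" "F n = abs_L2 (comb ps)" using F(1)[of n] by (auto simp: D_def)
      then show ?thesis using scaleD by simp
    qed
    then show ?thesis
      by (rule closed_sequentially[OF closed_closure _ tendsto_scaleC_L2[OF F(2)]])
  qed
  have box: "abs_L2 (indicator (box a b)) \<in> ?V"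
    if "a \<in> rational_vectors" "b \<in> rational_vectors" "\<And>i. i \<in> Basis \<Longrightarrow> a \<bullet> i < b \<bullet> i" for a b
  proof (rule closed_sequentially[OF closed_closure _ box_bump_dominated(2)[OF that(3)]])
    fix k
    have "(k, a, b) \<in> I" using that by (auto simp: I_def)
    from single[OF this, of 1] show "abs_L2 (box_bump k a b) \<in> ?V"
      by (simp add: abs_L2_cmult si[OF sch[OF \<open>(k, a, b) \<in> I\<close>]])
  qed
  have "?V = UNIV"
    using L2_generated_by_rational_boxes[of ?V] zero add scale box by auto
  moreover have "countable D" unfolding D_def by (intro countable_image countable_lists countable_SIGMA Z(1) I)
  ultimately show ?thesis using that[of D] D_sch by (auto simp: D_def)
qed

section \<open>The extension to \<open>L\<^sup>2\<close>\<close>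

lemma schwartz_sequence:
  obtains \<phi> :: "nat \<Rightarrow> real^'n \<Rightarrow> complex"
  where "\<And>k. schwartz (\<phi> k)" "(\<lambda>k. abs_L2 (\<phi> k)) \<longlonglongrightarrow> f"
proof -
  obtain D :: "(real^'n \<Rightarrow> complex) set" where D: "countable D" "\<And>\<phi>. \<phi> \<in> D \<Longrightarrow> schwartz \<phi>" "closure (abs_L2 ` D) = UNIV"
    using countable_dense_schwartz by blast
  have "f \<in> closure (abs_L2 ` D)" using D(3) by simp
  then obtain X where X: "\<And>k. X k \<in> abs_L2 ` D" "X \<longlonglongrightarrow> f" unfolding closure_sequential by blast
  then have "\<forall>k. \<exists>\<phi>\<in>D. X k = abs_L2 \<phi>" by blast
  then obtain \<phi> where \<phi>: "\<And>k. \<phi> k \<in> D" "\<And>k. X k = abs_L2 (\<phi> k)" by metis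
  then have "X = (\<lambda>k. abs_L2 (\<phi> k))" by auto
  with that[of \<phi>] X(2) D(2) \<phi>(1) show ?thesis by blast
qed

lemma scaleC_L2_one: "scaleC_L2 1 f = f"
  by transfer (auto simp: L2_eq_def)

lemma scaleC_L2_minus_one: "scaleC_L2 (-1) f = - f"
  by transfer (auto simp: L2_eq_def intro: square_integrable_uminus)

context
  fixes \<sigma> :: "real^'n \<Rightarrow> real^'n \<Rightarrow> complex" and K :: real
  assumes \<sigma>: "bdd_smooth (2 * CARD('n)) K (\<lambda>(x, \<xi>). \<sigma> x \<xi>)"
begin

lemma abs_L2_pdo_lincomb:
  assumes "schwartz \<phi>" "schwartz \<psi>"
  shows "abs_L2 (pdo \<sigma> (\<lambda>x. \<phi> x - c * \<psi> x)) = abs_L2 (pdo \<sigma> \<phi>) - scaleC_L2 c (abs_L2 (pdo \<sigma> \<psi>))"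
  using pdo_schwartz_bound(1)[OF \<sigma>] assms
  by (simp add: pdo_lincomb[OF \<sigma>] abs_L2_cmult abs_L2_diff square_integrable_cmult)

lemma norm_abs_L2_pdo_diff:
  assumes "schwartz \<phi>" "schwartz \<psi>"
  shows "norm (abs_L2 (pdo \<sigma> \<phi>) - abs_L2 (pdo \<sigma> \<psi>)) \<le> pdo_const TYPE('n) * K * norm (abs_L2 \<phi> - abs_L2 \<psi>)"
  using abs_L2_pdo_lincomb[OF assms, of 1] pdo_schwartz_bound(2)[OF \<sigma> schwartz_diff[OF assms]]
    abs_L2_diff[OF assms[THEN schwartz_square_integrable]]
  by (simp add: scaleC_L2_one)

text \<open>The norm bound makes the images of an approximating sequence Cauchy, and completeness
  gives g. The same bound shows that any other sequence approximating f leads to the same g, and the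
  existence of at least one sequence excludes other values.\<close>

lemma pdo_extends_to_ex1: "\<exists>!g. pdo_extends_to \<sigma> f g"
proof -
  let ?C = "pdo_const TYPE('n) * K"
  obtain \<phi> where \<phi>: "\<And>k. schwartz (\<phi> k)" "(\<lambda>k. abs_L2 (\<phi> k)) \<longlonglongrightarrow> f" using schwartz_sequence[of f] by blast
  have "Cauchy (\<lambda>k. abs_L2 (pdo \<sigma> (\<phi> k)))"
  proof (rule metric_CauchyI)
    fix e :: real assume e: "0 < e"
    have "Cauchy (\<lambda>k. abs_L2 (\<phi> k))" using \<phi>(2) by (rule LIMSEQ_imp_Cauchy)
    then obtain m where m: "\<And>i j. i \<ge> m \<Longrightarrow> j \<ge> m \<Longrightarrow> dist (abs_L2 (\<phi> i)) (abs_L2 (\<phi> j)) < e / (\<bar>?C\<bar> + 1)"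
      using metric_CauchyD[of "\<lambda>k. abs_L2 (\<phi> k)" "e / (\<bar>?C\<bar> + 1)"] e by (auto simp: add_nonneg_pos)
    have "dist (abs_L2 (pdo \<sigma> (\<phi> i))) (abs_L2 (pdo \<sigma> (\<phi> j))) < e" if "i \<ge> m" "j \<ge> m" for i j
    proof -
      let ?d = "dist (abs_L2 (\<phi> i)) (abs_L2 (\<phi> j))"
      have "dist (abs_L2 (pdo \<sigma> (\<phi> i))) (abs_L2 (pdo \<sigma> (\<phi> j))) \<le> ?C * ?d"
        using norm_abs_L2_pdo_diff[OF \<phi>(1) \<phi>(1)] by (simp add: dist_norm)
      also have "\<dots> \<le> (\<bar>?C\<bar> + 1) * ?d" by (intro mult_right_mono) auto
      also have "\<dots> < e" using m[OF that] by (simp add: less_divide_eq mult.commute add_nonneg_pos)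
      finally show ?thesis .
    qed
    then show "\<exists>M. \<forall>i\<ge>M. \<forall>j\<ge>M. dist (abs_L2 (pdo \<sigma> (\<phi> i))) (abs_L2 (pdo \<sigma> (\<phi> j))) < e" by blast
  qed
  then obtain g where g: "(\<lambda>k. abs_L2 (pdo \<sigma> (\<phi> k))) \<longlonglongrightarrow> g"
    using Cauchy_convergent_iff convergent_def by blast
  show ?thesis
  proof (rule ex1I[of _ g])
    show "pdo_extends_to \<sigma> f g"
      unfolding pdo_extends_to_def
    proof (intro allI impI conjI; elim conjE)
      fix \<psi> :: "nat \<Rightarrow> real^'n \<Rightarrow> complex" assume \<psi>: "\<forall>k. schwartz (\<psi> k)" "(\<lambda>k. abs_L2 (\<psi> k)) \<longlonglongrightarrow> f"
      show "square_integrable (pdo \<sigma> (\<psi> k))" for k using pdo_schwartz_bound(1)[OF \<sigma>] \<psi>(1) by blast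
      have "(\<lambda>k. ?C * norm (abs_L2 (\<psi> k) - abs_L2 (\<phi> k))) \<longlonglongrightarrow> ?C * norm (f - f)"
        by (intro tendsto_intros \<psi> \<phi>)
      then have lim: "(\<lambda>k. ?C * norm (abs_L2 (\<psi> k) - abs_L2 (\<phi> k))) \<longlonglongrightarrow> 0" by simp
      have "norm (abs_L2 (pdo \<sigma> (\<psi> k)) - abs_L2 (pdo \<sigma> (\<phi> k))) \<le> ?C * norm (abs_L2 (\<psi> k) - abs_L2 (\<phi> k))" for k
        by (rule norm_abs_L2_pdo_diff[OF \<psi>(1)[rule_format] \<phi>(1)])
      then have "(\<lambda>k. abs_L2 (pdo \<sigma> (\<psi> k)) - abs_L2 (pdo \<sigma> (\<phi> k))) \<longlonglongrightarrow> 0"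
        by (intro Lim_null_comparison[OF always_eventually lim] allI)
      from tendsto_add[OF this g] show "(\<lambda>k. abs_L2 (pdo \<sigma> (\<psi> k))) \<longlonglongrightarrow> g" by simp
    qed
    fix h assume "pdo_extends_to \<sigma> f h"
    then have "(\<lambda>k. abs_L2 (pdo \<sigma> (\<phi> k))) \<longlonglongrightarrow> h" using \<phi> by (auto simp: pdo_extends_to_def)
    then show "h = g" using g LIMSEQ_unique by blast
  qed
qed

lemma pdo_L2_tendsto:
  assumes "\<And>k. schwartz (\<phi> k)" "(\<lambda>k. abs_L2 (\<phi> k)) \<longlonglongrightarrow> f"
  shows "(\<lambda>k. abs_L2 (pdo \<sigma> (\<phi> k))) \<longlonglongrightarrow> pdo_L2 \<sigma> f"
proof -
  have "pdo_extends_to \<sigma> f (pdo_L2 \<sigma> f)"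
    unfolding pdo_L2_def by (rule theI'[OF pdo_extends_to_ex1])
  then have "(\<forall>k. schwartz (\<phi> k)) \<and> (\<lambda>k. abs_L2 (\<phi> k)) \<longlonglongrightarrow> f \<longrightarrow>
      (\<forall>k. square_integrable (pdo \<sigma> (\<phi> k))) \<and> (\<lambda>k. abs_L2 (pdo \<sigma> (\<phi> k))) \<longlonglongrightarrow> pdo_L2 \<sigma> f"
    unfolding pdo_extends_to_def by (rule spec)
  with assms show ?thesis by simp
qed

text \<open>One formula yields the whole linear structure: c = 1 gives differences, c = -1 sums, and
  writing c f as f - (f - c f) gives multiples.\<close>

lemma pdo_L2_lincomb: "pdo_L2 \<sigma> (f - scaleC_L2 c g) = pdo_L2 \<sigma> f - scaleC_L2 c (pdo_L2 \<sigma> g)"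
proof -
  obtain \<phi> where \<phi>: "\<And>k. schwartz (\<phi> k)" "(\<lambda>k. abs_L2 (\<phi> k)) \<longlonglongrightarrow> f" using schwartz_sequence[of f] by blast
  obtain \<psi> where \<psi>: "\<And>k. schwartz (\<psi> k)" "(\<lambda>k. abs_L2 (\<psi> k)) \<longlonglongrightarrow> g" using schwartz_sequence[of g] by blast
  note si = \<phi>(1)[THEN schwartz_square_integrable] \<psi>(1)[THEN schwartz_square_integrable]
  have "(\<lambda>k. abs_L2 (\<phi> k) - scaleC_L2 c (abs_L2 (\<psi> k))) \<longlonglongrightarrow> f - scaleC_L2 c g"
    by (intro tendsto_diff tendsto_scaleC_L2 \<phi> \<psi>)
  then have "(\<lambda>k. abs_L2 (\<lambda>x. \<phi> k x - c * \<psi> k x)) \<longlonglongrightarrow> f - scaleC_L2 c g"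
    by (simp add: abs_L2_cmult abs_L2_diff si square_integrable_cmult)
  then have "(\<lambda>k. abs_L2 (pdo \<sigma> (\<lambda>x. \<phi> k x - c * \<psi> k x))) \<longlonglongrightarrow> pdo_L2 \<sigma> (f - scaleC_L2 c g)"
    by (intro pdo_L2_tendsto schwartz_diff schwartz_cmult \<phi> \<psi>)
  moreover have "(\<lambda>k. abs_L2 (pdo \<sigma> (\<lambda>x. \<phi> k x - c * \<psi> k x))) \<longlonglongrightarrow> pdo_L2 \<sigma> f - scaleC_L2 c (pdo_L2 \<sigma> g)"
    unfolding abs_L2_pdo_lincomb[OF \<phi>(1) \<psi>(1)]
    by (intro tendsto_diff tendsto_scaleC_L2 pdo_L2_tendsto \<phi> \<psi>)
  ultimately show ?thesis by (rule LIMSEQ_unique)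
qed

lemma pdo_L2_diff: "pdo_L2 \<sigma> (f - g) = pdo_L2 \<sigma> f - pdo_L2 \<sigma> g"
  using pdo_L2_lincomb[of f 1 g] by (simp add: scaleC_L2_one)

lemma pdo_L2_add: "pdo_L2 \<sigma> (f + g) = pdo_L2 \<sigma> f + pdo_L2 \<sigma> g"
  using pdo_L2_lincomb[of f "-1" g] by (simp add: scaleC_L2_minus_one)

lemma pdo_L2_scaleC: "pdo_L2 \<sigma> (scaleC_L2 c f) = scaleC_L2 c (pdo_L2 \<sigma> f)"
  using pdo_L2_diff[of f "f - scaleC_L2 c f"] pdo_L2_lincomb[of f c f] by simp

lemma norm_pdo_L2_le: "norm (pdo_L2 \<sigma> f) \<le> pdo_const TYPE('n) * K * norm f"
proof -
  obtain \<phi> where \<phi>: "\<And>k. schwartz (\<phi> k)" "(\<lambda>k. abs_L2 (\<phi> k)) \<longlonglongrightarrow> f" using schwartz_sequence[of f] by blast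
  have "(\<lambda>k. norm (abs_L2 (pdo \<sigma> (\<phi> k)))) \<longlonglongrightarrow> norm (pdo_L2 \<sigma> f)"
    by (intro tendsto_norm pdo_L2_tendsto \<phi>)
  moreover have "(\<lambda>k. pdo_const TYPE('n) * K * norm (abs_L2 (\<phi> k))) \<longlonglongrightarrow> pdo_const TYPE('n) * K * norm f"
    by (intro tendsto_intros \<phi>)
  ultimately show ?thesis
    by (rule LIMSEQ_le) (use pdo_schwartz_bound(2)[OF \<sigma> \<phi>(1)] in blast)
qed

end

section \<open>Measurability\<close>

text \<open>Measurability is asked for on a countable dense set only, since the null set of times at
  which a symbol fails to be adapted may depend on (x, \<xi>). The point z is replaced by the first
  point of D closer than 1 / (k + 1), and continuity gives the limit.\<close>

lemma caratheodory_measurable: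
  fixes f :: "'y \<Rightarrow> 'z::{metric_space, second_countable_topology} \<Rightarrow> 'c::metric_space"
  assumes D: "countable D" "closure D = UNIV"
    and meas: "\<And>z. z \<in> D \<Longrightarrow> (\<lambda>y. f y z) \<in> borel_measurable N"
    and cont: "\<And>y. y \<in> space N \<Longrightarrow> continuous_on UNIV (f y)"
  shows "(\<lambda>(y, z). f y z) \<in> borel_measurable (N \<Otimes>\<^sub>M borel)"
proof -
  have ne: "D \<noteq> {}" using D(2) by auto
  define d where "d = from_nat_into D"
  have d: "d i \<in> D" for i unfolding d_def by (rule from_nat_into[OF ne])
  define idx where "idx k z = (LEAST i. dist z (d i) < 1 / real (Suc k))" for k z
  have idx: "dist z (d (idx k z)) < 1 / real (Suc k)" for k z
  proof -
    obtain x where "x \<in> D" "dist x z < 1 / real (Suc k)"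
      using closure_approachable[of z D] D(2) by (auto dest!: spec[of _ "1 / real (Suc k)"])
    then have "\<exists>i. dist z (d i) < 1 / real (Suc k)"
      unfolding d_def by (metis D(1) dist_commute from_nat_into_surj)
    then show ?thesis unfolding idx_def by (rule LeastI_ex)
  qed
  have idx_meas [measurable]: "idx k \<in> borel \<rightarrow>\<^sub>M count_space UNIV" for k
    unfolding idx_def[abs_def] by measurable
  have fk: "(\<lambda>(y, z). f y (d (idx k z))) \<in> borel_measurable (N \<Otimes>\<^sub>M borel)" for k
  proof -
    have "(\<lambda>p. (\<lambda>i p. f (fst p) (d i)) (idx k (snd p)) p) \<in> borel_measurable (N \<Otimes>\<^sub>M borel)"
      by (rule measurable_compose_countable) (auto intro: measurable_compose[OF measurable_fst meas[OF d]])
    then show ?thesis by (simp add: case_prod_unfold)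
  qed
  show ?thesis
  proof (rule borel_measurable_LIMSEQ_metric[OF fk])
    fix p assume p: "p \<in> space (N \<Otimes>\<^sub>M (borel :: 'z measure))"
    obtain y z where yz: "p = (y, z)" "y \<in> space N" using p by (cases p) (auto simp: space_pair_measure)
    have "(\<lambda>k. d (idx k z)) \<longlonglongrightarrow> z"
      by (rule tendsto_dist_iff[THEN iffD2], rule tendsto_sandwich[OF _ _ tendsto_const LIMSEQ_Suc[OF lim_1_over_n]])
         (auto intro!: always_eventually less_imp_le idx simp: dist_commute simp del: of_nat_Suc)
    then have "(\<lambda>k. f y (d (idx k z))) \<longlonglongrightarrow> f y z"
      using cont[OF yz(2)] by (intro isCont_tendsto_compose[of z "f y"]) (auto simp: continuous_on_eq_continuous_at)
    then show "(\<lambda>k. case p of (y, z) \<Rightarrow> f y (d (idx k z))) \<longlonglongrightarrow> (case p of (y, z) \<Rightarrow> f y z)"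
      by (simp add: yz)
  qed
qed

text \<open>Every open set is a countable union of balls with centres in D and rational radii. For
  maps into \<open>L2\<close> this reduces measurability to distances from Schwartz functions, which
  are explicit integrals.\<close>

lemma borel_measurable_dist_dense:
  fixes f :: "'y \<Rightarrow> 'z::metric_space"
  assumes D: "countable D" "closure D = UNIV"
    and meas: "\<And>d. d \<in> D \<Longrightarrow> (\<lambda>y. dist (f y) d) \<in> borel_measurable N"
  shows "f \<in> borel_measurable N"
proof (rule borel_measurableI)
  fix S :: "'z set" assume S: "open S"
  have "f -` S \<inter> space N = (\<Union>d\<in>D. \<Union>r\<in>{r\<in>\<rat>. ball d r \<subseteq> S}. {y \<in> space N. dist (f y) d < r})" (is "?L = ?R")
  proof
    show "?L \<subseteq> ?R"
    proof
      fix y assume y: "y \<in> f -` S \<inter> space N"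
      obtain e where e: "0 < e" "ball (f y) e \<subseteq> S" using S y by (meson IntD1 openE vimageD)
      obtain r where r: "r \<in> \<rat>" "0 < r" "r < e / 2" using Rats_dense_in_real[of 0 "e / 2"] e by auto
      obtain d where d: "d \<in> D" "dist d (f y) < r" using closure_approachable[of "f y" D] D(2) r by auto
      have "ball d r \<subseteq> S"
      proof
        fix x assume "x \<in> ball d r"
        then have "dist (f y) x < e" using d(2) r dist_triangle[of "f y" x d] by (simp add: dist_commute)
        then show "x \<in> S" using e(2) by auto
      qed
      then show "y \<in> ?R" using y d r by (auto simp: dist_commute)
    qed
    show "?R \<subseteq> ?L"
    proof
      fix y assume "y \<in> ?R"
      then obtain d r where "y \<in> space N" "ball d r \<subseteq> S" "dist (f y) d < r" by blast
      then show "y \<in> ?L" by (auto simp: dist_commute subset_iff)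
    qed
  qed
  also have "\<dots> \<in> sets N"
  proof (intro sets.countable_UN'')
    show "countable {r\<in>\<rat>. ball d r \<subseteq> S}" for d by (rule countable_subset[OF _ countable_rat]) auto
    fix d r assume d: "d \<in> D"
    note [measurable] = meas[OF d]
    show "{y \<in> space N. dist (f y) d < r} \<in> sets N" by measurable
  qed (rule D)
  finally show "f -` S \<inter> space N \<in> sets N" .
qed

lemma borel_measurable_dist_const:
  fixes f :: "'y \<Rightarrow> 'z::metric_space"
  assumes "f \<in> borel_measurable N"
  shows "(\<lambda>y. dist (f y) c) \<in> borel_measurable N"
  by (rule measurable_compose[OF assms borel_measurable_continuous_onI]) (intro continuous_intros)

text \<open>The hypothesis \<open>sub\<close> expresses completeness relative to the exceptional
  set. It is available for the completed product measure and also for each \<open>F t\<close>, which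
  contains the null sets of \<open>M\<close>.\<close>

lemma borel_measurable_modify_null:
  assumes g: "g \<in> borel_measurable N" and G: "G \<in> sets N"
    and eq: "\<And>y. y \<in> G \<Longrightarrow> f y = g y" and sub: "\<And>B. B \<subseteq> space N - G \<Longrightarrow> B \<in> sets N"
  shows "f \<in> borel_measurable N"
proof (rule borel_measurableI)
  fix S :: "'b set" assume S: "open S"
  have "f -` S \<inter> space N = ((g -` S \<inter> space N) \<inter> G) \<union> (f -` S \<inter> (space N - G))"
    using eq sets.sets_into_space[OF G] by auto
  moreover have "g -` S \<inter> space N \<in> sets N" using g S by (auto intro: measurable_sets)
  ultimately show "f -` S \<inter> space N \<in> sets N" using G sub by auto
qed

text \<open>Joint measurability of the symbol in (y, x, \<xi>) passes to
  \<open>pdo (a y) \<phi> x\<close> by integration over \<xi>; the distance to a Schwartz function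
  is the root of an integral over x of a jointly measurable function.\<close>

lemma abs_L2_pdo_measurable:
  fixes a :: "'y \<Rightarrow> real^'n \<Rightarrow> real^'n \<Rightarrow> complex"
  assumes D: "countable D" "closure D = UNIV"
    and meas: "\<And>x \<xi>. (x, \<xi>) \<in> D \<Longrightarrow> (\<lambda>y. a y x \<xi>) \<in> borel_measurable N"
    and good: "\<And>y. y \<in> space N \<Longrightarrow> bdd_smooth (2 * CARD('n)) K (\<lambda>(x, \<xi>). a y x \<xi>)"
    and \<phi>: "schwartz \<phi>"
  shows "(\<lambda>y. abs_L2 (pdo (a y) \<phi>)) \<in> borel_measurable N"
proof -
  obtain E :: "(real^'n \<Rightarrow> complex) set" where E: "countable E" "\<And>\<phi>. \<phi> \<in> E \<Longrightarrow> schwartz \<phi>" "closure (abs_L2 ` E) = UNIV"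
    using countable_dense_schwartz by blast
  have [measurable]: "\<phi> \<in> borel_measurable borel" by (rule schwartz_measurable[OF \<phi>])
  have "(\<lambda>(y, p). (\<lambda>(x, \<xi>). a y x \<xi>) p) \<in> borel_measurable (N \<Otimes>\<^sub>M borel)"
  proof (rule caratheodory_measurable[OF D])
    show "continuous_on UNIV (\<lambda>(x, \<xi>). a y x \<xi>)" if "y \<in> space N" for y
      by (rule smooth_continuous_on[OF bdd_smooth_smooth[OF good[OF that]]])
  qed (use meas in auto)
  then have am: "(\<lambda>(y, x, \<xi>). a y x \<xi>) \<in> borel_measurable (N \<Otimes>\<^sub>M (borel \<Otimes>\<^sub>M borel))"
    by (simp add: borel_prod)
  have am2: "(\<lambda>q. a (fst (fst q)) (snd (fst q)) (snd q)) \<in> borel_measurable ((N \<Otimes>\<^sub>M borel) \<Otimes>\<^sub>M lborel)"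
  proof -
    have "(\<lambda>q. (\<lambda>(y, x, \<xi>). a y x \<xi>) (fst (fst q), snd (fst q), snd q)) \<in> borel_measurable ((N \<Otimes>\<^sub>M borel) \<Otimes>\<^sub>M lborel)"
      by (rule measurable_compose[OF _ am]) measurable
    then show ?thesis by simp
  qed
  let ?I = "\<lambda>q. exp (\<i> * of_real (snd (fst q) \<bullet> snd q)) * a (fst (fst q)) (snd (fst q)) (snd q) * fourier \<phi> (snd q)"
  have "?I \<in> borel_measurable ((N \<Otimes>\<^sub>M borel) \<Otimes>\<^sub>M lborel)"
    by (intro borel_measurable_times am2) measurable
  then have "(\<lambda>p. LINT \<xi>|lborel. ?I (p, \<xi>)) \<in> borel_measurable (N \<Otimes>\<^sub>M borel)"
    by (intro lborel.borel_measurable_lebesgue_integral) simp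
  then have "(\<lambda>p. of_real ((2 * pi) powr (- real CARD('n))) * (LINT \<xi>|lborel. ?I (p, \<xi>))) \<in> borel_measurable (N \<Otimes>\<^sub>M borel)"
    by (intro borel_measurable_times borel_measurable_const)
  then have [measurable]: "(\<lambda>(y, x). pdo (a y) \<phi> x) \<in> borel_measurable (N \<Otimes>\<^sub>M borel)"
    by (simp only: pdo_def case_prod_unfold fst_conv snd_conv)
  show ?thesis
  proof (rule borel_measurable_dist_dense[OF _ E(3)])
    show "countable (abs_L2 ` E)" using E(1) by simp
    fix d assume "d \<in> abs_L2 ` E"
    then obtain h where h: "schwartz h" "d = abs_L2 h" using E(2) by blast
    have [measurable]: "h \<in> borel_measurable borel" by (rule schwartz_measurable[OF h(1)])
    have "(\<lambda>y. sqrt (enn2real (\<integral>\<^sup>+x. ennreal ((norm (pdo (a y) \<phi> x - h x))\<^sup>2) \<partial>lborel))) \<in> borel_measurable N"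
      by measurable
    moreover have "sqrt (enn2real (\<integral>\<^sup>+x. ennreal ((norm (pdo (a y) \<phi> x - h x))\<^sup>2) \<partial>lborel)) = dist (abs_L2 (pdo (a y) \<phi>)) d"
      if "y \<in> space N" for y
      unfolding h(2) using nn_integral_abs_L2_diff[OF pdo_schwartz_bound(1)[OF good[OF that] \<phi>] schwartz_square_integrable[OF h(1)]]
      by simp
    ultimately show "(\<lambda>y. dist (abs_L2 (pdo (a y) \<phi>)) d) \<in> borel_measurable N"
      by (subst measurable_cong[of N _ "\<lambda>y. sqrt (enn2real (\<integral>\<^sup>+x. ennreal ((norm (pdo (a y) \<phi> x - h x))\<^sup>2) \<partial>lborel))"]) auto
  qed
qed

text \<open>The value \<open>u y\<close> is replaced by the first member of a countable dense family
  at distance below 1 / (k + 1). Its index is a measurable function into a countable set, so fixed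
  Schwartz functions suffice on each piece, and the extension by continuity gives the limit.\<close>

lemma pdo_L2_measurable:
  fixes a :: "'y \<Rightarrow> real^'n \<Rightarrow> real^'n \<Rightarrow> complex"
  assumes D: "countable D" "closure D = UNIV"
    and meas: "\<And>x \<xi>. (x, \<xi>) \<in> D \<Longrightarrow> (\<lambda>y. a y x \<xi>) \<in> borel_measurable N"
    and good: "\<And>y. y \<in> space N \<Longrightarrow> bdd_smooth (2 * CARD('n)) K (\<lambda>(x, \<xi>). a y x \<xi>)"
    and u: "u \<in> borel_measurable N"
  shows "(\<lambda>y. pdo_L2 (a y) (u y)) \<in> borel_measurable N"
proof -
  obtain E :: "(real^'n \<Rightarrow> complex) set" where E: "countable E" "\<And>\<phi>. \<phi> \<in> E \<Longrightarrow> schwartz \<phi>" "closure (abs_L2 ` E) = UNIV"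
    using countable_dense_schwartz by blast
  have ne: "E \<noteq> {}" using E(3) by auto
  define e where "e = from_nat_into E"
  have e: "schwartz (e i)" for i unfolding e_def by (intro E(2) from_nat_into[OF ne])
  define idx where "idx k y = (LEAST i. dist (u y) (abs_L2 (e i)) < 1 / real (Suc k))" for k y
  have idx: "dist (u y) (abs_L2 (e (idx k y))) < 1 / real (Suc k)" for k y
  proof -
    have "u y \<in> closure (abs_L2 ` E)" using E(3) by simp
    then obtain x where "x \<in> E" "dist (abs_L2 x) (u y) < 1 / real (Suc k)"
      unfolding closure_approachable by (auto dest!: spec[of _ "1 / real (Suc k)"])
    then have "\<exists>i. dist (u y) (abs_L2 (e i)) < 1 / real (Suc k)"
      unfolding e_def by (metis E(1) dist_commute from_nat_into_surj)
    then show ?thesis unfolding idx_def by (rule LeastI_ex)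
  qed
  note [measurable] = borel_measurable_dist_const[OF u]
  have idx_meas [measurable]: "idx k \<in> N \<rightarrow>\<^sub>M count_space UNIV" for k
    unfolding idx_def[abs_def] by measurable
  have fk: "(\<lambda>y. abs_L2 (pdo (a y) (e (idx k y)))) \<in> borel_measurable N" for k
    by (rule measurable_compose_countable[OF abs_L2_pdo_measurable[OF D meas good e] idx_meas])
  show ?thesis
  proof (rule borel_measurable_LIMSEQ_metric[OF fk])
    fix y assume y: "y \<in> space N"
    have "(\<lambda>k. abs_L2 (e (idx k y))) \<longlonglongrightarrow> u y"
      by (rule tendsto_dist_iff[THEN iffD2], rule tendsto_sandwich[OF _ _ tendsto_const LIMSEQ_Suc[OF lim_1_over_n]])
         (auto intro!: always_eventually less_imp_le idx simp: dist_commute simp del: of_nat_Suc)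
    then show "(\<lambda>k. abs_L2 (pdo (a y) (e (idx k y)))) \<longlonglongrightarrow> pdo_L2 (a y) (u y)"
      by (intro pdo_L2_tendsto[OF good[OF y]] e)
  qed
qed

lemma bdd_smooth_zero: "0 \<le> K \<Longrightarrow> bdd_smooth k K (\<lambda>_::'a::euclidean_space. 0)"
proof -
  have *: "partial_derivs bs (\<lambda>_::'a. 0 :: complex) = (\<lambda>_. 0)" for bs
    by (induction bs) (auto intro!: ext partial_deriv_eqI)
  assume "0 \<le> K"
  then show ?thesis by (auto simp: bdd_smooth_def smooth_def *)
qed

text \<open>Off G the symbol is replaced by 0, itself a bounded smooth symbol, so that the uniform
  hypothesis holds at every point; the change is undone by completeness.\<close>

lemma pdo_L2_measurable_on:
  fixes a :: "'y \<Rightarrow> real^'n \<Rightarrow> real^'n \<Rightarrow> complex"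
  assumes D: "countable D" "closure D = UNIV"
    and meas: "\<And>x \<xi>. (x, \<xi>) \<in> D \<Longrightarrow> (\<lambda>y. a y x \<xi>) \<in> borel_measurable N"
    and G: "G \<in> sets N" and sub: "\<And>B. B \<subseteq> space N - G \<Longrightarrow> B \<in> sets N"
    and good: "\<And>y. y \<in> G \<Longrightarrow> bdd_smooth (2 * CARD('n)) K (\<lambda>(x, \<xi>). a y x \<xi>)"
    and K: "0 \<le> K" and u: "u \<in> borel_measurable N"
  shows "(\<lambda>y. pdo_L2 (a y) (u y)) \<in> borel_measurable N"
proof (rule borel_measurable_modify_null[OF _ G _ sub])
  let ?a = "\<lambda>y x \<xi>. if y \<in> G then a y x \<xi> else 0"
  show "(\<lambda>y. pdo_L2 (?a y) (u y)) \<in> borel_measurable N"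
  proof (rule pdo_L2_measurable[OF D _ _ u])
    show "(\<lambda>y. ?a y x \<xi>) \<in> borel_measurable N" if "(x, \<xi>) \<in> D" for x \<xi>
      using meas[OF that] G by measurable
    show "bdd_smooth (2 * CARD('n)) K (\<lambda>(x, \<xi>). ?a y x \<xi>)" for y
      using good[of y] bdd_smooth_zero[OF K] by (cases "y \<in> G") (auto simp: case_prod_unfold)
  qed
qed auto

section \<open>Symbols of class \<open>S\<^sup>0\<^sub>\<infinity>\<close>\<close>

text \<open>The essential supremum of the dominating process is finite and turns the random bound
  into a deterministic one; the power of 1 + norm \<xi> has exponent at most 0 and is at most
  1.\<close>

lemma S0_infty_derivative_bound:
  fixes a :: "real \<Rightarrow> 'w \<Rightarrow> real^'n \<Rightarrow> real^'n \<Rightarrow> complex"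
  assumes a: "a \<in> S0_infty M F T" and cs: "set cs \<subseteq> Basis"
  obtains K where "AE p in time_prob M T. \<forall>z. norm (partial_derivs cs (\<lambda>(x, \<xi>). a (fst p) (snd p) x \<xi>) z) \<le> K"
proof -
  obtain \<alpha> \<beta> :: "'n multiindex" where \<alpha>\<beta>: "\<And>\<sigma> x \<xi>. smooth (\<lambda>(x, \<xi>). \<sigma> x \<xi>) \<Longrightarrow>
      partial_derivs cs (\<lambda>(x, \<xi>). \<sigma> x \<xi>) (x, \<xi>) = symbol_deriv \<alpha> \<beta> \<sigma> x \<xi>"
    using partial_derivs_symbol_deriv[OF cs] by blast
  obtain m :: "real \<Rightarrow> 'w \<Rightarrow> real" where m: "m \<in> LqF M F T \<infinity>" "\<forall>t \<omega>. 0 \<le> m t \<omega>"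
    "AE (t, \<omega>) in time_prob M T. \<forall>x \<xi>. norm (symbol_deriv \<alpha> \<beta> (a t \<omega>) x \<xi>)
             \<le> m t \<omega> * (1 + norm \<xi>) powr (- real (multiindex_order \<alpha>))"
    using a unfolding S0_infty_def by blast
  have sm: "AE (t, \<omega>) in time_prob M T. smooth (\<lambda>(x, \<xi>). a t \<omega> x \<xi>)"
    using a unfolding S0_infty_def by blast
  define e where "e = esssup (time_prob M T) (\<lambda>(t, \<omega>). ennreal (norm (m t \<omega>)))"
  have e: "e < \<infinity>" using m(1) by (simp add: LqF_def e_def)
  have "AE p in time_prob M T. (\<lambda>(t, \<omega>). ennreal (norm (m t \<omega>))) p \<le> e"
    unfolding e_def by (rule esssup_AE)
  with m(3) sm have "AE p in time_prob M T. \<forall>z. norm (partial_derivs cs (\<lambda>(x, \<xi>). a (fst p) (snd p) x \<xi>) z) \<le> enn2real e"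
  proof eventually_elim
    fix p assume "case p of (t, \<omega>) \<Rightarrow> \<forall>x \<xi>. norm (symbol_deriv \<alpha> \<beta> (a t \<omega>) x \<xi>)
             \<le> m t \<omega> * (1 + norm \<xi>) powr (- real (multiindex_order \<alpha>))"
      and "case p of (t, \<omega>) \<Rightarrow> smooth (\<lambda>(x, \<xi>). a t \<omega> x \<xi>)"
      and "(case p of (t, \<omega>) \<Rightarrow> ennreal (norm (m t \<omega>))) \<le> e"
    then obtain t \<omega> where p: "p = (t, \<omega>)"
      and b: "\<And>x \<xi>. norm (symbol_deriv \<alpha> \<beta> (a t \<omega>) x \<xi>) \<le> m t \<omega> * (1 + norm \<xi>) powr (- real (multiindex_order \<alpha>))"
      and s: "smooth (\<lambda>(x, \<xi>). a t \<omega> x \<xi>)" and me: "ennreal (norm (m t \<omega>)) \<le> e"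
      by (cases p) auto
    have me': "m t \<omega> \<le> enn2real e"
      using me e m(2) by (metis abs_of_nonneg enn2real_ennreal enn2real_mono infinity_ennreal_def norm_ge_zero real_norm_def)
    have "norm (partial_derivs cs (\<lambda>(x, \<xi>). a t \<omega> x \<xi>) (x, \<xi>)) \<le> enn2real e" for x \<xi>
    proof -
      have "(1 + norm \<xi>) powr (- real (multiindex_order \<alpha>)) \<le> 1"
        using ge_one_powr_ge_zero[of "1 + norm \<xi>" "real (multiindex_order \<alpha>)"]
        by (simp add: powr_minus inverse_le_1_iff)
      then have "m t \<omega> * (1 + norm \<xi>) powr (- real (multiindex_order \<alpha>)) \<le> m t \<omega> * 1"
        using m(2) by (intro mult_left_mono) auto
      with b[of x \<xi>] me' show ?thesis unfolding \<alpha>\<beta>[OF s] by linarith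
    qed
    then show "\<forall>z. norm (partial_derivs cs (\<lambda>(x, \<xi>). a (fst p) (snd p) x \<xi>) z) \<le> enn2real e"
      by (auto simp: p)
  qed
  then show ?thesis by (rule that)
qed

text \<open>Only finitely many lists of directions have length at most k; the sum of the absolute
  values of their constants serves them all outside one null set.\<close>

lemma S0_infty_bdd_smooth:
  fixes a :: "real \<Rightarrow> 'w \<Rightarrow> real^'n \<Rightarrow> real^'n \<Rightarrow> complex"
  assumes a: "a \<in> S0_infty M F T"
  obtains K where "0 \<le> K" "AE p in time_prob M T. bdd_smooth k K (\<lambda>(x, \<xi>). a (fst p) (snd p) x \<xi>)"
proof -
  let ?L = "{cs :: ((real^'n) \<times> (real^'n)) list. set cs \<subseteq> Basis \<and> length cs \<le> k}"
  have fin: "finite ?L" by (rule finite_lists_length_le) simp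
  have "\<forall>cs\<in>?L. \<exists>K. AE p in time_prob M T. \<forall>z. norm (partial_derivs cs (\<lambda>(x, \<xi>). a (fst p) (snd p) x \<xi>) z) \<le> K"
    using S0_infty_derivative_bound[OF a] by blast
  from bchoice[OF this] obtain Kf where
    Kf: "\<forall>cs\<in>?L. AE p in time_prob M T. \<forall>z. norm (partial_derivs cs (\<lambda>(x, \<xi>). a (fst p) (snd p) x \<xi>) z) \<le> Kf cs"
    by (elim exE)
  let ?K = "\<Sum>cs\<in>?L. \<bar>Kf cs\<bar>"
  have sm: "AE p in time_prob M T. smooth (\<lambda>(x, \<xi>). a (fst p) (snd p) x \<xi>)"
    using a unfolding S0_infty_def by (simp add: case_prod_unfold)
  have "AE p in time_prob M T. \<forall>cs\<in>?L. \<forall>z. norm (partial_derivs cs (\<lambda>(x, \<xi>). a (fst p) (snd p) x \<xi>) z) \<le> Kf cs"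
    unfolding AE_ball_countable[OF countable_finite[OF fin]] by (rule Kf)
  with sm have "AE p in time_prob M T. bdd_smooth k ?K (\<lambda>(x, \<xi>). a (fst p) (snd p) x \<xi>)"
  proof eventually_elim
    fix p assume s: "smooth (\<lambda>(x, \<xi>). a (fst p) (snd p) x \<xi>)"
      and *: "\<forall>cs\<in>?L. \<forall>z. norm (partial_derivs cs (\<lambda>(x, \<xi>). a (fst p) (snd p) x \<xi>) z) \<le> Kf cs"
    have "norm (partial_derivs cs (\<lambda>(x, \<xi>). a (fst p) (snd p) x \<xi>) z) \<le> ?K" if "cs \<in> ?L" for cs z
    proof -
      have "norm (partial_derivs cs (\<lambda>(x, \<xi>). a (fst p) (snd p) x \<xi>) z) \<le> Kf cs" using * that by blast
      also have "\<dots> \<le> \<bar>Kf cs\<bar>" by simp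
      also have "\<dots> \<le> ?K" by (rule member_le_sum[OF that _ fin]) simp
      finally show ?thesis .
    qed
    then show "bdd_smooth k ?K (\<lambda>(x, \<xi>). a (fst p) (snd p) x \<xi>)"
      using s by (auto simp: bdd_smooth_def)
  qed
  moreover have "0 \<le> ?K" by (intro sum_nonneg) auto
  ultimately show ?thesis using that by blast
qed

section \<open>Bounded pointwise operators on adapted processes\<close>

lemma LqF_pointwise_bound:
  fixes u :: "real \<Rightarrow> 'w \<Rightarrow> 'h::banach" and v :: "real \<Rightarrow> 'w \<Rightarrow> 'h2::banach"
  assumes q: "1 \<le> q" and C: "0 \<le> C" and u: "u \<in> LqF M F T q" and v: "adapted_process M F T v"
    and le: "AE p in time_prob M T. norm (v (fst p) (snd p)) \<le> C * norm (u (fst p) (snd p))"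
  shows "v \<in> LqF M F T q" "LqF_norm M T q v \<le> C * LqF_norm M T q u"
proof -
  let ?N = "time_prob M T"
  have norm_meas: "(\<lambda>p. norm (w (fst p) (snd p))) \<in> borel_measurable ?N" if "adapted_process M F T w"
    for w :: "real \<Rightarrow> 'w \<Rightarrow> 'h3::real_normed_vector"
  proof -
    have "(\<lambda>(t, \<omega>). w t \<omega>) \<in> borel_measurable ?N" using that by (simp add: adapted_process_def)
    from measurable_compose[OF this borel_measurable_continuous_onI[OF continuous_on_norm[OF continuous_on_id]]]
    show ?thesis by (simp add: case_prod_unfold)
  qed
  have [measurable]: "(\<lambda>p. norm (v (fst p) (snd p))) \<in> borel_measurable ?N" by (rule norm_meas[OF v])
  have "v \<in> LqF M F T q \<and> LqF_norm M T q v \<le> C * LqF_norm M T q u"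
  proof (cases "q = \<infinity>")
    case True
    define su where "su = esssup ?N (\<lambda>p. ennreal (norm (u (fst p) (snd p))))"
    have su: "su < \<infinity>" using u True by (simp add: LqF_def su_def case_prod_unfold)
    have bound: "esssup ?N (\<lambda>p. ennreal (norm (v (fst p) (snd p)))) \<le> ennreal C * su"
    proof (rule esssup_I)
      show "AE p in ?N. ennreal (norm (v (fst p) (snd p))) \<le> ennreal C * su"
        using le esssup_AE[of "\<lambda>p. ennreal (norm (u (fst p) (snd p)))" ?N]
      proof eventually_elim
        fix p assume *: "norm (v (fst p) (snd p)) \<le> C * norm (u (fst p) (snd p))"
          "ennreal (norm (u (fst p) (snd p))) \<le> esssup ?N (\<lambda>p. ennreal (norm (u (fst p) (snd p))))"
        have "ennreal (norm (v (fst p) (snd p))) \<le> ennreal C * ennreal (norm (u (fst p) (snd p)))"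
          using * C by (simp add: ennreal_mult[symmetric])
        also have "\<dots> \<le> ennreal C * su" unfolding su_def by (intro mult_left_mono *) auto
        finally show "ennreal (norm (v (fst p) (snd p))) \<le> ennreal C * su" .
      qed
    qed measurable
    have fin: "ennreal C * su < \<infinity>" using su by (simp add: ennreal_mult_less_top)
    have "enn2real (esssup ?N (\<lambda>p. ennreal (norm (v (fst p) (snd p))))) \<le> enn2real (ennreal C * su)"
      using bound fin by (intro enn2real_mono) auto
    then show ?thesis
      using v True bound fin C by (auto simp: LqF_def LqF_norm_def case_prod_unfold enn2real_mult su_def)
  next
    case False
    define r where "r = enn2real q"
    have r: "1 \<le> r"
      using q False unfolding r_def by (cases q) (auto simp: ennreal_1[symmetric] simp del: ennreal_1)
    have ui: "integrable ?N (\<lambda>p. norm (u (fst p) (snd p)) powr r)"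
      using u False by (simp add: LqF_def case_prod_unfold r_def)
    have le': "AE p in ?N. norm (v (fst p) (snd p)) powr r \<le> C powr r * norm (u (fst p) (snd p)) powr r"
      using le
    proof eventually_elim
      fix p assume "norm (v (fst p) (snd p)) \<le> C * norm (u (fst p) (snd p))"
      then have "norm (v (fst p) (snd p)) powr r \<le> (C * norm (u (fst p) (snd p))) powr r"
        using r by (intro powr_mono2) auto
      then show "norm (v (fst p) (snd p)) powr r \<le> C powr r * norm (u (fst p) (snd p)) powr r"
        using C by (simp add: powr_mult)
    qed
    have vi: "integrable ?N (\<lambda>p. norm (v (fst p) (snd p)) powr r)"
      by (rule Bochner_Integration.integrable_bound[OF integrable_mult_right[OF ui, of "C powr r"]])
         (use le' in auto)
    have "(\<integral>p. norm (v (fst p) (snd p)) powr r \<partial>?N) \<le> (\<integral>p. C powr r * norm (u (fst p) (snd p)) powr r \<partial>?N)"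
      by (rule integral_mono_AE[OF vi integrable_mult_right[OF ui] le'])
    then have "(\<integral>p. norm (v (fst p) (snd p)) powr r \<partial>?N) powr (1 / r)
        \<le> (C powr r * (\<integral>p. norm (u (fst p) (snd p)) powr r \<partial>?N)) powr (1 / r)"
      using r by (intro powr_mono2) (auto intro!: integral_nonneg_AE)
    also have "\<dots> = C * (\<integral>p. norm (u (fst p) (snd p)) powr r \<partial>?N) powr (1 / r)"
      using r C by (subst powr_mult) (auto intro!: integral_nonneg_AE simp: powr_powr)
    finally show ?thesis
      using v vi False by (simp add: LqF_def LqF_norm_def case_prod_unfold r_def)
  qed
  then show "v \<in> LqF M F T q" "LqF_norm M T q v \<le> C * LqF_norm M T q u" by auto
qed

text \<open>Completion does not change which properties hold almost everywhere, so Fubini's theorem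
  for null sets of the product applies.\<close>

lemma time_prob_AE_sections:
  assumes "prob_space M" and "AE p in time_prob M T. P p"
  shows "AE t in restrict_space lborel {0<..<T}. AE \<omega> in M. P (t, \<omega>)"
proof -
  interpret M: prob_space M by fact
  interpret R: sigma_finite_measure "restrict_space lborel {0<..<T}"
    by (rule sigma_finite_measure_restrict_space[OF sigma_finite_lborel]) auto
  interpret pair_sigma_finite "restrict_space lborel {0<..<T}" M ..
  from assms(2) have "AE p in restrict_space lborel {0<..<T} \<Otimes>\<^sub>M M. P p"
    unfolding time_prob_def by (rule AE_completion_iff[THEN iffD1])
  from AE_pair[OF this] show ?thesis .
qed

text \<open>\<open>pdo_L2_measurable_on\<close> is used twice: on the completed product for joint
  measurability, and on \<open>F t\<close> for almost every fixed t.\<close>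

lemma stochastic_pdo_adapted:
  fixes a :: "real \<Rightarrow> 'w \<Rightarrow> real^'n \<Rightarrow> real^'n \<Rightarrow> complex"
  assumes "complete_filtered_prob_space M F" and a: "a \<in> S0_infty M F T"
    and u: "adapted_process M F T u"
  shows "adapted_process M F T (stochastic_pdo a u)"
proof -
  interpret complete_filtered_prob_space M F by fact
  let ?n2 = "2 * CARD('n)"
  obtain K where K: "0 \<le> K" "AE p in time_prob M T. bdd_smooth ?n2 K (\<lambda>(x, \<xi>). a (fst p) (snd p) x \<xi>)"
    using S0_infty_bdd_smooth[OF a, of ?n2] by blast
  obtain D :: "((real^'n) \<times> (real^'n)) set" where D: "countable D" "closure D = UNIV"
  proof -
    obtain D :: "((real^'n) \<times> (real^'n)) set" where "countable D" "\<And>X. open X \<Longrightarrow> X \<noteq> {} \<Longrightarrow> \<exists>d\<in>D. d \<in> X"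
      by (rule countable_dense_setE) blast
    moreover from this(2) have "\<exists>d\<in>D. dist d p < e" if "0 < e" for p e
      using that by (metis dist_commute mem_ball open_ball centre_in_ball empty_iff)
    then have "closure D = UNIV" by (auto simp: closure_approachable)
    ultimately show thesis using that by blast
  qed
  have am: "adapted_process M F T (\<lambda>t \<omega>. a t \<omega> x \<xi>)" for x \<xi>
    using a unfolding S0_infty_def by blast
  have "(\<lambda>(t, \<omega>). stochastic_pdo a u t \<omega>) \<in> borel_measurable (time_prob M T)"
  proof -
    let ?N = "time_prob M T"
    define G where "G = {p \<in> space ?N. bdd_smooth ?n2 K (\<lambda>(x, \<xi>). a (fst p) (snd p) x \<xi>)}"
    \<comment> \<open>Subsets of the exceptional null set are measurable because
      \<open>time_prob\<close> is a completion.\<close>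
    have sub: "B \<in> sets ?N" if "B \<subseteq> space ?N - G" for B
    proof -
      have "AE p in restrict_space lborel {0<..<T} \<Otimes>\<^sub>M M. \<not> p \<in> B"
        using K(2) that unfolding time_prob_def AE_completion_iff
        by (rule_tac eventually_mono) (auto simp: G_def time_prob_def)
      from sets_completion_AE[OF this] have "{p \<in> space ?N. p \<in> B} \<in> sets ?N"
        by (simp add: pred_def time_prob_def)
      moreover have "{p \<in> space ?N. p \<in> B} = B" using that by auto
      ultimately show ?thesis by simp
    qed
    have "space ?N - (space ?N - G) \<in> sets ?N" by (rule sets.compl_sets[OF sub]) simp
    moreover have "space ?N - (space ?N - G) = G" by (auto simp: G_def)
    ultimately have G: "G \<in> sets ?N" by simp
    have "(\<lambda>p. pdo_L2 (a (fst p) (snd p)) (u (fst p) (snd p))) \<in> borel_measurable ?N"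
    proof (rule pdo_L2_measurable_on[OF D _ G sub _ K(1)])
      show "(\<lambda>p. a (fst p) (snd p) x \<xi>) \<in> borel_measurable ?N" for x \<xi>
        using am[of x \<xi>] by (simp add: adapted_process_def case_prod_unfold)
      show "bdd_smooth ?n2 K (\<lambda>(x, \<xi>). a (fst p) (snd p) x \<xi>)" if "p \<in> G" for p using that by (simp add: G_def)
      show "(\<lambda>p. u (fst p) (snd p)) \<in> borel_measurable ?N"
        using u by (simp add: adapted_process_def case_prod_unfold)
    qed
    then show ?thesis by (simp add: stochastic_pdo_def case_prod_unfold)
  qed
  moreover have "AE t in restrict_space lborel {0<..<T}. stochastic_pdo a u t \<in> borel_measurable (F t)"
  proof -
    have uF: "AE t in restrict_space lborel {0<..<T}. u t \<in> borel_measurable (F t)"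
      using u by (simp add: adapted_process_def)
    \<comment> \<open>The exceptional times depend on (x, \<xi>); restriction to the countable set D
      leaves one null set of times for all points.\<close>
    have aF: "AE t in restrict_space lborel {0<..<T}. \<forall>p\<in>D. (\<lambda>\<omega>. a t \<omega> (fst p) (snd p)) \<in> borel_measurable (F t)"
      using am by (subst AE_ball_countable[OF D(1)]) (auto simp: adapted_process_def)
    have gF: "AE t in restrict_space lborel {0<..<T}. AE \<omega> in M. bdd_smooth ?n2 K (\<lambda>(x, \<xi>). a t \<omega> x \<xi>)"
      using time_prob_AE_sections[OF prob_space_axioms K(2)] by simp
    show ?thesis
      using uF aF gF AE_space
    proof eventually_elim
      fix t assume ut: "u t \<in> borel_measurable (F t)"
        and at: "\<forall>p\<in>D. (\<lambda>\<omega>. a t \<omega> (fst p) (snd p)) \<in> borel_measurable (F t)"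
        and good: "AE \<omega> in M. bdd_smooth ?n2 K (\<lambda>(x, \<xi>). a t \<omega> x \<xi>)"
        and "t \<in> space (restrict_space lborel {0<..<T})"
      then have t: "0 \<le> t" by (simp add: space_restrict_space)
      have sp: "space (F t) = space M" using subalgebra_F[OF t] by (simp add: subalgebra_def)
      define G where "G = {\<omega> \<in> space M. bdd_smooth ?n2 K (\<lambda>(x, \<xi>). a t \<omega> x \<xi>)}"
      obtain Z where Z: "Z \<in> null_sets M" "space M - G \<subseteq> Z"
        using good unfolding G_def eventually_ae_filter by auto
      \<comment> \<open>Completeness of M makes B a null set of M; such sets belong to
        \<open>F 0\<close> and hence to \<open>F t\<close>.\<close>
      have sub: "B \<in> sets (F t)" if B: "B \<subseteq> space (F t) - G" for B
      proof -
        have "B \<subseteq> Z" using B Z(2) sp by auto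
        then have "B \<in> null_sets M" using complete2[OF _ Z(1)] by blast
        then show ?thesis using null_sets_F F_mono[OF order_refl t] by blast
      qed
      have "space (F t) - (space (F t) - G) \<in> sets (F t)" by (rule sets.compl_sets[OF sub]) simp
      moreover have "space (F t) - (space (F t) - G) = G" by (auto simp: G_def sp)
      ultimately have G: "G \<in> sets (F t)" by simp
      show "stochastic_pdo a u t \<in> borel_measurable (F t)"
        unfolding stochastic_pdo_def[abs_def]
        by (rule pdo_L2_measurable_on[OF D _ G sub _ K(1) ut]) (use at in \<open>auto simp: G_def\<close>)
    qed
  qed
  ultimately show ?thesis by (simp add: adapted_process_def)
qed

theorem theorem3p1:
  fixes M :: "'w measure" and F :: "real \<Rightarrow> 'w measure" and T :: real and q :: ennreal
    and a :: "real \<Rightarrow> 'w \<Rightarrow> real^'n \<Rightarrow> real^'n \<Rightarrow> complex"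
  assumes "complete_filtered_prob_space M F"
    and "0 < T"
    and "1 \<le> q"
    and "a \<in> S0_infty M F T"
  shows "stochastic_pdo_well_defined M T a \<and>
         bounded_operator_LqF M F T q (stochastic_pdo a)"
proof -
  let ?C = "pdo_const TYPE('n)"
  \<comment> \<open>K and its null set come from the symbol alone, so the pointwise bound and the
    linearity hold for all processes with the same constant.\<close>
  obtain K where K: "0 \<le> K" "AE p in time_prob M T. bdd_smooth (2 * CARD('n)) K (\<lambda>(x, \<xi>). a (fst p) (snd p) x \<xi>)"
    using S0_infty_bdd_smooth[OF assms(4), of "2 * CARD('n)"] by blast
  have C: "0 \<le> ?C * K" using K(1) by (simp add: pdo_const_def)
  have bound: "stochastic_pdo a u \<in> LqF M F T q \<and> LqF_norm M T q (stochastic_pdo a u) \<le> ?C * K * LqF_norm M T q u"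
    if u: "u \<in> LqF M F T q" for u
  proof -
    have "adapted_process M F T (stochastic_pdo a u)"
      using u by (intro stochastic_pdo_adapted assms) (simp add: LqF_def)
    moreover have "AE p in time_prob M T. norm (stochastic_pdo a u (fst p) (snd p)) \<le> ?C * K * norm (u (fst p) (snd p))"
      using K(2) by eventually_elim (simp add: stochastic_pdo_def norm_pdo_L2_le)
    ultimately show ?thesis using LqF_pointwise_bound[OF assms(3) C u] by blast
  qed
  have "stochastic_pdo_well_defined M T a"
    unfolding stochastic_pdo_well_defined_def
    using K(2)
  proof eventually_elim
    fix p assume "bdd_smooth (2 * CARD('n)) K (\<lambda>(x, \<xi>). a (fst p) (snd p) x \<xi>)"
    from pdo_extends_to_ex1[OF this] show "case p of (t, \<omega>) \<Rightarrow> \<forall>f. \<exists>!g. pdo_extends_to (a t \<omega>) f g"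
      by (simp add: case_prod_unfold)
  qed
  moreover have "AE (t, \<omega>) in time_prob M T.
        stochastic_pdo a (\<lambda>t \<omega>. u t \<omega> + v t \<omega>) t \<omega> = stochastic_pdo a u t \<omega> + stochastic_pdo a v t \<omega>" for u v
    using K(2) by eventually_elim (simp add: case_prod_unfold stochastic_pdo_def pdo_L2_add)
  moreover have "AE (t, \<omega>) in time_prob M T.
        stochastic_pdo a (\<lambda>t \<omega>. scaleC_L2 c (u t \<omega>)) t \<omega> = scaleC_L2 c (stochastic_pdo a u t \<omega>)" for c u
    using K(2) by eventually_elim (simp add: case_prod_unfold stochastic_pdo_def pdo_L2_scaleC)
  ultimately show ?thesis
    using bound C unfolding bounded_operator_LqF_def by blast
qed

end
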